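(* Consider largest gap routing, i.e. the total picking time $$T=\sum_{i=1}^{M}P_i+\frac{2l}v\sum_{i=k^-+1}^{k^+-1}(1-D_i)+\frac{2l}v+\frac2vw_a(k^+-1),$$ and let $S=\sum_{i=k^-+1}^{k^+-1}(1-D_i)$. Then $$\mathbb{E}[T]=\mathbb{E}[M]\mathbb{E}[P]+\frac{2l}v\mathbb{E}[S]+\frac{2w_a}v\big(\mathbb{E}[k^+]-1\big)+\frac{2l}v$$ and $$\begin{aligned}\mathbb{E}[T^2]&=\mathbb{E}[M(M-1)]\mathbb{E}[P]^2+\mathbb{E}[M]\mathbb{E}[P^2]+\frac{4l^2}{v^2}\mathbb{E}[S^2]+\frac{4w_a^2}{v^2}\Big(\mathbb{E}[(k^+)^2]-2\mathbb{E}[k^+]+1\Big)+\frac{4l^2}{v^2}\\ &\quad+\frac{4l}v\mathbb{E}[P]\,\mathbb{E}[MS]+\frac{4w_a}v\mathbb{E}[P]\Big(\mathbb{E}[Mk^+]-\mathbb{E}[M]\Big)+\frac{8lw_a}{v^2}\Big(\mathbb{E}[k^+S]-\mathbb{E}[S]\Big)+\frac{4l}v\Big(\mathbb{E}[T]-\frac{2l}v\Big).\end{aligned}$$ Here $$\mathbb{E}[k^+]=k-\sum_{r=0}^{k-1}P_M\Big(\frac rk\Big),\quad \mathbb{E}[(k^+)^2]=k^2-\sum_{r=0}^{k-1}(2r+1)P_M\Big(\frac rk\Big),\quad \mathbb{E}[Mk^+]=k\mathbb{E}[M]-\sum_{r=0}^{k-1}\frac rkP_M'\Big(\frac rk\Big),$$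 $$\mathbb{E}[S]=\sum_{m=2}^{k-1}(m-1)(k-m)\,\alpha_m,\qquad \mathbb{E}[k^+S]=\sum_{m=2}^{k-1}\tfrac12(k-m)(k+m+1)(m-1)\,\alpha_m,$$ $$\mathbb{E}[S^2]=\sum_{m=2}^{k-1}(m-1)(k-m)\,\beta_m+\sum_{m=3}^{k-1}(m-1)(m-2)(k-m)\,\gamma_m,$$ $$\mathbb{E}[MS]=\sum_{m=3}^{k-1}(k-m)(m-1)(m-2)\,\delta_m+\sum_{m=2}^{k-1}(k-m)(m-1)\,\epsilon_m+\sum_{m=2}^{k-1}2(k-m)(m-1)\,\zeta_m,$$ where, with $$Q_m(x)=P_M\Big(\frac{m+x}k\Big)-2P_M\Big(\frac{m-1+x}k\Big)+P_M\Big(\frac{m-2+x}k\Big)\quad(m\ge2),$$ $$R_m(x,y)=P_M\Big(\frac{m-1+x+y}k\Big)-2P_M\Big(\frac{m-2+x+y}k\Big)+P_M\Big(\frac{m-3+x+y}k\Big)\quad(m\ge3),$$ $$U_m(x)=\mathbb{E}\big[x^{N_1}\mathbf 1\{k^+=m+1,k^-=1\}\big],$$ and $E_m$ denoting the event $\{k^+=m+1,k^-=1\}$: $$\alpha_m=\mathbb{E}[(1-D_2)\mathbf 1_{E_m}]=Q_m(1)+\int_0^1Q_m(x)\log(1-x)dx,$$ $$\beta_m=\mathbb{E}[(1-D_2)^2\mathbf 1_{E_m}]=Q_m(1)+2\int_0^1Q_m(x)\log(1-x)dx+\int_0^1xQ_m(x)\int_x^1\frac{\log^2(1-y)}{y^2}dy\,dx,$$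 $$\gamma_m=\mathbb{E}[(1-D_2)(1-D_3)\mathbf 1_{E_m}]=Q_m(1)+2\int_0^1Q_m(x)\log(1-x)dx+\int_0^1\!\!\int_0^1\log(1-x)\log(1-y)R_m(x,y)dy\,dx,$$ $$\delta_m=\mathbb{E}[N_3(1-D_2)\mathbf 1_{E_m}]=Q_m'(1)-\int_0^1\frac{Q_m(1)-Q_m(x)}{1-x}dx,$$ $$\epsilon_m=\mathbb{E}[N_2(1-D_2)\mathbf 1_{E_m}]=Q_m'(1)-\int_0^1\log(1-x)Q_m(x)dx-\int_0^1\frac{Q_m(1)-xQ_m(x)}{1-x}dx,$$ $$\zeta_m=\mathbb{E}[N_1(1-D_2)\mathbf 1_{E_m}]=U_m'(1)-\int_0^1\frac{Q_m(1)-Q_m(x)}{1-x}dx.$$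
   Context: Model. $k\ge1$ is an integer (number of aisles, numbered $1,\dots,k$); $l>0$ (aisle length), $w_a>0$ (distance between the middles of adjacent aisles), $v>0$ (walking speed) are constants. The order size $M$ is a nonnegative-integer-valued random variable with $\mathbb{E}[M^2]<\infty$ and probability generating function $P_M(x)=\mathbb{E}[x^M]$ (with $0^0=1$); derivatives at $1$ are one-sided. Given $M$, each of the $M$ items is, independently of the others, placed in an aisle uniformly distributed on $\{1,\dots,k\}$ and, independently, at a location uniformly distributed on $[0,1]$ in that aisle (fraction of the aisle length measured from the front cross-aisle). The item picking times $P_1,P_2,\dots$ are i.i.d. copies of a nonnegative random variable $P$ with $\mathbb{E}[P^2]<\infty$, independent of $M$ and of all item locations. $N_i$ is the number of items in aisle $i$. $k^+=\max\{i:N_i>0\}$ and $k^-=\min\{i:N_i>0\}$ (both $0$ if $M=0$). $D_i$ is the largest gap in aisle $i$: the length of the longest of the $N_i+1$ subintervals into which the item locations divide $[0,1]$ (the gaps to the endpoints $0$ and $1$ included; $D_i=1$ if $N_i=0$). Empty sums are $0$.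
   Formalization: The printed closed form of ζ_m is false (for M=3, k=3, m=2 it gives 1/3 instead of 1/18); the integrand (Q_m(1)-Q_m(x))/(1-x) in ζ_m is replaced by (U_m(1)-U_m(x))/(1-x). *)

theory Defs
  imports "HOL-Probability.Probability"
begin

text \<open>
  Item number \<open>j\<close> (counted from \<open>0\<close>) of the order lies in aisle \<open>A j\<close> at location \<open>X j\<close>, measured
  as a fraction of the aisle length, and has picking time \<open>P j\<close>.  The sequences are infinite and
  independent of the order size \<open>M\<close>; the order consists of the items \<open>j < M\<close>.
  The index type below lists all sources of randomness, so that their joint independence is a
  single \<open>indep_vars\<close> statement.
\<close>

datatype source = Size | Aisle nat | Location nat | Picking nat

fun source_var ::
  "('a \<Rightarrow> nat) \<Rightarrow> (nat \<Rightarrow> 'a \<Rightarrow> nat) \<Rightarrow> (nat \<Rightarrow> 'a \<Rightarrow> real) \<Rightarrow> (nat \<Rightarrow> 'a \<Rightarrow> real) \<Rightarrow> source \<Rightarrow> 'a \<Rightarrow> real"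
where
  "source_var M A X P Size = (\<lambda>\<omega>. real (M \<omega>))"
| "source_var M A X P (Aisle j) = (\<lambda>\<omega>. real (A j \<omega>))"
| "source_var M A X P (Location j) = X j"
| "source_var M A X P (Picking j) = P j"

definition pgf :: "'a measure \<Rightarrow> ('a \<Rightarrow> nat) \<Rightarrow> real \<Rightarrow> real" where
  "pgf \<Omega> M x = (\<integral>\<omega>. x ^ M \<omega> \<partial>\<Omega>)"

text \<open>Derivative of a function on \<open>[0,1]\<close>; one-sided at the endpoints.\<close>

definition unit_deriv :: "(real \<Rightarrow> real) \<Rightarrow> real \<Rightarrow> real" where
  "unit_deriv f x = vector_derivative f (at x within {0..1})"

definition item_count :: "('a \<Rightarrow> nat) \<Rightarrow> (nat \<Rightarrow> 'a \<Rightarrow> nat) \<Rightarrow> nat \<Rightarrow> 'a \<Rightarrow> nat" where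
  "item_count M A i \<omega> = card {j. j < M \<omega> \<and> A j \<omega> = i}"

text \<open>Almost surely this set is empty only if \<open>M \<omega> = 0\<close>.\<close>

definition occupied :: "nat \<Rightarrow> ('a \<Rightarrow> nat) \<Rightarrow> (nat \<Rightarrow> 'a \<Rightarrow> nat) \<Rightarrow> 'a \<Rightarrow> nat set" where
  "occupied k M A \<omega> = {i \<in> {1..k}. item_count M A i \<omega> > 0}"

definition last_aisle :: "nat \<Rightarrow> ('a \<Rightarrow> nat) \<Rightarrow> (nat \<Rightarrow> 'a \<Rightarrow> nat) \<Rightarrow> 'a \<Rightarrow> nat" where
  "last_aisle k M A \<omega> = (if occupied k M A \<omega> = {} then 0 else Max (occupied k M A \<omega>))"

definition first_aisle :: "nat \<Rightarrow> ('a \<Rightarrow> nat) \<Rightarrow> (nat \<Rightarrow> 'a \<Rightarrow> nat) \<Rightarrow> 'a \<Rightarrow> nat" where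
  "first_aisle k M A \<omega> = (if occupied k M A \<omega> = {} then 0 else Min (occupied k M A \<omega>))"

text \<open>The longest of the \<open>length xs + 1\<close> subintervals into which the points \<open>xs\<close> divide \<open>[0,1]\<close>.\<close>

definition longest_gap :: "real list \<Rightarrow> real" where
  "longest_gap xs =
     (let ps = 0 # sort xs @ [1] in Max {ps ! Suc n - ps ! n | n. n \<le> length xs})"

definition largest_gap ::
  "('a \<Rightarrow> nat) \<Rightarrow> (nat \<Rightarrow> 'a \<Rightarrow> nat) \<Rightarrow> (nat \<Rightarrow> 'a \<Rightarrow> real) \<Rightarrow> nat \<Rightarrow> 'a \<Rightarrow> real"
where
  "largest_gap M A X i \<omega> =
     longest_gap (map (\<lambda>j. X j \<omega>) (filter (\<lambda>j. A j \<omega> = i) [0..<M \<omega>]))"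

text \<open>
  Pitfall for \<open>\<zeta>\<^sub>m = E[N\<^sub>1 (1 - D\<^sub>2); E\<^sub>m]\<close>: its closed form needs \<open>U\<^sub>m\<close>, not \<open>Q\<^sub>m\<close>, in the integrand
  \<open>(U\<^sub>m(1) - U\<^sub>m(x)) / (1 - x)\<close>.  Aisle \<open>1\<close> is an extreme aisle and hence nonempty on \<open>E\<^sub>m\<close>, whereas
  \<open>Q\<^sub>m\<close> is the generating function of the count of an inner aisle.  With \<open>Q\<^sub>m\<close> the identity
  fails: for \<open>M = 3\<close>, \<open>k = 3\<close>, \<open>m = 2\<close> the expectation is \<open>1/18\<close>, while
  \<open>U\<^sub>m'(1) - \<integral> (Q\<^sub>m(1) - Q\<^sub>m(x)) / (1 - x) dx = 1/3\<close>.
\<close>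

end

theory Submission
  imports Defs
begin

text \<open>
  Three observations reduce the formulas to bookkeeping.

  \<^item> The placement of the order (its size and the aisles of its items) is a discrete variable
  independent of the locations, so it can be held fixed while averaging over the locations.  Then the
  largest gap of an aisle with \<open>n\<close> items is the longest of the \<open>n + 1\<close> spacings of \<open>n\<close> uniform points.
  Stretching the unit interval to a random Gamma distributed length turns the spacings into
  independent exponential variables \<open>- ln (1 - U\<^sub>j)\<close>, whose maximum is \<open>- ln (1 - max\<^sub>j U\<^sub>j)\<close>, and the
  length is averaged out by homogeneity:
  \<open>(n + p)! / n! * E[D ^ p] = (n + 1) * \<integral> y ^ n * (- ln (1 - y)) ^ p dy\<close> over \<open>[0,1]\<close>.
  For \<open>p = 1, 2\<close> this can be written as \<open>E[D ^ p] = \<integral> w x * x ^ n dx\<close> with a weight \<open>w \<ge> 0\<close> that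
  does not depend on \<open>n\<close> (\<open>gap_moment_weight1\<close>, \<open>gap_moment_weight2\<close>, \<open>expectation_longest_gap\<close>).

  \<^item> As \<open>n\<close> enters only through the power \<open>x ^ n\<close>, averaging over the placement turns the moments of
  the gaps into integrals of generating functions of the item counts.  The event that the occupied
  aisles range exactly from \<open>a\<close> to \<open>b\<close> is an inclusion-exclusion combination of four events of the
  form ``all items lie in a set \<open>B\<close> of aisles'', and for these \<open>E[\<Prod>\<^sub>j w (A\<^sub>j)]\<close> is the generating
  function of the order size at the mean weight (\<open>expectation_spans\<close>).  The results depend on \<open>a\<close>
  and \<open>b\<close> through \<open>m = b - a\<close> only.  So the sums over the position of the span and over the inner
  aisles merely count: \<open>k - m\<close> positions, \<open>m - 1\<close> inner aisles.  A factor \<open>N\<^sub>c\<close> differentiates the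
  generating function, and \<open>\<integral> - ln (1 - x) * n * x ^ (n - 1) dx = \<integral> (1 - x ^ n) / (1 - x) dx\<close> removes
  the derivative under the integral (\<open>expectation_geometric_quotient\<close>).

  \<^item> The picking times are independent of everything else, so in a product of their sum with a
  function of placement and locations each of them contributes its mean, and the sum contributes a
  factor \<open>M\<close> (\<open>expectation_total_picking_mult\<close>).  Expanding \<open>T\<close> and \<open>T\<^sup>2\<close> is then linearity.
\<close>

section \<open>The longest gap as a function of the sorted points\<close>

text \<open>
  The longest gap among the increasing points \<open>xs\<close> of \<open>[a,1]\<close>.  Splitting off the leftmost point
  leaves a problem of the same kind on a shorter interval, which is what the integration over the
  points follows.
\<close>

fun gap_from :: "real \<Rightarrow> real list \<Rightarrow> real" where
  "gap_from a [] = 1 - a"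
| "gap_from a (x # xs) = max (x - a) (gap_from x xs)"

lemma Max_consecutive_differences:
  "Max {(a # ys @ [1]) ! Suc n - (a # ys @ [1]) ! n | n. n \<le> length ys} = gap_from a ys"
proof (induction ys arbitrary: a)
  case Nil
  have "{(a # [] @ [1]) ! Suc n - (a # [] @ [1]) ! n | n. n \<le> length ([] :: real list)} = {1 - a}"
    by auto
  then show ?case by simp
next
  case (Cons y ys)
  let ?B = "{(y # ys @ [1]) ! Suc n - (y # ys @ [1]) ! n | n. n \<le> length ys}"
  have "{(a # (y # ys) @ [1]) ! Suc n - (a # (y # ys) @ [1]) ! n | n. n \<le> length (y # ys)}
      = (\<lambda>n. (a # (y # ys) @ [1]) ! Suc n - (a # (y # ys) @ [1]) ! n) ` {..Suc (length ys)}"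
    by auto
  also have "\<dots> = insert (y - a) ?B"
    by (subst atMost_Suc_eq_insert_0) (auto simp: image_image)
  finally have "Max {(a # (y # ys) @ [1]) ! Suc n - (a # (y # ys) @ [1]) ! n | n. n \<le> length (y # ys)}
      = Max (insert (y - a) ?B)" by simp
  also have "\<dots> = max (y - a) (Max ?B)"
    by (rule Max_insert) auto
  finally show ?case using Cons.IH[of y] by simp
qed

lemma longest_gap_eq_gap_from: "longest_gap xs = gap_from 0 (sort xs)"
  using Max_consecutive_differences[of 0 "sort xs"] by (simp add: longest_gap_def Let_def)

lemma gap_from_bounds:
  "sorted (a # xs) \<Longrightarrow> \<forall>x\<in>set (a # xs). x \<le> 1 \<Longrightarrow> 0 \<le> gap_from a xs \<and> gap_from a xs \<le> 1 - a"
proof (induction xs arbitrary: a)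
  case (Cons x xs)
  then show ?case using Cons.IH[of x] by fastforce
qed simp

lemma longest_gap_bounds:
  assumes "set xs \<subseteq> {0..1}"
  shows "0 \<le> longest_gap xs" "longest_gap xs \<le> 1"
proof -
  have "\<forall>x\<in>set xs. 0 \<le> x \<and> x \<le> 1" using assms by auto
  then have "0 \<le> gap_from 0 (sort xs) \<and> gap_from 0 (sort xs) \<le> 1 - 0"
    by (intro gap_from_bounds) auto
  then show "0 \<le> longest_gap xs" "longest_gap xs \<le> 1"
    by (auto simp: longest_gap_eq_gap_from)
qed

text \<open>
  Insertion sort carried out pointwise on a list of functions: \<open>min\<close> and \<open>max\<close> replace the
  comparison, so the result is one list of functions, the order statistics, and these are
  measurable because \<open>min\<close> and \<open>max\<close> are.
\<close>

fun insort_fun :: "('a \<Rightarrow> real) \<Rightarrow> ('a \<Rightarrow> real) list \<Rightarrow> ('a \<Rightarrow> real) list" where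
  "insort_fun f [] = [f]"
| "insort_fun f (g # gs) = (\<lambda>\<omega>. min (f \<omega>) (g \<omega>)) # insort_fun (\<lambda>\<omega>. max (f \<omega>) (g \<omega>)) gs"

lemma insort_fun_eval:
  "sorted (map (\<lambda>g. g \<omega>) gs) \<Longrightarrow>
     map (\<lambda>g. g \<omega>) (insort_fun f gs) = insort (f \<omega>) (map (\<lambda>g. g \<omega>) gs)"
  by (induction gs arbitrary: f) (auto simp: insort_is_Cons min_def max_def)

lemma insort_fun_measurable:
  "f \<in> borel_measurable N \<Longrightarrow> set gs \<subseteq> borel_measurable N \<Longrightarrow>
     set (insort_fun f gs) \<subseteq> borel_measurable N"
proof (induction gs arbitrary: f)
  case (Cons g gs)
  have [measurable]: "f \<in> borel_measurable N" "g \<in> borel_measurable N"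
    using Cons.prems by auto
  have "set (insort_fun (\<lambda>\<omega>. max (f \<omega>) (g \<omega>)) gs) \<subseteq> borel_measurable N"
    using Cons.prems(2) by (intro Cons.IH) auto
  then show ?case by simp
qed simp

lemma sort_measurable:
  fixes fs :: "('a \<Rightarrow> real) list"
  assumes "set fs \<subseteq> borel_measurable N"
  obtains gs where "set gs \<subseteq> borel_measurable N"
    "\<And>\<omega>. sort (map (\<lambda>f. f \<omega>) fs) = map (\<lambda>g. g \<omega>) gs"
proof -
  have "\<exists>gs. set gs \<subseteq> borel_measurable N \<and>
          (\<forall>\<omega>. sort (map (\<lambda>f. f \<omega>) fs) = map (\<lambda>g. g \<omega>) gs)"
    using assms
  proof (induction fs)
    case (Cons f fs)
    then obtain gs where gs: "set gs \<subseteq> borel_measurable N"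
      "\<And>\<omega>. sort (map (\<lambda>f. f \<omega>) fs) = map (\<lambda>g. g \<omega>) gs" by auto
    have "sort (map (\<lambda>f. f \<omega>) (f # fs)) = map (\<lambda>g. g \<omega>) (insort_fun f gs)" for \<omega>
      by (subst insort_fun_eval) (auto simp: gs(2)[symmetric])
    then show ?case using Cons.prems insort_fun_measurable[OF _ gs(1), of f] by auto
  qed auto
  then show thesis using that by auto
qed

lemma gap_from_measurable:
  "a \<in> borel_measurable N \<Longrightarrow> set gs \<subseteq> borel_measurable N \<Longrightarrow>
     (\<lambda>\<omega>. gap_from (a \<omega>) (map (\<lambda>g. g \<omega>) gs)) \<in> borel_measurable N"
  by (induction gs arbitrary: a) auto

lemma gap_from_sort_measurable:
  assumes "\<And>j. j \<in> set js \<Longrightarrow> f j \<in> borel_measurable N"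
  shows "(\<lambda>\<omega>. gap_from a (sort (map (\<lambda>j. f j \<omega>) js))) \<in> borel_measurable N"
proof -
  have "set (map f js) \<subseteq> borel_measurable N" using assms by auto
  from sort_measurable[OF this] obtain gs where "set gs \<subseteq> borel_measurable N"
    "\<And>\<omega>. sort (map (\<lambda>f. f \<omega>) (map f js)) = map (\<lambda>g. g \<omega>) gs" by blast
  then show ?thesis using gap_from_measurable[of "\<lambda>_. a" N gs] by (simp add: comp_def)
qed

lemma longest_gap_measurable:
  assumes "\<And>j. j \<in> set js \<Longrightarrow> f j \<in> borel_measurable N"
  shows "(\<lambda>\<omega>. longest_gap (map (\<lambda>j. f j \<omega>) js)) \<in> borel_measurable N"
  unfolding longest_gap_eq_gap_from by (rule gap_from_sort_measurable[OF assms])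

lemma sort_map_min_Cons:
  assumes "distinct js" "i \<in> set js" "\<And>j. j \<in> set js - {i} \<Longrightarrow> f i \<le> f j"
  shows "sort (map f js) = f i # sort (map f (remove1 i js))"
proof (rule properties_for_sort)
  show "mset (f i # sort (map f (remove1 i js))) = mset (map f js)"
  proof -
    have "mset js = add_mset i (mset (remove1 i js))" using assms(2) by simp
    then have "mset (map f js) = add_mset (f i) (mset (map f (remove1 i js)))"
      by (metis image_mset_add_mset mset_map)
    then show ?thesis by simp
  qed
  show "sorted (f i # sort (map f (remove1 i js)))"
    using assms by (auto simp: set_remove1_eq)
qed

lemma measurable_indicator_Ioo [measurable (raw)]:
  fixes f g h :: "'a \<Rightarrow> real"
  assumes [measurable]: "f \<in> borel_measurable N" "g \<in> borel_measurable N" "h \<in> borel_measurable N"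
  shows "(\<lambda>x. indicator {f x<..<g x} (h x) :: ennreal) \<in> borel_measurable N"
proof -
  have "(\<lambda>x. if f x < h x \<and> h x < g x then 1 else 0 :: ennreal) \<in> borel_measurable N"
    by measurable
  then show ?thesis by (simp add: indicator_def of_bool_def)
qed

lemma nn_integral_shift:
  fixes f :: "real \<Rightarrow> ennreal"
  assumes "f \<in> borel_measurable borel"
  shows "(\<integral>\<^sup>+x. f x \<partial>lborel) = (\<integral>\<^sup>+x. f (t + x) \<partial>lborel)"
  using nn_integral_real_affine[OF assms, of 1 t] by simp

section \<open>Averages over uniform points as iterated integrals over the gaps\<close>

text \<open>
  The integral over all configurations of \<open>n\<close> increasing points in an interval of length \<open>s\<close>, with
  the successive gaps as variables, of \<open>\<phi>\<close> at the maximum of \<open>c\<close> and the \<open>n + 1\<close> gaps.  The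
  argument \<open>c\<close> accumulates the longest gap seen so far.
\<close>

primrec spacings :: "(real \<Rightarrow> ennreal) \<Rightarrow> nat \<Rightarrow> real \<Rightarrow> real \<Rightarrow> ennreal" where
  "spacings \<phi> 0 s c = \<phi> (max c s)"
| "spacings \<phi> (Suc n) s c =
     (\<integral>\<^sup>+u. indicator {0<..<s} u * spacings \<phi> n (s - u) (max c u) \<partial>lborel)"

lemma spacings_measurable:
  assumes [measurable]: "\<phi> \<in> borel_measurable borel"
  shows "case_prod (spacings \<phi> n) \<in> borel_measurable (borel \<Otimes>\<^sub>M borel)"
proof (induction n)
  case 0
  then show ?case by (simp add: case_prod_unfold)
next
  case (Suc n)
  note Suc[measurable]
  have "(\<lambda>p. \<integral>\<^sup>+u. (if 0 < u \<and> u < fst p then 1 else 0) *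
          case_prod (spacings \<phi> n) (fst p - u, max (snd p) u) \<partial>lborel)
        \<in> borel_measurable (borel \<Otimes>\<^sub>M (borel :: real measure))"
    by measurable
  also have "(\<lambda>p. \<integral>\<^sup>+u. (if 0 < u \<and> u < fst p then 1 else 0) *
          case_prod (spacings \<phi> n) (fst p - u, max (snd p) u) \<partial>lborel) = case_prod (spacings \<phi> (Suc n))"
    by (auto simp: fun_eq_iff indicator_def of_bool_def intro!: nn_integral_cong)
  finally show ?case .
qed

lemma spacings_measurable_comp [measurable (raw)]:
  assumes "\<phi> \<in> borel_measurable borel" "f \<in> borel_measurable N" "g \<in> borel_measurable N"
  shows "(\<lambda>x. spacings \<phi> n (f x) (g x)) \<in> borel_measurable N"
  using measurable_compose[OF measurable_Pair[OF assms(2,3)] spacings_measurable[OF assms(1)]]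
  by simp

abbreviation unit_uniform :: "real measure" where
  "unit_uniform \<equiv> uniform_measure lborel {0..1}"

lemma prob_space_unit_uniform: "prob_space unit_uniform"
  by (rule prob_space_uniform_measure) auto

lemma emeasure_unit_uniform_singleton: "emeasure unit_uniform {x} = 0"
proof -
  have "emeasure lborel ({0..1} \<inter> {x}) \<le> emeasure lborel {x}"
    by (rule emeasure_mono) auto
  then show ?thesis by (subst emeasure_uniform_measure) auto
qed

lemma nn_integral_unit_uniform:
  assumes "f \<in> borel_measurable borel"
  shows "(\<integral>\<^sup>+x. f x \<partial>unit_uniform) = (\<integral>\<^sup>+x. f x * indicator {0..1} x \<partial>lborel)"
  using assms by (subst nn_integral_uniform_measure) (auto simp: divide_ennreal_def)

text \<open>
  Ties form a null set, so almost every configuration has a unique leftmost point.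
\<close>

lemma AE_PiM_uniform_distinct:
  fixes I :: "'i set"
  assumes "finite I"
  shows "AE y in PiM I (\<lambda>_. unit_uniform). inj_on y I"
proof -
  interpret product_sigma_finite "\<lambda>_::'i. unit_uniform"
    by (intro product_sigma_finite.intro prob_space_imp_sigma_finite prob_space_unit_uniform)
  have "AE y in PiM I (\<lambda>_. unit_uniform). y i \<noteq> y j"
    if ij: "i \<in> I" "j \<in> I" "i \<noteq> j" for i j
  proof -
    let ?P = "PiM I (\<lambda>_. unit_uniform)"
    have I: "I = insert i (I - {i})" using ij by auto
    have [measurable]: "(\<lambda>y. y i) \<in> borel_measurable ?P" "(\<lambda>y. y j) \<in> borel_measurable ?P"
      using ij by auto
    have m[measurable]: "{y \<in> space ?P. y i = y j} \<in> sets ?P" by measurable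
    have "emeasure ?P {y \<in> space ?P. y i = y j}
        = (\<integral>\<^sup>+y. (if y i = y j then 1 else 0) \<partial>?P)"
      unfolding nn_integral_indicator[symmetric, OF m]
      by (intro nn_integral_cong) (simp add: indicator_def)
    also have "\<dots> = (\<integral>\<^sup>+y. (\<integral>\<^sup>+x. (if (y(i := x)) i = (y(i := x)) j then 1 else 0) \<partial>unit_uniform)
         \<partial>PiM (I - {i}) (\<lambda>_. unit_uniform))"
    proof -
      have "(\<lambda>y. if y i = y j then 1 else 0 :: ennreal)
          \<in> borel_measurable (PiM (insert i (I - {i})) (\<lambda>_. unit_uniform))"
        unfolding I[symmetric] by measurable
      from product_nn_integral_insert[OF _ _ this] show ?thesis
        using assms unfolding I[symmetric] by simp
    qed
    also have "\<dots> = (\<integral>\<^sup>+y. (\<integral>\<^sup>+x. indicator {y j} x \<partial>unit_uniform) \<partial>PiM (I - {i}) (\<lambda>_. unit_uniform))"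
      using ij by (intro nn_integral_cong) (auto simp: indicator_def of_bool_def intro!: nn_integral_cong)
    also have "\<dots> = 0" by (simp add: emeasure_unit_uniform_singleton)
    finally have "{y \<in> space ?P. y i = y j} \<in> null_sets ?P" by auto
    then show ?thesis by (rule AE_I') auto
  qed
  then have "AE y in PiM I (\<lambda>_. unit_uniform). \<forall>i\<in>I. \<forall>j\<in>I. i \<noteq> j \<longrightarrow> y i \<noteq> y j"
    using assms by (intro AE_finite_allI) auto
  then show ?thesis by eventually_elim (auto simp: inj_on_def)
qed

text \<open>
  The configurations are split according to the index of the leftmost point.  If that point is at
  \<open>x\<close>, it contributes the gap \<open>x - a\<close>, and the others are a configuration of \<open>n\<close> points in \<open>[x,1]\<close>;
  each of the \<open>n + 1\<close> indices contributes the same amount, whence the factorial.  The points are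
  indexed by an arbitrary list, since the items of one aisle are an arbitrary set of item numbers.
\<close>

lemma nn_integral_gap_from:
  fixes \<phi> :: "real \<Rightarrow> ennreal" and js :: "'i list"
  assumes \<phi>[measurable]: "\<phi> \<in> borel_measurable borel" and "distinct js" and "0 \<le> a"
  shows "(\<integral>\<^sup>+y. (\<Prod>i\<in>set js. indicator {a<..<1} (y i)) *
            \<phi> (max c (gap_from a (sort (map y js)))) \<partial>PiM (set js) (\<lambda>_. unit_uniform))
       = fact (length js) * spacings \<phi> (length js) (1 - a) c"
  using assms(2,3)
proof (induction "length js" arbitrary: js a c)
  case 0
  interpret product_sigma_finite "\<lambda>_::'i. unit_uniform"
    by (intro product_sigma_finite.intro prob_space_imp_sigma_finite prob_space_unit_uniform)
  from 0 show ?case by (simp add: space_PiM_empty)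
next
  case (Suc n)
  interpret product_sigma_finite "\<lambda>_::'i. unit_uniform"
    by (intro product_sigma_finite.intro prob_space_imp_sigma_finite prob_space_unit_uniform)
  let ?I = "set js"
  let ?P = "\<lambda>I. PiM I (\<lambda>_. unit_uniform)"
  define F where "F y = (\<Prod>i\<in>?I. indicator {a<..<1} (y i)) *
     \<phi> (max c (gap_from a (sort (map y js))))" for y
  define L where "L i y = (if \<forall>j\<in>?I - {i}. y i < y j then 1 else 0 :: ennreal)" for i and y :: "'i \<Rightarrow> real"
  have [measurable]: "(\<lambda>y. gap_from a (sort (map y js))) \<in> borel_measurable (?P ?I)"
    by (rule gap_from_sort_measurable[of js "\<lambda>j y. y j"]) auto
  have F_meas[measurable]: "F \<in> borel_measurable (?P ?I)"
    unfolding F_def by measurable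
  have L_meas: "L i \<in> borel_measurable (?P ?I)" if "i \<in> ?I" for i
  proof -
    have "(\<lambda>y. y j) \<in> borel_measurable (?P ?I)" if "j \<in> ?I" for j using that by auto
    with that show ?thesis unfolding L_def by measurable
  qed
  have ne: "?I \<noteq> {}" using Suc.hyps(2) by auto
  have sum_L: "(\<Sum>i\<in>?I. L i y) = 1" if inj: "inj_on y ?I" for y
  proof -
    obtain m where m: "m \<in> ?I" "\<And>j. j \<in> ?I \<Longrightarrow> y m \<le> y j"
      using ne finite_set[of js] by (metis arg_min_if_finite(1) arg_min_least)
    then have "L i y = (if i = m then 1 else 0)" if "i \<in> ?I" for i
      using that inj unfolding L_def inj_on_def by (smt (verit) DiffD1 DiffD2 DiffI empty_iff insert_iff)
    then show ?thesis using m(1) by simp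
  qed
  \<comment> \<open>\<open>L i\<close> is the indicator that point \<open>i\<close> is strictly to the left of all others.\<close>
  have part: "(\<integral>\<^sup>+y. F y * L i y \<partial>?P ?I) = fact n * spacings \<phi> (Suc n) (1 - a) c" if i: "i \<in> ?I" for i
  proof -
    let ?js = "remove1 i js"
    have js': "set ?js = ?I - {i}" "distinct ?js" "n = length ?js"
      using Suc.prems(1) Suc.hyps(2) i by (auto simp: length_remove1 set_remove1_eq)
    have I: "insert i (?I - {i}) = ?I" using i by auto
    have "(\<lambda>y. F y * L i y) \<in> borel_measurable (?P (insert i (?I - {i})))"
      unfolding I using L_meas[OF i] by measurable
    from product_nn_integral_insert_rev[OF _ _ this]
    have "(\<integral>\<^sup>+y. F y * L i y \<partial>?P ?I) =
       (\<integral>\<^sup>+x. \<integral>\<^sup>+y. F (y(i := x)) * L i (y(i := x)) \<partial>?P (?I - {i}) \<partial>unit_uniform)"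
      unfolding I by simp
    also have "\<dots> = (\<integral>\<^sup>+x. indicator {a<..<1} x *
        (\<integral>\<^sup>+y. (\<Prod>i\<in>set ?js. indicator {x<..<1} (y i)) *
            \<phi> (max (max c (x - a)) (gap_from x (sort (map y ?js)))) \<partial>?P (set ?js)) \<partial>unit_uniform)"
    proof (rule nn_integral_cong)
      fix x :: real
      have [measurable]: "(\<lambda>y. gap_from x (sort (map y ?js))) \<in> borel_measurable (?P (set ?js))"
        by (rule gap_from_sort_measurable[of ?js "\<lambda>j y. y j"]) auto
      have eq: "F (y(i := x)) * L i (y(i := x)) = indicator {a<..<1} x *
          ((\<Prod>i\<in>set ?js. indicator {x<..<1} (y i)) *
            \<phi> (max (max c (x - a)) (gap_from x (sort (map y ?js)))))" (is "?l = ?r") for y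
      proof -
        have prod: "(\<Prod>j\<in>?I. indicator {a<..<1} ((y(i := x)) j) :: ennreal)
            = indicator {a<..<1} x * (\<Prod>j\<in>?I - {i}. indicator {a<..<1} (y j))"
          using i by (subst prod.remove[of _ i]) (auto intro!: prod.cong)
        \<comment> \<open>Outside the first case both sides vanish.\<close>
        consider "a < x" "x < 1" "\<forall>j\<in>?I - {i}. x < y j \<and> y j < 1"
          | "\<not> (a < x \<and> x < 1)" | j where "j \<in> ?I - {i}" "\<not> x < y j"
          | j where "a < x" "j \<in> ?I - {i}" "\<not> y j < 1" by blast
        then show ?thesis
        proof cases
          case 1
          have "sort (map (y(i := x)) js) = x # sort (map y ?js)"
          proof -
            have "map (y(i := x)) ?js = map y ?js" using js'(1) by (intro map_cong) auto
            moreover have "sort (map (y(i := x)) js) = (y(i := x)) i # sort (map (y(i := x)) ?js)"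
            proof (rule sort_map_min_Cons[OF Suc.prems(1) i])
              fix j assume j: "j \<in> ?I - {i}"
              with 1(3) have "x < y j" by blast
              then show "(y(i := x)) i \<le> (y(i := x)) j" using j by simp
            qed
            ultimately show ?thesis by (simp only: fun_upd_same)
          qed
          then have "gap_from a (sort (map (y(i := x)) js)) = max (x - a) (gap_from x (sort (map y ?js)))"
            by simp
          moreover have "L i (y(i := x)) = 1" using 1(3) by (auto simp: L_def)
          moreover have "(\<Prod>j\<in>?I - {i}. indicator {a<..<1} (y j)) = (1 :: ennreal)"
            using 1 by (intro prod.neutral) force
          moreover have "(\<Prod>j\<in>?I - {i}. indicator {x<..<1} (y j)) = (1 :: ennreal)"
            using 1 by (intro prod.neutral) force
          ultimately show ?thesis unfolding F_def prod js'(1) using 1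
            by (simp add: max.assoc)
        next
          case 2
          then have "indicator {a<..<1} x = (0 :: ennreal)" by auto
          then show ?thesis by (simp only: F_def prod mult_zero_left)
        next
          case 3
          then have "L i (y(i := x)) = 0" by (auto simp: L_def)
          moreover have "(\<Prod>j\<in>set ?js. indicator {x<..<1} (y j)) = (0 :: ennreal)"
            unfolding js'(1) using 3 by (intro prod_zero bexI[of _ j]) auto
          ultimately show ?thesis by simp
        next
          case 4
          then have "(\<Prod>j\<in>?I - {i}. indicator {a<..<1} (y j)) = (0 :: ennreal)"
            by (intro prod_zero bexI[of _ j]) auto
          moreover have "(\<Prod>j\<in>set ?js. indicator {x<..<1} (y j)) = (0 :: ennreal)"
            unfolding js'(1) using 4 by (intro prod_zero bexI[of _ j]) auto
          ultimately show ?thesis by (simp only: F_def prod mult_zero_left mult_zero_right)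
        qed
      qed
      have "(\<lambda>y. (\<Prod>i\<in>set ?js. indicator {x<..<1} (y i)) *
            \<phi> (max (max c (x - a)) (gap_from x (sort (map y ?js))))) \<in> borel_measurable (?P (set ?js))"
        by measurable
      then show "(\<integral>\<^sup>+y. F (y(i := x)) * L i (y(i := x)) \<partial>?P (?I - {i})) = indicator {a<..<1} x *
        (\<integral>\<^sup>+y. (\<Prod>i\<in>set ?js. indicator {x<..<1} (y i)) *
            \<phi> (max (max c (x - a)) (gap_from x (sort (map y ?js)))) \<partial>?P (set ?js))"
        unfolding eq js'(1)[symmetric] by (rule nn_integral_cmult)
    qed
    also have "\<dots> = (\<integral>\<^sup>+x. indicator {a<..<1} x * (fact n * spacings \<phi> n (1 - x) (max c (x - a))) \<partial>unit_uniform)"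
      using Suc.hyps(1)[OF js'(3,2)] Suc.prems(2) unfolding js'(3)[symmetric]
      by (intro nn_integral_cong) (auto simp: indicator_def)
    also have "\<dots> = (\<integral>\<^sup>+x. fact n * (indicator {a<..<1} x * spacings \<phi> n (1 - x) (max c (x - a))) \<partial>lborel)"
      using Suc.prems(2) by (subst nn_integral_unit_uniform)
        (auto intro!: nn_integral_cong simp: indicator_def)
    also have "\<dots> = fact n * (\<integral>\<^sup>+x. indicator {a<..<1} x * spacings \<phi> n (1 - x) (max c (x - a)) \<partial>lborel)"
      by (intro nn_integral_cmult) measurable
    also have "(\<integral>\<^sup>+x. indicator {a<..<1} x * spacings \<phi> n (1 - x) (max c (x - a)) \<partial>lborel)
        = (\<integral>\<^sup>+u. indicator {a<..<1} (a + u) *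
            spacings \<phi> n (1 - (a + u)) (max c (a + u - a)) \<partial>lborel)"
      by (rule nn_integral_shift) measurable
    also have "\<dots> = spacings \<phi> (Suc n) (1 - a) c"
      by (auto simp: indicator_def intro!: nn_integral_cong arg_cong2[where f = "spacings \<phi> n"])
    finally show ?thesis .
  qed
  have "(\<integral>\<^sup>+y. F y \<partial>?P ?I) = (\<integral>\<^sup>+y. (\<Sum>i\<in>?I. F y * L i y) \<partial>?P ?I)"
    using AE_PiM_uniform_distinct[OF finite_set[of js]]
    by (intro nn_integral_cong_AE, eventually_elim)
       (use sum_L in \<open>simp add: sum_distrib_left[symmetric]\<close>)
  also have "\<dots> = (\<Sum>i\<in>?I. \<integral>\<^sup>+y. F y * L i y \<partial>?P ?I)"
    by (intro nn_integral_sum borel_measurable_times_ennreal F_meas L_meas)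
  also have "\<dots> = of_nat (Suc n) * (fact n * spacings \<phi> (Suc n) (1 - a) c)"
    using part Suc.prems(1) Suc.hyps(2) by (simp add: distinct_card)
  also have "\<dots> = fact (Suc n) * spacings \<phi> (Suc n) (1 - a) c"
    by (simp only: fact_Suc mult.assoc)
  finally show ?case unfolding F_def Suc.hyps(2)[symmetric] .
qed

section \<open>Random stretching: spacings become exponential variables\<close>

text \<open>
  If the first gap is \<open>u\<close>, then \<open>exp (- s) = exp (- u) * exp (- (s - u))\<close>.  Hence averaging over the
  length of the interval makes each gap an independent standard exponential variable.
\<close>

lemma laplace_spacings_Suc:
  assumes [measurable]: "\<phi> \<in> borel_measurable borel"
  shows "(\<integral>\<^sup>+s. ennreal (exp (- s)) * indicator {0<..} s * spacings \<phi> (Suc n) s c \<partial>lborel)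
       = (\<integral>\<^sup>+u. ennreal (exp (- u)) * indicator {0<..} u *
           (\<integral>\<^sup>+s. ennreal (exp (- s)) * indicator {0<..} s * spacings \<phi> n s (max c u) \<partial>lborel) \<partial>lborel)"
proof -
  have "(\<integral>\<^sup>+s. ennreal (exp (- s)) * indicator {0<..} s * spacings \<phi> (Suc n) s c \<partial>lborel)
    = (\<integral>\<^sup>+s. \<integral>\<^sup>+u. ennreal (exp (- s)) * indicator {0<..} s *
         (indicator {0<..<s} u * spacings \<phi> n (s - u) (max c u)) \<partial>lborel \<partial>lborel)"
    unfolding spacings.simps
    by (intro nn_integral_cong nn_integral_cmult[symmetric]) measurable
  also have "\<dots> = (\<integral>\<^sup>+u. \<integral>\<^sup>+s. ennreal (exp (- s)) * indicator {0<..} s *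
         (indicator {0<..<s} u * spacings \<phi> n (s - u) (max c u)) \<partial>lborel \<partial>lborel)"
    by (rule lborel_pair.Fubini') measurable
  also have "\<dots> = (\<integral>\<^sup>+u. \<integral>\<^sup>+s. ennreal (exp (- (u + s))) * indicator {0<..} (u + s) *
         (indicator {0<..<u + s} u * spacings \<phi> n (u + s - u) (max c u)) \<partial>lborel \<partial>lborel)"
    by (intro nn_integral_cong nn_integral_shift) measurable
  also have "\<dots> = (\<integral>\<^sup>+u. \<integral>\<^sup>+s. ennreal (exp (- u)) * indicator {0<..} u *
      (ennreal (exp (- s)) * indicator {0<..} s * spacings \<phi> n s (max c u)) \<partial>lborel \<partial>lborel)"
    by (intro nn_integral_cong)
       (auto simp: indicator_def exp_diff exp_minus divide_inverse ennreal_mult mult_ac)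
  also have "\<dots> = (\<integral>\<^sup>+u. ennreal (exp (- u)) * indicator {0<..} u *
           (\<integral>\<^sup>+s. ennreal (exp (- s)) * indicator {0<..} s * spacings \<phi> n s (max c u) \<partial>lborel) \<partial>lborel)"
    by (intro nn_integral_cong nn_integral_cmult) measurable
  finally show ?thesis .
qed

text \<open>
  If \<open>U\<close> is uniform on \<open>[0,1]\<close>, then \<open>- ln (1 - U)\<close> is a standard exponential variable.
\<close>

lemma nn_integral_exp_eq_uniform:
  assumes [measurable]: "f \<in> borel_measurable borel"
  shows "(\<integral>\<^sup>+u. ennreal (exp (- u)) * indicator {0<..} u * f u \<partial>lborel)
       = (\<integral>\<^sup>+y. indicator {0<..<1} y * f (- ln (1 - y)) \<partial>lborel)"
proof -
  let ?U = "uniform_measure lborel {0<..<1 :: real}"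
  have "distributed ?U lborel (\<lambda>y. - ln (1 - y)) (exponential_density 1)"
  proof (rule exponential_distributedI)
    fix a :: real assume "0 \<le> a"
    have "{0<..<1} \<inter> {y \<in> space ?U. - ln (1 - y) \<le> a} = {0<..1 - exp (- a)}"
    proof (intro equalityI subsetI)
      fix y assume "y \<in> {0<..<1} \<inter> {y \<in> space ?U. - ln (1 - y) \<le> a}"
      then have "0 < y" "y < 1" "- a \<le> ln (1 - y)" by auto
      then show "y \<in> {0<..1 - exp (- a)}" by (auto simp: ln_ge_iff)
    next
      fix y assume *: "y \<in> {0<..1 - exp (- a)}"
      then have "exp (- a) \<le> 1 - y" "y < 1" using exp_gt_zero[of "- a"] by (auto simp: le_less_trans)
      then show "y \<in> {0<..<1} \<inter> {y \<in> space ?U. - ln (1 - y) \<le> a}"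
        using * ln_ge_iff[of "1 - y" "- a"] by auto
    qed
    then show "emeasure ?U {y \<in> space ?U. - ln (1 - y) \<le> a} = 1 - ennreal (exp (- a * 1))"
      using \<open>0 \<le> a\<close> ennreal_minus[of "exp (- a)" 1]
      by (subst emeasure_uniform_measure) (auto simp: divide_ennreal_def)
  qed auto
  from distributed_nn_integral[OF this, of f]
  have "(\<integral>\<^sup>+u. ennreal (exponential_density 1 u) * f u \<partial>lborel) = (\<integral>\<^sup>+y. f (- ln (1 - y)) \<partial>?U)"
    by simp
  also have "\<dots> = (\<integral>\<^sup>+y. indicator {0<..<1} y * f (- ln (1 - y)) \<partial>lborel)"
    by (subst nn_integral_uniform_measure) (auto simp: mult.commute divide_ennreal_def)
  also have "(\<integral>\<^sup>+u. ennreal (exponential_density 1 u) * f u \<partial>lborel)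
      = (\<integral>\<^sup>+u. ennreal (exp (- u)) * indicator {0<..} u * f u \<partial>lborel)"
    using AE_lborel_singleton[of "0 :: real"]
    by (intro nn_integral_cong_AE, eventually_elim) (auto simp: exponential_density_def indicator_def)
  finally show ?thesis .
qed

text \<open>
  The right-hand side is the expectation of \<open>\<phi> (- ln (1 - V))\<close>, where \<open>V\<close> is the maximum of \<open>d\<close>
  and \<open>n + 1\<close> independent uniform variables: \<open>V = d\<close> has probability \<open>d ^ (n + 1)\<close>, and above \<open>d\<close>
  the density of \<open>V\<close> is \<open>(n + 1) * y ^ n\<close>.  The lower bound \<open>d\<close> is there for the induction, in which
  one more uniform variable raises it.
\<close>

lemma laplace_spacings:
  assumes [measurable]: "\<phi> \<in> borel_measurable borel" and "0 \<le> d" "d < 1"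
  shows "(\<integral>\<^sup>+s. ennreal (exp (- s)) * indicator {0<..} s * spacings \<phi> n s (- ln (1 - d)) \<partial>lborel)
       = ennreal (d ^ Suc n) * \<phi> (- ln (1 - d))
         + (\<integral>\<^sup>+y. indicator {d<..<1} y * (ennreal (real (Suc n) * y ^ n) * \<phi> (- ln (1 - y))) \<partial>lborel)"
  using assms(2,3)
proof (induction n arbitrary: d)
  have max_ln: "max (- ln (1 - d)) (- ln (1 - y)) = - ln (1 - max d y)" if "d < 1" "y < 1" for d y :: real
    using that by (auto simp: max_def)
  define \<psi> where "\<psi> y = \<phi> (- ln (1 - y))" for y
  have [measurable]: "\<psi> \<in> borel_measurable borel" unfolding \<psi>_def by measurable
  \<comment> \<open>The average of \<open>f (max d U)\<close> for a uniform variable \<open>U\<close>.\<close>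
  have split: "(\<integral>\<^sup>+y. indicator {0<..<1} y * f (max d y) \<partial>lborel)
      = ennreal d * f d + (\<integral>\<^sup>+y. indicator {d<..<1} y * f y \<partial>lborel)"
    if d: "0 \<le> d" "d < 1" and [measurable]: "f \<in> borel_measurable borel" for d :: real and f
  proof -
    have "(\<integral>\<^sup>+y. indicator {0<..<1} y * f (max d y) \<partial>lborel)
        = (\<integral>\<^sup>+y. f d * indicator {0<..d} y + indicator {d<..<1} y * f y \<partial>lborel)"
      using d by (intro nn_integral_cong) (auto simp: indicator_def max_def)
    also have "\<dots> = ennreal d * f d + (\<integral>\<^sup>+y. indicator {d<..<1} y * f y \<partial>lborel)"
      using d by (simp add: nn_integral_add nn_integral_cmult mult.commute)
    finally show ?thesis .
  qed
  {
    case 0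
    have "(\<integral>\<^sup>+s. ennreal (exp (- s)) * indicator {0<..} s * spacings \<phi> 0 s (- ln (1 - d)) \<partial>lborel)
        = (\<integral>\<^sup>+y. indicator {0<..<1} y * \<phi> (max (- ln (1 - d)) (- ln (1 - y))) \<partial>lborel)"
      unfolding spacings.simps by (rule nn_integral_exp_eq_uniform) measurable
    also have "\<dots> = (\<integral>\<^sup>+y. indicator {0<..<1} y * \<psi> (max d y) \<partial>lborel)"
      using max_ln[OF 0(2)] by (intro nn_integral_cong) (auto simp: \<psi>_def indicator_def)
    finally show ?case using split[OF 0, of \<psi>] by (simp add: \<psi>_def)
  next
    case (Suc n)
    let ?w = "\<lambda>y. ennreal (real (Suc n) * y ^ n)"
    define f where "f d = ennreal (d ^ Suc n) * \<psi> d + (\<integral>\<^sup>+y. indicator {d<..<1} y * (?w y * \<psi> y) \<partial>lborel)" for d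
    have [measurable]: "f \<in> borel_measurable borel"
      unfolding f_def by measurable
    have "(\<integral>\<^sup>+s. ennreal (exp (- s)) * indicator {0<..} s * spacings \<phi> (Suc n) s (- ln (1 - d)) \<partial>lborel)
        = (\<integral>\<^sup>+y. indicator {0<..<1} y *
            (\<integral>\<^sup>+s. ennreal (exp (- s)) * indicator {0<..} s *
               spacings \<phi> n s (max (- ln (1 - d)) (- ln (1 - y))) \<partial>lborel) \<partial>lborel)"
      unfolding laplace_spacings_Suc[OF assms(1)]
      by (rule nn_integral_exp_eq_uniform) measurable
    also have "\<dots> = (\<integral>\<^sup>+y. indicator {0<..<1} y * f (max d y) \<partial>lborel)"
      using max_ln[OF Suc.prems(2)] Suc.IH[of "max d y" for y] Suc.prems
      by (intro nn_integral_cong) (auto simp: \<psi>_def f_def indicator_def)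
    also have "\<dots> = ennreal d * f d + (\<integral>\<^sup>+y. indicator {d<..<1} y * f y \<partial>lborel)"
      by (rule split) (use Suc.prems in auto)
    also have "(\<integral>\<^sup>+y. indicator {d<..<1} y * f y \<partial>lborel)
        = (\<integral>\<^sup>+y. indicator {d<..<1} y * (ennreal (y ^ Suc n) * \<psi> y) \<partial>lborel)
          + (\<integral>\<^sup>+y. \<integral>\<^sup>+t. indicator {d<..<1} y * (indicator {y<..<1} t * (?w t * \<psi> t)) \<partial>lborel \<partial>lborel)"
      unfolding f_def distrib_left
      by (simp add: nn_integral_add nn_integral_cmult)
    also have "(\<integral>\<^sup>+y. \<integral>\<^sup>+t. indicator {d<..<1} y * (indicator {y<..<1} t * (?w t * \<psi> t)) \<partial>lborel \<partial>lborel)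
        = (\<integral>\<^sup>+t. \<integral>\<^sup>+y. indicator {d<..<1} y * (indicator {y<..<1} t * (?w t * \<psi> t)) \<partial>lborel \<partial>lborel)"
      by (rule lborel_pair.Fubini') measurable
    also have "\<dots> = (\<integral>\<^sup>+t. indicator {d<..<1} t * (ennreal (t - d) * (?w t * \<psi> t)) \<partial>lborel)"
    proof (rule nn_integral_cong)
      fix t :: real
      have "(\<integral>\<^sup>+y. indicator {d<..<1} y * (indicator {y<..<1} t * (?w t * \<psi> t)) \<partial>lborel)
          = (\<integral>\<^sup>+y. (indicator {d<..<1} t * (?w t * \<psi> t)) * indicator {d<..<t} y \<partial>lborel)"
        by (intro nn_integral_cong) (auto simp: indicator_def)
      also have "\<dots> = (indicator {d<..<1} t * (?w t * \<psi> t)) * emeasure lborel {d<..<t}"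
        by (subst nn_integral_cmult_indicator) auto
      finally show "(\<integral>\<^sup>+y. indicator {d<..<1} y * (indicator {y<..<1} t * (?w t * \<psi> t)) \<partial>lborel)
          = indicator {d<..<1} t * (ennreal (t - d) * (?w t * \<psi> t))"
        by (auto simp: indicator_def mult_ac)
    qed
    also have "ennreal d * f d = ennreal (d ^ Suc (Suc n)) * \<psi> d +
        (\<integral>\<^sup>+t. indicator {d<..<1} t * (ennreal d * (?w t * \<psi> t)) \<partial>lborel)"
      using Suc.prems unfolding f_def distrib_left
      by (simp add: nn_integral_cmult[symmetric] ennreal_mult mult_ac)
    also have "ennreal (d ^ Suc (Suc n)) * \<psi> d +
        (\<integral>\<^sup>+t. indicator {d<..<1} t * (ennreal d * (?w t * \<psi> t)) \<partial>lborel) +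
        ((\<integral>\<^sup>+t. indicator {d<..<1} t * (ennreal (t ^ Suc n) * \<psi> t) \<partial>lborel) +
         (\<integral>\<^sup>+t. indicator {d<..<1} t * (ennreal (t - d) * (?w t * \<psi> t)) \<partial>lborel))
       = ennreal (d ^ Suc (Suc n)) * \<psi> d +
        (\<integral>\<^sup>+t. indicator {d<..<1} t * (ennreal d * (?w t * \<psi> t)) +
         (indicator {d<..<1} t * (ennreal (t ^ Suc n) * \<psi> t) +
          indicator {d<..<1} t * (ennreal (t - d) * (?w t * \<psi> t))) \<partial>lborel)"
      by (simp add: nn_integral_add add.assoc)
    also have "(\<integral>\<^sup>+t. indicator {d<..<1} t * (ennreal d * (?w t * \<psi> t)) +
         (indicator {d<..<1} t * (ennreal (t ^ Suc n) * \<psi> t) +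
          indicator {d<..<1} t * (ennreal (t - d) * (?w t * \<psi> t))) \<partial>lborel)
        = (\<integral>\<^sup>+t. indicator {d<..<1} t * (ennreal (real (Suc (Suc n)) * t ^ Suc n) * \<psi> t) \<partial>lborel)"
    proof (rule nn_integral_cong)
      fix t :: real
      have "ennreal d * ?w t + (ennreal (t ^ Suc n) + ennreal (t - d) * ?w t)
          = ennreal (real (Suc (Suc n)) * t ^ Suc n)" if "d < t"
        using that Suc.prems
        by (subst ennreal_mult[symmetric] ennreal_plus[symmetric], simp, simp)+
           (auto simp: algebra_simps)
      then have "ennreal d * (?w t * \<psi> t) + (ennreal (t ^ Suc n) * \<psi> t + ennreal (t - d) * (?w t * \<psi> t))
          = ennreal (real (Suc (Suc n)) * t ^ Suc n) * \<psi> t" if "d < t"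
        using that by (simp only: distrib_right[symmetric] mult.assoc[symmetric])
      then show "indicator {d<..<1} t * (ennreal d * (?w t * \<psi> t)) +
         (indicator {d<..<1} t * (ennreal (t ^ Suc n) * \<psi> t) +
          indicator {d<..<1} t * (ennreal (t - d) * (?w t * \<psi> t)))
        = indicator {d<..<1} t * (ennreal (real (Suc (Suc n)) * t ^ Suc n) * \<psi> t)"
        by (auto simp: indicator_def)
    qed
    finally show ?case by (simp add: \<psi>_def)
  }
qed

lemma spacings_power_scale:
  assumes "r > 0" "s > 0" "c \<ge> 0"
  shows "spacings (\<lambda>t. ennreal (t ^ p)) n (r * s) (r * c)
       = ennreal (r ^ (n + p)) * spacings (\<lambda>t. ennreal (t ^ p)) n s c"
  using assms
proof (induction n arbitrary: s c)
  case 0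
  have "max (r * c) (r * s) = r * max c s" using 0 by (simp add: max_mult_distrib_left)
  then show ?case using 0 by (simp add: power_mult_distrib ennreal_mult)
next
  case (Suc n)
  let ?S = "spacings (\<lambda>t. ennreal (t ^ p)) n"
  have "spacings (\<lambda>t. ennreal (t ^ p)) (Suc n) (r * s) (r * c)
      = (\<integral>\<^sup>+u. indicator {0<..<r * s} u * ?S (r * s - u) (max (r * c) u) \<partial>lborel)"
    by simp
  also have "\<dots> = ennreal r * (\<integral>\<^sup>+u. indicator {0<..<r * s} (0 + r * u) *
        ?S (r * s - (0 + r * u)) (max (r * c) (0 + r * u)) \<partial>lborel)"
    using Suc.prems nn_integral_real_affine[of "\<lambda>u. indicator {0<..<r * s} u *
        ?S (r * s - u) (max (r * c) u)" r 0] by simp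
  also have "(\<integral>\<^sup>+u. indicator {0<..<r * s} (0 + r * u) *
        ?S (r * s - (0 + r * u)) (max (r * c) (0 + r * u)) \<partial>lborel)
      = (\<integral>\<^sup>+u. ennreal (r ^ (n + p)) * (indicator {0<..<s} u * ?S (s - u) (max c u)) \<partial>lborel)"
  proof (rule nn_integral_cong)
    fix u :: real
    have "?S (r * s - r * u) (max (r * c) (r * u)) = ennreal (r ^ (n + p)) * ?S (s - u) (max c u)"
      if "0 < u" "u < s"
      using Suc.IH[of "s - u" "max c u"] that Suc.prems
      by (simp add: right_diff_distrib max_mult_distrib_left)
    then show "indicator {0<..<r * s} (0 + r * u) * ?S (r * s - (0 + r * u)) (max (r * c) (0 + r * u))
      = ennreal (r ^ (n + p)) * (indicator {0<..<s} u * ?S (s - u) (max c u))"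
      using Suc.prems(1) by (auto simp: indicator_def mult_ac zero_less_mult_iff)
  qed
  also have "\<dots> = ennreal (r ^ (n + p)) * spacings (\<lambda>t. ennreal (t ^ p)) (Suc n) s c"
    by (simp add: nn_integral_cmult)
  finally show ?case using Suc.prems(1) by (simp add: ennreal_mult mult_ac)
qed

text \<open>
  By homogeneity the integral over configurations in an interval of length \<open>s\<close> is proportional to
  \<open>s ^ (n + p)\<close>, and averaging this power against \<open>exp (- s)\<close> gives the factorial.
\<close>

lemma fact_mult_spacings:
  "fact (n + p) * spacings (\<lambda>t. ennreal (t ^ p)) n 1 0
     = (\<integral>\<^sup>+y. indicator {0<..<1} y * ennreal (real (Suc n) * y ^ n * (- ln (1 - y)) ^ p) \<partial>lborel)"
proof -
  let ?\<phi> = "\<lambda>t. ennreal (t ^ p)"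
  have "(\<integral>\<^sup>+s. ennreal (exp (- s)) * indicator {0<..} s * spacings ?\<phi> n s 0 \<partial>lborel)
      = (\<integral>\<^sup>+y. indicator {0<..<1} y * (ennreal (real (Suc n) * y ^ n) * ?\<phi> (- ln (1 - y))) \<partial>lborel)"
    using laplace_spacings[of ?\<phi> 0 n] by simp
  also have "\<dots> = (\<integral>\<^sup>+y. indicator {0<..<1} y * ennreal (real (Suc n) * y ^ n * (- ln (1 - y)) ^ p) \<partial>lborel)"
    by (intro nn_integral_cong) (auto simp: indicator_def ennreal_mult[symmetric])
  finally have 1: "(\<integral>\<^sup>+s. ennreal (exp (- s)) * indicator {0<..} s * spacings ?\<phi> n s 0 \<partial>lborel) = \<dots>" .
  have "(\<integral>\<^sup>+s. ennreal (exp (- s)) * indicator {0<..} s * spacings ?\<phi> n s 0 \<partial>lborel)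
      = (\<integral>\<^sup>+s. (ennreal (s ^ (n + p) * exp (- s)) * indicator {0..} s) * spacings ?\<phi> n 1 0 \<partial>lborel)"
    using AE_lborel_singleton[of "0 :: real"]
  proof (intro nn_integral_cong_AE, eventually_elim)
    case (elim s)
    then show ?case using spacings_power_scale[of s 1 0 p n]
      by (auto simp: indicator_def ennreal_mult mult_ac)
  qed
  also have "\<dots> = ennreal (fact (n + p)) * spacings ?\<phi> n 1 0"
    by (subst nn_integral_multc) (auto simp: nn_intergal_power_times_exp_Ici)
  also have "ennreal (fact (n + p)) = fact (n + p)"
    by (metis ennreal_of_nat_eq_real_of_nat of_nat_fact)
  finally show ?thesis using 1 by (simp only:)
qed

section \<open>Moments of the longest gap as integrals against powers\<close>

lemma AE_unit_uniform_interior: "AE x in unit_uniform. 0 < x \<and> x < 1"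
  using AE_lborel_singleton[of "0 :: real"] AE_lborel_singleton[of "1 :: real"]
  by (intro AE_uniform_measureI) auto

lemma AE_PiM_unit_uniform_interior:
  assumes "finite I"
  shows "AE y in PiM I (\<lambda>_. unit_uniform). \<forall>i\<in>I. 0 < y i \<and> y i < 1"
  using assms by (intro AE_finite_allI AE_PiM_component[where P = "\<lambda>x. 0 < x \<and> x < 1"]
      prob_space_unit_uniform AE_unit_uniform_interior)

lemma nn_integral_longest_gap_power:
  assumes "distinct js"
  shows "(\<integral>\<^sup>+y. ennreal (longest_gap (map y js) ^ p) \<partial>PiM (set js) (\<lambda>_. unit_uniform))
       = fact (length js) * spacings (\<lambda>t. ennreal (t ^ p)) (length js) 1 0"
proof -
  have "AE y in PiM (set js) (\<lambda>_. unit_uniform). \<forall>i\<in>set js. 0 < y i \<and> y i < 1"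
    by (rule AE_PiM_unit_uniform_interior) simp
  then have "(\<integral>\<^sup>+y. ennreal (longest_gap (map y js) ^ p) \<partial>PiM (set js) (\<lambda>_. unit_uniform))
    = (\<integral>\<^sup>+y. (\<Prod>i\<in>set js. indicator {0<..<1} (y i)) *
         ennreal (max 0 (gap_from 0 (sort (map y js))) ^ p) \<partial>PiM (set js) (\<lambda>_. unit_uniform))"
  proof (intro nn_integral_cong_AE, eventually_elim)
    case (elim y)
    have "set (map y js) \<subseteq> {0..1}" using elim by fastforce
    then have "0 \<le> longest_gap (map y js)" by (rule longest_gap_bounds)
    moreover have "(\<Prod>i\<in>set js. indicator {0<..<1} (y i)) = (1 :: ennreal)"
      using elim by (intro prod.neutral) auto
    ultimately show ?case by (simp add: longest_gap_eq_gap_from)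
  qed
  then show ?thesis
    using nn_integral_gap_from[of "\<lambda>t. ennreal (t ^ p)" js 0 0] assms by simp
qed

text \<open>
  The \<open>p\<close>-th moment of the longest gap of \<open>n\<close> uniform points is \<open>\<integral> w x * x ^ n dx\<close> for every \<open>n\<close>;
  one weight serves all \<open>n\<close>.  The moment is written as a \<open>spacings\<close> integral, which keeps the
  condition an identity of nonnegative integrals without integrability premises.
\<close>

definition gap_moment_weight :: "nat \<Rightarrow> (real \<Rightarrow> real) \<Rightarrow> bool" where
  "gap_moment_weight p w \<longleftrightarrow> w \<in> borel_measurable borel \<and> (\<forall>x\<in>{0..1}. 0 \<le> w x) \<and>
     (\<forall>n. (\<integral>\<^sup>+x. indicator {0<..<1} x * ennreal (w x * x ^ n) \<partial>lborel)
        = fact n * spacings (\<lambda>t. ennreal (t ^ p)) n 1 0)"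

lemma nn_integral_Ioo_eq_Icc:
  fixes f :: "real \<Rightarrow> ennreal"
  shows "(\<integral>\<^sup>+x. indicator {0<..<1} x * f x \<partial>lborel) = (\<integral>\<^sup>+x. f x * indicator {0..1} x \<partial>lborel)"
  using AE_lborel_singleton[of "0 :: real"] AE_lborel_singleton[of "1 :: real"]
  by (intro nn_integral_cong_AE, eventually_elim) (auto simp: indicator_def)

text \<open>
  The moments are at most \<open>1\<close>, which yields the integrability of \<open>w x * x ^ n\<close>.
\<close>

lemma gap_moment_weight_integral:
  assumes w: "gap_moment_weight p w"
  shows "set_integrable lborel {0..1} (\<lambda>x. w x * x ^ n)"
    and "distinct js \<Longrightarrow>
      (\<integral>y. longest_gap (map y js) ^ p \<partial>PiM (set js) (\<lambda>_. unit_uniform)) = (LBINT x:{0..1}. w x * x ^ length js)"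
proof -
  have [measurable]: "w \<in> borel_measurable borel" using w by (simp add: gap_moment_weight_def)
  have w0: "x \<in> {0..1} \<Longrightarrow> 0 \<le> w x" for x using w by (simp add: gap_moment_weight_def)
  have nn: "(\<integral>\<^sup>+x. ennreal (indicator {0..1} x *\<^sub>R (w x * x ^ n)) \<partial>lborel)
      = fact n * spacings (\<lambda>t. ennreal (t ^ p)) n 1 0" for n
  proof -
    have "(\<integral>\<^sup>+x. ennreal (indicator {0..1} x *\<^sub>R (w x * x ^ n)) \<partial>lborel)
        = (\<integral>\<^sup>+x. ennreal (w x * x ^ n) * indicator {0..1} x \<partial>lborel)"
      by (intro nn_integral_cong) (auto simp: indicator_def)
    then show ?thesis using w nn_integral_Ioo_eq_Icc[of "\<lambda>x. ennreal (w x * x ^ n)"]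
      by (simp add: gap_moment_weight_def)
  qed
  have gap_nn: "(\<integral>\<^sup>+y. ennreal (longest_gap (map y js) ^ p) \<partial>PiM (set js) (\<lambda>_. unit_uniform))
      = (\<integral>\<^sup>+x. ennreal (indicator {0..1} x *\<^sub>R (w x * x ^ length js)) \<partial>lborel)"
    if "distinct js" for js :: "'c list"
    using nn_integral_longest_gap_power[OF that, of p] nn by simp
  show int: "set_integrable lborel {0..1} (\<lambda>x. w x * x ^ n)" for n
    unfolding set_integrable_def
  proof (rule integrableI_nonneg)
    have "(\<integral>\<^sup>+x. ennreal (indicator {0..1} x *\<^sub>R (w x * x ^ n)) \<partial>lborel)
      = (\<integral>\<^sup>+y. ennreal (longest_gap (map y [0..<n]) ^ p) \<partial>PiM (set [0..<n]) (\<lambda>_. unit_uniform))"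
      using gap_nn[of "[0..<n]"] by simp
    also have "\<dots> \<le> (\<integral>\<^sup>+y. 1 \<partial>PiM (set [0..<n]) (\<lambda>_. unit_uniform))"
    proof (rule nn_integral_mono_AE)
      have "AE y in PiM (set [0..<n]) (\<lambda>_. unit_uniform). \<forall>i\<in>set [0..<n]. 0 < y i \<and> y i < 1"
        by (rule AE_PiM_unit_uniform_interior) simp
      then show "AE y in PiM (set [0..<n]) (\<lambda>_. unit_uniform). ennreal (longest_gap (map y [0..<n]) ^ p) \<le> 1"
      proof eventually_elim
        case (elim y)
        have "set (map y [0..<n]) \<subseteq> {0..1}" using elim by fastforce
        from longest_gap_bounds[OF this] show ?case by (simp add: power_le_one)
      qed
    qed
    also have "\<dots> = 1"
      using prob_space.emeasure_space_1[OF prob_space_PiM[OF prob_space_unit_uniform]] by simp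
    finally show "(\<integral>\<^sup>+x. ennreal (indicator {0..1} x *\<^sub>R (w x * x ^ n)) \<partial>lborel) < \<infinity>"
      by (simp add: le_less_trans)
  qed (use w0 in \<open>auto simp: indicator_def intro!: AE_I2\<close>)
  show "(\<integral>y. longest_gap (map y js) ^ p \<partial>PiM (set js) (\<lambda>_. unit_uniform)) = (LBINT x:{0..1}. w x * x ^ length js)"
    if "distinct js"
  proof -
    let ?P = "PiM (set js) (\<lambda>_. unit_uniform)"
    have "(\<lambda>y. gap_from 0 (sort (map y js))) \<in> borel_measurable ?P"
      by (rule gap_from_sort_measurable[of js "\<lambda>j y. y j"]) auto
    then have [measurable]: "(\<lambda>y. longest_gap (map y js)) \<in> borel_measurable ?P"
      by (simp add: longest_gap_eq_gap_from)
    have "AE y in ?P. \<forall>i\<in>set js. 0 < y i \<and> y i < 1"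
      by (rule AE_PiM_unit_uniform_interior) simp
    then have "AE y in ?P. 0 \<le> longest_gap (map y js) ^ p"
    proof eventually_elim
      case (elim y)
      have "set (map y js) \<subseteq> {0..1}" using elim by fastforce
      from longest_gap_bounds[OF this] show ?case by simp
    qed
    then have "(\<integral>y. longest_gap (map y js) ^ p \<partial>?P) = enn2real (\<integral>\<^sup>+y. ennreal (longest_gap (map y js) ^ p) \<partial>?P)"
      by (intro integral_eq_nn_integral) auto
    also have "\<dots> = (LBINT x:{0..1}. w x * x ^ length js)"
      unfolding set_lebesgue_integral_def gap_nn[OF that]
      using w0 by (intro integral_eq_nn_integral[symmetric]) (auto simp: indicator_def intro!: AE_I2)
    finally show ?thesis .
  qed
qed

definition gap_weight1 :: "real \<Rightarrow> real" where
  "gap_weight1 x = - ln (1 - x)"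

definition gap_weight2 :: "real \<Rightarrow> real" where
  "gap_weight2 x = x * (LBINT y:{x..1}. (ln (1 - y))\<^sup>2 / y\<^sup>2)"

lemma ennreal_mult_of_nat_cancel:
  fixes a b :: ennreal
  assumes "of_nat (Suc n) * a = of_nat (Suc n) * b"
  shows "a = b"
  using assms by (subst (asm) ennreal_mult_cancel_left) (auto simp del: of_nat_Suc)

lemma log_power_moment:
  "fact (n + p) * spacings (\<lambda>t. ennreal (t ^ p)) n 1 0
     = of_nat (Suc n) * (\<integral>\<^sup>+y. indicator {0<..<1} y * ennreal (y ^ n * (- ln (1 - y)) ^ p) \<partial>lborel)"
proof -
  have "(\<integral>\<^sup>+y. indicator {0<..<1} y * ennreal (real (Suc n) * y ^ n * (- ln (1 - y)) ^ p) \<partial>lborel)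
     = (\<integral>\<^sup>+y. of_nat (Suc n) * (indicator {0<..<1} y * ennreal (y ^ n * (- ln (1 - y)) ^ p)) \<partial>lborel)"
    by (intro nn_integral_cong)
      (auto simp: indicator_def ennreal_mult ennreal_of_nat_eq_real_of_nat mult.assoc simp del: of_nat_Suc)
  then show ?thesis unfolding fact_mult_spacings by (simp add: nn_integral_cmult)
qed

lemma gap_moment_weight1: "gap_moment_weight 1 gap_weight1"
  unfolding gap_moment_weight_def
proof (intro conjI ballI allI)
  show "gap_weight1 \<in> borel_measurable borel" unfolding gap_weight1_def by measurable
  show "0 \<le> gap_weight1 x" if "x \<in> {0..1}" for x
    using that by (cases "x = 1") (auto simp: gap_weight1_def)
  fix n
  have "of_nat (Suc n) * (\<integral>\<^sup>+x. indicator {0<..<1} x * ennreal (gap_weight1 x * x ^ n) \<partial>lborel)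
      = of_nat (Suc n) * (fact n * spacings (\<lambda>t. ennreal (t ^ 1)) n 1 0)"
    using log_power_moment[of n 1] by (simp add: gap_weight1_def mult_ac)
  then show "(\<integral>\<^sup>+x. indicator {0<..<1} x * ennreal (gap_weight1 x * x ^ n) \<partial>lborel)
      = fact n * spacings (\<lambda>t. ennreal (t ^ 1)) n 1 0"
    by (rule ennreal_mult_of_nat_cancel)
qed

text \<open>
  The moment is \<open>1 / (n + 2)\<close> times \<open>\<integral> y ^ n * (ln (1 - y))\<^sup>2 dy\<close>.  The factor becomes part of the
  weight through \<open>y ^ (n + 2) / (n + 2) = \<integral> x ^ (n + 1) dx\<close> over \<open>[0,y]\<close>, after which the two
  integrals are exchanged.
\<close>

lemma gap_moment_weight2: "gap_moment_weight 2 gap_weight2"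
  unfolding gap_moment_weight_def
proof (intro conjI ballI allI)
  let ?f = "\<lambda>y :: real. (ln (1 - y))\<^sup>2 / y\<^sup>2"
  have tail: "(LBINT y:{x..1}. ?f y) = (\<integral>y. (if x \<le> y \<and> y \<le> 1 then ?f y else 0) \<partial>lborel)" for x
    unfolding set_lebesgue_integral_def by (intro Bochner_Integration.integral_cong) (auto simp: indicator_def)
  show [measurable]: "gap_weight2 \<in> borel_measurable borel"
    unfolding gap_weight2_def tail by measurable
  show "0 \<le> gap_weight2 x" if "x \<in> {0..1}" for x
    using that unfolding gap_weight2_def tail by (auto intro!: mult_nonneg_nonneg integral_nonneg_AE AE_I2)
  have log2: "(\<integral>\<^sup>+y. indicator {0<..<1} y * ennreal (y ^ n * (ln (1 - y))\<^sup>2) \<partial>lborel)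
      = of_nat (n + 2) * (fact n * spacings (\<lambda>t. ennreal (t ^ 2)) n 1 0)" for n
  proof -
    have "of_nat (Suc n) * (\<integral>\<^sup>+y. indicator {0<..<1} y * ennreal (y ^ n * (ln (1 - y))\<^sup>2) \<partial>lborel)
        = of_nat (Suc n) * (of_nat (n + 2) * (fact n * spacings (\<lambda>t. ennreal (t ^ 2)) n 1 0))"
      using log_power_moment[of n 2] by (simp add: numeral_2_eq_2 mult_ac)
    then show ?thesis by (rule ennreal_mult_of_nat_cancel)
  qed
  \<comment> \<open>For \<open>x > 0\<close> the factor \<open>1 / y\<^sup>2\<close> is bounded, so the inner integral is finite.\<close>
  have tail_nn: "ennreal (LBINT y:{x..1}. ?f y)
      = (\<integral>\<^sup>+y. indicator {0<..<1} y * (if x \<le> y then ennreal (?f y) else 0) \<partial>lborel)" if "0 < x" for x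
  proof -
    have eq: "(\<integral>\<^sup>+y. ennreal (if x \<le> y \<and> y \<le> 1 then ?f y else 0) \<partial>lborel)
        = (\<integral>\<^sup>+y. indicator {0<..<1} y * (if x \<le> y then ennreal (?f y) else 0) \<partial>lborel)"
      using AE_lborel_singleton[of "1 :: real"]
      by (intro nn_integral_cong_AE, eventually_elim) (use that in \<open>auto simp: indicator_def\<close>)
    have "(\<integral>\<^sup>+y. indicator {0<..<1} y * (if x \<le> y then ennreal (?f y) else 0) \<partial>lborel)
       \<le> (\<integral>\<^sup>+y. ennreal (1 / x\<^sup>2) * (indicator {0<..<1} y * ennreal (y ^ 0 * (ln (1 - y))\<^sup>2)) \<partial>lborel)"
    proof (intro nn_integral_mono)
      fix y :: real
      have "?f y \<le> 1 / x\<^sup>2 * (ln (1 - y))\<^sup>2" if "x \<le> y"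
        using \<open>0 < x\<close> that by (auto intro!: divide_left_mono power_mono mult_pos_pos)
      then show "indicator {0<..<1} y * (if x \<le> y then ennreal (?f y) else 0)
        \<le> ennreal (1 / x\<^sup>2) * (indicator {0<..<1} y * ennreal (y ^ 0 * (ln (1 - y))\<^sup>2))"
        by (auto simp: indicator_def ennreal_mult'[symmetric] intro!: ennreal_leI)
    qed
    also have "\<dots> < \<infinity>"
    proof -
      have "(\<integral>\<^sup>+y. indicator {0<..<1} y * ennreal (y ^ 0 * (ln (1 - y))\<^sup>2) \<partial>lborel) = 2"
        using log2[of 0] by simp
      then show ?thesis by (subst nn_integral_cmult) (auto simp: ennreal_mult_less_top)
    qed
    finally have fin: "(\<integral>\<^sup>+y. ennreal (if x \<le> y \<and> y \<le> 1 then ?f y else 0) \<partial>lborel) < \<infinity>"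
      unfolding eq .
    have "integrable lborel (\<lambda>y. if x \<le> y \<and> y \<le> 1 then ?f y else 0)"
      by (rule integrableI_nonneg) (use fin in auto)
    from nn_integral_eq_integral[OF this] show ?thesis unfolding tail eq by simp
  qed
  fix n
  let ?h = "\<lambda>x y. indicator {0<..<1} x * (ennreal (x ^ Suc n) *
      (indicator {0<..<1} y * (if x \<le> y then ennreal (?f y) else 0)))"
  have "(\<integral>\<^sup>+x. indicator {0<..<1} x * ennreal (gap_weight2 x * x ^ n) \<partial>lborel)
      = (\<integral>\<^sup>+x. \<integral>\<^sup>+y. ?h x y \<partial>lborel \<partial>lborel)"
  proof (rule nn_integral_cong)
    fix x :: real
    have nonneg: "0 \<le> (LBINT y:{x..1}. ?f y)"
      unfolding tail by (auto intro!: integral_nonneg_AE AE_I2)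
    show "indicator {0<..<1} x * ennreal (gap_weight2 x * x ^ n) = (\<integral>\<^sup>+y. ?h x y \<partial>lborel)"
    proof (cases "0 < x \<and> x < 1")
      case True
      then have "ennreal (gap_weight2 x * x ^ n) = ennreal (x ^ Suc n) * ennreal (LBINT y:{x..1}. ?f y)"
        using nonneg by (simp add: gap_weight2_def ennreal_mult'[symmetric] mult_ac)
      also have "\<dots> = (\<integral>\<^sup>+y. ?h x y \<partial>lborel)"
        using True by (simp add: tail_nn nn_integral_cmult)
      finally show ?thesis using True by simp
    qed simp
  qed
  also have "\<dots> = (\<integral>\<^sup>+y. \<integral>\<^sup>+x. ?h x y \<partial>lborel \<partial>lborel)"
    by (rule lborel_pair.Fubini') measurable
  also have "\<dots> = (\<integral>\<^sup>+y. ennreal (1 / real (n + 2)) *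
      (indicator {0<..<1} y * ennreal (y ^ n * (ln (1 - y))\<^sup>2)) \<partial>lborel)"
  proof (rule nn_integral_cong)
    fix y :: real
    show "(\<integral>\<^sup>+x. ?h x y \<partial>lborel) = ennreal (1 / real (n + 2)) *
      (indicator {0<..<1} y * ennreal (y ^ n * (ln (1 - y))\<^sup>2))"
    proof (cases "0 < y \<and> y < 1")
      case True
      have "(\<integral>\<^sup>+x. ?h x y \<partial>lborel) = (\<integral>\<^sup>+x. ennreal (?f y) * (ennreal (x ^ Suc n) * indicator {0..y} x) \<partial>lborel)"
        using AE_lborel_singleton[of "0 :: real"]
        by (intro nn_integral_cong_AE, eventually_elim) (use True in \<open>auto simp: indicator_def mult_ac\<close>)
      also have "\<dots> = ennreal (?f y) * (\<integral>\<^sup>+x. ennreal (x ^ Suc n) * indicator {0..y} x \<partial>lborel)"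
        by (rule nn_integral_cmult) measurable
      also have "(\<integral>\<^sup>+x. ennreal (x ^ Suc n) * indicator {0..y} x \<partial>lborel)
          = ennreal (y ^ (n + 2) / real (n + 2) - 0 ^ (n + 2) / real (n + 2))"
      proof (rule nn_integral_FTC_Icc)
        show "((\<lambda>x. x ^ (n + 2) / real (n + 2)) has_real_derivative x ^ Suc n) (at x)" for x :: real
          using DERIV_cdivide[OF DERIV_pow[of "n + 2" x UNIV], of "real (n + 2)"] by simp
      qed (use True in auto)
      also have "ennreal (?f y) * \<dots> = ennreal (1 / real (n + 2) * (y ^ n * (ln (1 - y))\<^sup>2))"
        using True by (subst ennreal_mult[symmetric]) (auto simp: field_simps power2_eq_square)
      finally show ?thesis using True by (simp add: ennreal_mult'[symmetric])
    qed auto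
  qed
  also have "\<dots> = ennreal (1 / real (n + 2)) *
      (of_nat (n + 2) * (fact n * spacings (\<lambda>t. ennreal (t ^ 2)) n 1 0))"
    unfolding log2[symmetric] by (rule nn_integral_cmult) measurable
  also have "\<dots> = (ennreal (1 / real (n + 2)) * ennreal (real (n + 2))) *
      (fact n * spacings (\<lambda>t. ennreal (t ^ 2)) n 1 0)"
    unfolding ennreal_of_nat_eq_real_of_nat by (simp only: mult_ac)
  also have "ennreal (1 / real (n + 2)) * ennreal (real (n + 2)) = 1"
    by (subst ennreal_mult[symmetric]) auto
  finally show "(\<integral>\<^sup>+x. indicator {0<..<1} x * ennreal (gap_weight2 x * x ^ n) \<partial>lborel)
      = fact n * spacings (\<lambda>t. ennreal (t ^ 2)) n 1 0" by simp
qed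

text \<open>
  For \<open>t = 1 - x\<close> the bound follows from \<open>1 - x ^ n \<le> n * t\<close> and \<open>- ln t = 2 * ln (1 / sqrt t) \<le> 2 / sqrt t\<close>.
\<close>

lemma power_diff_mult_ln_bound:
  fixes x :: real
  assumes "0 \<le> x" "x \<le> 1"
  shows "\<bar>(x ^ n - 1) * ln (1 - x)\<bar> \<le> 2 * real n * sqrt (1 - x)"
proof (cases "x = 1")
  case False
  define t where "t = 1 - x"
  have t: "0 < t" "t \<le> 1" using assms False by (auto simp: t_def)
  have "1 - x ^ n \<le> real n * t"
    using Bernoulli_inequality[of "- t" n] t by (simp add: t_def algebra_simps)
  moreover have "0 \<le> 1 - x ^ n" using assms by (simp add: power_le_one)
  moreover have "- ln t \<le> 2 / sqrt t"
  proof -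
    have "- ln t = 2 * ln (1 / sqrt t)" using t by (simp add: ln_div ln_sqrt)
    also have "\<dots> \<le> 2 * (1 / sqrt t)" using t by (intro mult_left_mono ln_bound) auto
    finally show ?thesis by simp
  qed
  moreover have "0 \<le> - ln t" using t by simp
  ultimately have "(1 - x ^ n) * (- ln t) \<le> (real n * t) * (2 / sqrt t)"
    by (intro mult_mono) auto
  also have "\<dots> = 2 * real n * (t / sqrt t)" by simp
  also have "t / sqrt t = sqrt t" using t by (simp add: real_div_sqrt)
  finally show ?thesis
    using \<open>0 \<le> 1 - x ^ n\<close> \<open>0 \<le> - ln t\<close>
    by (simp add: t_def abs_mult mult.commute abs_of_nonpos)
qed simp

lemma geometric_quotient_integrable:
  "set_integrable lborel {0..1} (\<lambda>x. (1 - x ^ n) / (1 - x) :: real)"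
proof -
  have "set_integrable lborel {0..1} (\<lambda>x. \<Sum>i<n. x ^ i :: real)"
    by (intro borel_integrable_atLeastAtMost' continuous_intros)
  then show ?thesis
  proof (rule set_integrable_cong_AE[THEN iffD1, rotated -1])
    show "AE x\<in>{0..1} in lborel. (\<Sum>i<n. x ^ i) = (1 - x ^ n) / (1 - x :: real)"
      using AE_lborel_singleton[of "1 :: real"]
      by eventually_elim (simp add: sum_gp_strict)
  qed auto
qed

text \<open>
  Integration by parts: the difference of the two integrands is the derivative of
  \<open>(x ^ n - 1) * ln (1 - x)\<close>, which vanishes at both ends of \<open>[0,1]\<close>.
\<close>

lemma gap_weight1_derivative_power:
  "(LBINT x:{0..1}. gap_weight1 x * (real n * x ^ (n - 1))) = (LBINT x:{0..1}. (1 - x ^ n) / (1 - x))"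
proof -
  let ?F = "\<lambda>x. (x ^ n - 1) * ln (1 - x :: real)"
  let ?f = "\<lambda>x. (1 - x ^ n) / (1 - x) - gap_weight1 x * (real n * x ^ (n - 1))"
  have int1: "set_integrable lborel {0..1} (\<lambda>x. gap_weight1 x * (real n * x ^ (n - 1)))"
    using set_integrable_mult_right[OF gap_moment_weight_integral(1)[OF gap_moment_weight1, of "n - 1"], of "real n"]
    by (simp add: mult_ac)
  have int: "set_integrable lborel {0..1} ?f"
    by (intro set_integral_diff geometric_quotient_integrable int1)
  \<comment> \<open>At \<open>x = 1\<close> the value of \<open>?F\<close> is \<open>0\<close>, since \<open>0 * ln 0 = 0\<close>, and \<open>0\<close> is also the limit.\<close>
  have "continuous_on {0..1} ?F"
    unfolding continuous_on_eq_continuous_within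
  proof
    fix x :: real assume x: "x \<in> {0..1}"
    show "continuous (at x within {0..1}) ?F"
    proof (cases "x = 1")
      case True
      have "((\<lambda>x. 2 * real n * sqrt (1 - x)) \<longlongrightarrow> 2 * real n * sqrt (1 - 1)) (at 1 within {0..1})"
        by (intro tendsto_intros)
      then have "((\<lambda>x. 2 * real n * sqrt (1 - x)) \<longlongrightarrow> 0) (at 1 within {0..1})"
        by simp
      then have "(?F \<longlongrightarrow> 0) (at 1 within {0..1})"
      proof (rule Lim_null_comparison[rotated])
        show "\<forall>\<^sub>F x in at 1 within {0..1}. norm (?F x) \<le> 2 * real n * sqrt (1 - x)"
          unfolding eventually_at_filter real_norm_def
          by (intro always_eventually allI impI power_diff_mult_ln_bound) auto
      qed
      then show ?thesis by (simp add: continuous_within True)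
    qed (use x in \<open>auto intro!: continuous_intros\<close>)
  qed
  moreover have "(?F has_vector_derivative ?f x) (at x)" if "x \<in> {0<..<1}" for x
  proof -
    have "(?F has_real_derivative real n * x ^ (n - 1) * ln (1 - x) + (x ^ n - 1) * (- 1 / (1 - x))) (at x)"
      using that by (auto intro!: derivative_eq_intros)
    also have "real n * x ^ (n - 1) * ln (1 - x) + (x ^ n - 1) * (- 1 / (1 - x)) = ?f x"
      by (simp add: gap_weight1_def diff_divide_distrib mult_ac)
    finally show ?thesis by (simp add: has_real_derivative_iff_has_vector_derivative)
  qed
  ultimately have "(?f has_integral (?F 1 - ?F 0)) {0..1}"
    by (intro fundamental_theorem_of_calculus_interior) auto
  then have "(LBINT x:{0..1}. ?f x) = 0"
    using set_borel_integral_eq_integral(2)[OF int] by (simp add: integral_unique)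
  then show ?thesis
    using set_integral_diff(2)[OF geometric_quotient_integrable int1, of n] by simp
qed

lemma geometric_quotient_bound:
  fixes x :: real
  assumes "x \<in> {0..1}"
  shows "\<bar>(1 - x ^ n) / (1 - x)\<bar> \<le> real n"
proof (cases "x = 1")
  case False
  have "1 - x ^ n \<le> real n * (1 - x)" "0 \<le> 1 - x ^ n"
    using Bernoulli_inequality[of "x - 1" n] assms by (auto simp: algebra_simps power_le_one)
  then show ?thesis using False assms by (simp add: divide_le_eq)
qed simp

lemma gap_weight1_integrable: "set_integrable lborel {0..1} gap_weight1"
  using gap_moment_weight_integral(1)[OF gap_moment_weight1, of 0] by simp

lemma gap_weight1_zero: "gap_weight1 0 = 0"
  by (simp add: gap_weight1_def)

lemma set_integral_unit_cong:
  "(\<And>x. x \<in> {0..1} \<Longrightarrow> f x = g x) \<Longrightarrow> (LBINT x:{0..1}. f x) = (LBINT x:{0..1}. g x)" for f g :: "real \<Rightarrow> real"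
  by (rule set_lebesgue_integral_cong) auto

lemma set_integral_gap_weight1:
  "(LBINT x:{0..1}. gap_weight1 x * g x) = - (LBINT x:{0..1}. g x * ln (1 - x))"
  by (simp add: gap_weight1_def set_lebesgue_integral_def mult_ac)

section \<open>Freezing, exchanging and differentiating under the expectation\<close>

lemma integrable_mult_bounded_by:
  fixes F G :: "'a \<Rightarrow> real"
  assumes F: "integrable M F" and G: "G \<in> borel_measurable M" and bound: "AE \<omega> in M. \<bar>G \<omega>\<bar> \<le> C"
  shows "integrable M (\<lambda>\<omega>. F \<omega> * G \<omega>)"
proof (rule Bochner_Integration.integrable_bound)
  show "integrable M (\<lambda>\<omega>. C * F \<omega>)" using F by simp
  show "(\<lambda>\<omega>. F \<omega> * G \<omega>) \<in> borel_measurable M"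
    by (rule borel_measurable_times[OF borel_measurable_integrable[OF F] G])
  show "AE \<omega> in M. norm (F \<omega> * G \<omega>) \<le> norm (C * F \<omega>)"
    using bound
  proof eventually_elim
    case (elim \<omega>)
    then have "0 \<le> C" by (rule order_trans[OF abs_ge_zero])
    then show ?case using mult_right_mono[OF elim, of "\<bar>F \<omega>\<bar>"] by (simp add: abs_mult mult.commute)
  qed
qed

lemmas integrable_mult_bounded = integrable_mult_bounded_by[where C = 1]

text \<open>
  Independence lets a discrete variable be held fixed while averaging over an independent copy of
  the other one.  As \<open>indep_var\<close> requires both variables to take values in the same type, the
  discrete variable is given as a function \<open>\<zeta>\<close> of a variable \<open>U\<close> of the type of \<open>Y\<close>.
\<close>

lemma (in prob_space) freeze_countable:
  fixes \<zeta> :: "'b \<Rightarrow> 'z :: countable" and f :: "'z \<Rightarrow> 'b \<Rightarrow> real"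
  assumes ind: "indep_var L U N Y"
    and \<zeta>[measurable]: "\<zeta> \<in> measurable L (count_space UNIV)"
    and meas[measurable]: "\<And>z. f z \<in> borel_measurable N"
  shows "(\<integral>\<^sup>+\<omega>. ennreal (f (\<zeta> (U \<omega>)) (Y \<omega>)) \<partial>M)
      = (\<integral>\<^sup>+\<omega>. (\<integral>\<^sup>+\<omega>'. ennreal (f (\<zeta> (U \<omega>)) (Y \<omega>')) \<partial>M) \<partial>M)" (is ?nn)
    and "integrable M (\<lambda>\<omega>. f (\<zeta> (U \<omega>)) (Y \<omega>)) \<Longrightarrow>
      expectation (\<lambda>\<omega>. f (\<zeta> (U \<omega>)) (Y \<omega>))
        = expectation (\<lambda>\<omega>. expectation (\<lambda>\<omega>'. f (\<zeta> (U \<omega>)) (Y \<omega>')))" (is "?int \<Longrightarrow> ?eq")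
proof -
  have U[measurable]: "U \<in> measurable M L" and Y[measurable]: "Y \<in> measurable M N"
    using ind by (auto dest: indep_var_rv1 indep_var_rv2)
  have joint: "distr M (L \<Otimes>\<^sub>M N) (\<lambda>\<omega>. (U \<omega>, Y \<omega>)) = distr M L U \<Otimes>\<^sub>M distr M N Y"
    using ind by (simp add: indep_var_distribution_eq)
  interpret U: prob_space "distr M L U" by (rule prob_space_distr) measurable
  interpret Y: prob_space "distr M N Y" by (rule prob_space_distr) measurable
  interpret UY: pair_prob_space "distr M L U" "distr M N Y" ..
  have [measurable]: "(\<lambda>p. f (\<zeta> (fst p)) (snd p)) \<in> borel_measurable (L \<Otimes>\<^sub>M N)"
    by (rule measurable_compose_countable[where f = "\<lambda>z p. f z (snd p)" and g = "\<lambda>p. \<zeta> (fst p)"])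
       measurable
  have inner: "(\<integral>\<^sup>+y. ennreal (f z y) \<partial>distr M N Y) = (\<integral>\<^sup>+\<omega>'. ennreal (f z (Y \<omega>')) \<partial>M)"
    "(\<integral>y. f z y \<partial>distr M N Y) = expectation (\<lambda>\<omega>'. f z (Y \<omega>'))" for z
    using meas[of z] by (simp_all add: nn_integral_distr integral_distr)
  show ?nn
  proof -
    have "(\<integral>\<^sup>+\<omega>. ennreal (f (\<zeta> (U \<omega>)) (Y \<omega>)) \<partial>M)
        = (\<integral>\<^sup>+p. ennreal (f (\<zeta> (fst p)) (snd p)) \<partial>distr M (L \<Otimes>\<^sub>M N) (\<lambda>\<omega>. (U \<omega>, Y \<omega>)))"
      by (subst nn_integral_distr) auto
    also have "\<dots> = (\<integral>\<^sup>+u. \<integral>\<^sup>+y. ennreal (f (\<zeta> u) y) \<partial>distr M N Y \<partial>distr M L U)"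
      unfolding joint by (subst Y.nn_integral_fst[symmetric]) auto
    also have "\<dots> = (\<integral>\<^sup>+\<omega>. (\<integral>\<^sup>+\<omega>'. ennreal (f (\<zeta> (U \<omega>)) (Y \<omega>')) \<partial>M) \<partial>M)"
      unfolding inner
      by (rule nn_integral_distr[OF U])
         (rule measurable_compose[where f = \<zeta> and N = "count_space UNIV"], auto)
    finally show ?thesis .
  qed
  assume ?int
  then have int: "integrable (distr M L U \<Otimes>\<^sub>M distr M N Y) (\<lambda>p. f (\<zeta> (fst p)) (snd p))"
    unfolding joint[symmetric] by (subst integrable_distr_eq) auto
  have "expectation (\<lambda>\<omega>. f (\<zeta> (U \<omega>)) (Y \<omega>))
      = (\<integral>p. f (\<zeta> (fst p)) (snd p) \<partial>distr M (L \<Otimes>\<^sub>M N) (\<lambda>\<omega>. (U \<omega>, Y \<omega>)))"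
    by (subst integral_distr) auto
  also have "\<dots> = (\<integral>u. \<integral>y. f (\<zeta> u) y \<partial>distr M N Y \<partial>distr M L U)"
    unfolding joint using UY.integral_fst'[OF int] by simp
  also have "\<dots> = expectation (\<lambda>\<omega>. expectation (\<lambda>\<omega>'. f (\<zeta> (U \<omega>)) (Y \<omega>')))"
    unfolding inner
    by (rule integral_distr[OF U])
       (rule measurable_compose[where f = \<zeta> and N = "count_space UNIV"], auto)
  finally show ?eq .
qed

text \<open>
  Fubini's theorem with the dominating function \<open>F \<omega> * B (N \<omega>) * w x\<close>.
\<close>

lemma (in prob_space) expectation_unit_integral_swap:
  fixes F :: "'a \<Rightarrow> real" and N :: "'a \<Rightarrow> nat" and f :: "nat \<Rightarrow> real \<Rightarrow> real"
  assumes F[measurable]: "F \<in> borel_measurable M" and N[measurable]: "N \<in> measurable M (count_space UNIV)"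
    and f[measurable]: "\<And>n. f n \<in> borel_measurable borel"
    and w: "set_integrable lborel {0..1} w"
    and bound: "\<And>n x. x \<in> {0..1} \<Longrightarrow> \<bar>f n x\<bar> \<le> B n * w x"
    and int: "integrable M (\<lambda>\<omega>. F \<omega> * B (N \<omega>))"
  shows "expectation (\<lambda>\<omega>. F \<omega> * (LBINT x:{0..1}. f (N \<omega>) x))
      = (LBINT x:{0..1}. expectation (\<lambda>\<omega>. F \<omega> * f (N \<omega>) x))"
    and "set_integrable lborel {0..1} (\<lambda>x. expectation (\<lambda>\<omega>. F \<omega> * f (N \<omega>) x))"
    and "integrable M (\<lambda>\<omega>. F \<omega> * (LBINT x:{0..1}. f (N \<omega>) x))"
proof -
  interpret P: pair_sigma_finite M lborel ..
  define g where "g \<omega> x = indicator {0..1} x * (F \<omega> * f (N \<omega>) x)" for \<omega> and x :: real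
  define G where "G \<omega> x = F \<omega> * B (N \<omega>) * (indicator {0..1} x * w x)" for \<omega> and x :: real
  have w': "integrable lborel (\<lambda>x. indicator {0..1} x * w x)"
    using w by (simp add: set_integrable_def)
  then have [measurable]: "(\<lambda>x. indicator {0..1} x * w x) \<in> borel_measurable borel"
    by (auto dest: borel_measurable_integrable)
  have [measurable]: "(\<lambda>\<omega>. F \<omega> * B (N \<omega>)) \<in> borel_measurable M"
    using int by (rule borel_measurable_integrable)
  have "(\<lambda>p. f (N (fst p)) (snd p)) \<in> borel_measurable (M \<Otimes>\<^sub>M lborel)"
    by (rule measurable_compose_countable[where f = "\<lambda>n p. f n (snd p)" and g = "\<lambda>p. N (fst p)"])
       measurable
  then have [measurable]: "case_prod g \<in> borel_measurable (M \<Otimes>\<^sub>M lborel)"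
    unfolding g_def case_prod_unfold by measurable
  have "integrable (M \<Otimes>\<^sub>M lborel) (case_prod G)"
  proof (rule P.Fubini_integrable)
    show "case_prod G \<in> borel_measurable (M \<Otimes>\<^sub>M lborel)"
      unfolding G_def case_prod_unfold by measurable
    have "(\<integral>x. norm (case_prod G (\<omega>, x)) \<partial>lborel)
        = \<bar>F \<omega> * B (N \<omega>)\<bar> * (\<integral>x. \<bar>indicator {0..1} x * w x\<bar> \<partial>lborel)" for \<omega>
      by (simp add: G_def abs_mult)
    then show "integrable M (\<lambda>\<omega>. \<integral>x. norm (case_prod G (\<omega>, x)) \<partial>lborel)"
      using int by simp
    show "AE \<omega> in M. integrable lborel (\<lambda>x. case_prod G (\<omega>, x))"
      using w' by (simp add: G_def)
  qed
  then have g_int: "integrable (M \<Otimes>\<^sub>M lborel) (case_prod g)"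
  proof (rule Bochner_Integration.integrable_bound)
    have "norm (g \<omega> x) \<le> norm (G \<omega> x)" for \<omega> x
    proof (cases "x \<in> {0..1}")
      case True
      then have "\<bar>F \<omega>\<bar> * \<bar>f (N \<omega>) x\<bar> \<le> \<bar>F \<omega>\<bar> * \<bar>B (N \<omega>) * w x\<bar>"
        using bound[of x "N \<omega>"] by (intro mult_left_mono) auto
      then show ?thesis using True by (simp add: g_def G_def abs_mult mult_ac)
    qed (simp add: g_def)
    then show "AE p in M \<Otimes>\<^sub>M lborel. norm (case_prod g p) \<le> norm (case_prod G p)" by auto
  qed simp
  have inner: "(\<integral>x. g \<omega> x \<partial>lborel) = F \<omega> * (LBINT x:{0..1}. f (N \<omega>) x)" for \<omega>
    unfolding g_def set_lebesgue_integral_def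
    by (subst integral_mult_right_zero[symmetric]) (simp add: mult_ac)
  have outer: "expectation (\<lambda>\<omega>. g \<omega> x) = indicator {0..1} x *\<^sub>R expectation (\<lambda>\<omega>. F \<omega> * f (N \<omega>) x)" for x
    unfolding g_def by simp
  show "expectation (\<lambda>\<omega>. F \<omega> * (LBINT x:{0..1}. f (N \<omega>) x))
      = (LBINT x:{0..1}. expectation (\<lambda>\<omega>. F \<omega> * f (N \<omega>) x))"
    using P.Fubini_integral[OF g_int] unfolding inner outer set_lebesgue_integral_def by simp
  show "set_integrable lborel {0..1} (\<lambda>x. expectation (\<lambda>\<omega>. F \<omega> * f (N \<omega>) x))"
    using P.integrable_snd[OF g_int] unfolding outer set_integrable_def by simp
  show "integrable M (\<lambda>\<omega>. F \<omega> * (LBINT x:{0..1}. f (N \<omega>) x))"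
    using P.integrable_fst[OF g_int] unfolding inner by simp
qed

text \<open>
  Dominated convergence: on \<open>[0,1]\<close> the difference quotients of \<open>x ^ n\<close> are at most \<open>n\<close>.  The
  statement includes the one-sided derivatives at the end points.
\<close>

lemma (in prob_space) has_derivative_expectation_power:
  fixes F :: "'a \<Rightarrow> real" and N :: "'a \<Rightarrow> nat"
  assumes F: "integrable M F" and N[measurable]: "N \<in> measurable M (count_space UNIV)"
    and FN: "integrable M (\<lambda>\<omega>. F \<omega> * real (N \<omega>))" and x: "x \<in> {0..1}"
  shows "((\<lambda>x. expectation (\<lambda>\<omega>. F \<omega> * x ^ N \<omega>)) has_real_derivative
           expectation (\<lambda>\<omega>. F \<omega> * (real (N \<omega>) * x ^ (N \<omega> - 1)))) (at x within {0..1})"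
  unfolding has_field_derivative_iff tendsto_at_iff_sequentially
proof safe
  fix y :: "nat \<Rightarrow> real" assume y: "\<forall>i. y i \<in> {0..1} - {x}" and lim: "y \<longlonglongrightarrow> x"
  have [measurable]: "F \<in> borel_measurable M" using F by (rule borel_measurable_integrable)
  have int: "integrable M (\<lambda>\<omega>. F \<omega> * z ^ N \<omega>)" if "z \<in> {0..1}" for z
    by (rule Bochner_Integration.integrable_bound[OF F])
       (use that in \<open>auto simp: abs_mult power_abs power_le_one intro!: mult_left_le\<close>)
  let ?q = "\<lambda>i \<omega>. F \<omega> * ((y i ^ N \<omega> - x ^ N \<omega>) / (y i - x))"
  have lim_q: "(\<lambda>i. expectation (?q i)) \<longlonglongrightarrow> expectation (\<lambda>\<omega>. F \<omega> * (real (N \<omega>) * x ^ (N \<omega> - 1)))"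
  proof (rule integral_dominated_convergence[where w = "\<lambda>\<omega>. \<bar>F \<omega> * real (N \<omega>)\<bar>"])
    show "AE \<omega> in M. (\<lambda>i. ?q i \<omega>) \<longlonglongrightarrow> F \<omega> * (real (N \<omega>) * x ^ (N \<omega> - 1))"
    proof (rule AE_I2)
      fix \<omega>
      have "((\<lambda>x. x ^ N \<omega>) has_real_derivative real (N \<omega>) * x ^ (N \<omega> - 1)) (at x within {0..1})"
        using DERIV_pow[of "N \<omega>" x "{0..1}"] by simp
      then have "(\<lambda>i. (y i ^ N \<omega> - x ^ N \<omega>) / (y i - x)) \<longlonglongrightarrow> real (N \<omega>) * x ^ (N \<omega> - 1)"
        using y lim unfolding has_field_derivative_iff tendsto_at_iff_sequentially comp_def by blast
      then show "(\<lambda>i. ?q i \<omega>) \<longlonglongrightarrow> F \<omega> * (real (N \<omega>) * x ^ (N \<omega> - 1))"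
        by (rule tendsto_mult_left)
    qed
    show "AE \<omega> in M. norm (?q i \<omega>) \<le> \<bar>F \<omega> * real (N \<omega>)\<bar>" for i
    proof (rule AE_I2)
      fix \<omega>
      have "y i \<in> {0..1}" "y i \<noteq> x" using y by auto
      then have "\<bar>y i ^ N \<omega> - x ^ N \<omega>\<bar> \<le> real (N \<omega>) * \<bar>y i - x\<bar>"
        using norm_power_diff[of "y i" x "N \<omega>"] x by simp
      then have "\<bar>(y i ^ N \<omega> - x ^ N \<omega>) / (y i - x)\<bar> \<le> real (N \<omega>)"
        using \<open>y i \<noteq> x\<close> by (simp add: divide_le_eq)
      then show "norm (?q i \<omega>) \<le> \<bar>F \<omega> * real (N \<omega>)\<bar>"
        unfolding real_norm_def abs_mult by (intro mult_left_mono) auto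
    qed
  qed (use FN in auto)
  have eq: "expectation (?q i)
      = (expectation (\<lambda>\<omega>. F \<omega> * y i ^ N \<omega>) - expectation (\<lambda>\<omega>. F \<omega> * x ^ N \<omega>)) / (y i - x)" for i
    using y int[of "y i"] int[OF x]
    by (subst Bochner_Integration.integral_diff[symmetric]) (auto simp: right_diff_distrib)
  show "((\<lambda>y. (expectation (\<lambda>\<omega>. F \<omega> * y ^ N \<omega>) - expectation (\<lambda>\<omega>. F \<omega> * x ^ N \<omega>)) / (y - x)) \<circ> y)
      \<longlonglongrightarrow> expectation (\<lambda>\<omega>. F \<omega> * (real (N \<omega>) * x ^ (N \<omega> - 1)))"
    using lim_q unfolding eq comp_def .
qed

lemma unit_deriv_eqI:
  assumes "(f has_real_derivative D) (at x within {0..1})" "x \<in> {0..1}"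
    and "\<And>y. y \<in> {0..1} \<Longrightarrow> g y = f y"
  shows "unit_deriv g x = D"
proof -
  have "(g has_vector_derivative D) (at x within {0..1})"
    using has_vector_derivative_transform[OF assms(2,3)] assms(1)
    by (simp add: has_real_derivative_iff_has_vector_derivative)
  then show ?thesis unfolding unit_deriv_def
    using assms(2) by (intro vector_derivative_within_closed_interval) auto
qed

lemma measurable_prefix:
  fixes a :: "nat \<Rightarrow> 'c \<Rightarrow> nat"
  assumes m: "m \<in> measurable N (count_space UNIV)" and a: "\<And>j. a j \<in> measurable N (count_space UNIV)"
  shows "(\<lambda>\<omega>. map (\<lambda>j. a j \<omega>) [0..<m \<omega>]) \<in> measurable N (count_space UNIV)"
proof -
  have "(\<lambda>\<omega>. map (\<lambda>j. a j \<omega>) [0..<m \<omega>]) -` {l} \<inter> space N \<in> sets N" for l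
  proof -
    have "map (\<lambda>j. a j \<omega>) [0..<m \<omega>] = l \<longleftrightarrow> m \<omega> = length l \<and> (\<forall>j\<in>{..<length l}. a j \<omega> = l ! j)" for \<omega>
      by (auto simp: list_eq_iff_nth_eq)
    then have "(\<lambda>\<omega>. map (\<lambda>j. a j \<omega>) [0..<m \<omega>]) -` {l} \<inter> space N
        = {\<omega> \<in> space N. m \<omega> = length l \<and> (\<forall>j\<in>{..<length l}. a j \<omega> = l ! j)}"
      by blast
    also have "\<dots> \<in> sets N"
      using m a by (intro sets.sets_Collect_conj sets.sets_Collect_finite_All)
        (auto intro!: measurable_sets_Collect[where P = "\<lambda>n. n = c" for c])
    finally show ?thesis .
  qed
  then show ?thesis by (auto simp: measurable_count_space_eq_countable)
qed

section \<open>Occupied aisles and finite sums\<close>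

lemma last_aisle_le: "last_aisle k M A \<omega> \<le> k"
proof -
  have "finite (occupied k M A \<omega>)" by (simp add: occupied_def)
  then show ?thesis using Max_in[of "occupied k M A \<omega>"] by (auto simp: last_aisle_def occupied_def)
qed

lemma first_last_aisle_cases:
  "first_aisle k M A \<omega> = 0 \<and> last_aisle k M A \<omega> = 0
    \<or> 1 \<le> first_aisle k M A \<omega> \<and> first_aisle k M A \<omega> \<le> last_aisle k M A \<omega>"
proof (cases "occupied k M A \<omega> = {}")
  case False
  have fin: "finite (occupied k M A \<omega>)" by (simp add: occupied_def)
  have "1 \<le> Min (occupied k M A \<omega>)" using Min_in[OF fin False] by (auto simp: occupied_def)
  then show ?thesis using fin False by (simp add: first_aisle_def last_aisle_def)
qed (simp add: first_aisle_def last_aisle_def)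

lemma sum_one_exceptional_weight:
  fixes x :: real
  assumes "finite B"
  shows "(\<Sum>c\<in>B. if c = i then x else 1) = real (card B) + (if i \<in> B then x - 1 else 0)"
proof -
  have "(\<Sum>c\<in>B. if c = i then x else 1) = (\<Sum>c\<in>B. 1 + (if c = i then x - 1 else 0))"
    by (intro sum.cong) auto
  then show ?thesis using assms by (simp add: sum.distrib)
qed

lemma sum_two_exceptional_weights:
  fixes x y :: real
  assumes "finite B" "i \<noteq> j"
  shows "(\<Sum>c\<in>B. if c = i then x else if c = j then y else 1)
    = real (card B) + (if i \<in> B then x - 1 else 0) + (if j \<in> B then y - 1 else 0)"
proof -
  have "(\<Sum>c\<in>B. if c = i then x else if c = j then y else 1)
      = (\<Sum>c\<in>B. 1 + (if c = i then x - 1 else 0) + (if c = j then y - 1 else 0))"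
    using assms(2) by (intro sum.cong) auto
  then show ?thesis using assms by (simp add: sum.distrib)
qed

lemma sum_tail_indicator:
  fixes n k :: nat
  assumes "n \<le> k"
  shows "(\<Sum>r<k. if n \<le> r then 1 else 0) = real k - real n"
    and "(\<Sum>r<k. if n \<le> r then 2 * real r + 1 else 0) = (real k)\<^sup>2 - (real n)\<^sup>2"
proof -
  show "(\<Sum>r<k. if n \<le> r then 1 else 0) = real k - real n"
    using assms
  proof (induction k rule: dec_induct)
    case base
    show ?case by (simp add: sum.neutral)
  qed simp
  show "(\<Sum>r<k. if n \<le> r then 2 * real r + 1 else 0) = (real k)\<^sup>2 - (real n)\<^sup>2"
    using assms
  proof (induction k rule: dec_induct)
    case base
    show ?case by (simp add: sum.neutral)
  qed (simp add: power2_eq_square algebra_simps)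
qed

text \<open>
  Pairs of inner aisles exist for \<open>m \<ge> 3\<close> only; their coefficient \<open>m - 2\<close> vanishes for \<open>m = 2\<close>.
\<close>

lemma sum_drop_two: "f (2 :: nat) = 0 \<Longrightarrow> (\<Sum>m=2..<k. f m) = (\<Sum>m=3..<k. f m)" for f :: "nat \<Rightarrow> real"
proof (rule sum.mono_neutral_right)
  assume "f 2 = 0"
  show "\<forall>i\<in>{2..<k} - {3..<k}. f i = 0"
  proof
    fix i assume "i \<in> {2..<k} - {3..<k}"
    then have "i = 2" by auto
    with \<open>f 2 = 0\<close> show "f i = 0" by simp
  qed
qed auto

section \<open>The model and its independent sources\<close>

locale picking_order = prob_space \<Omega> for \<Omega> :: "'a measure" +
  fixes k :: nat and M :: "'a \<Rightarrow> nat" and A :: "nat \<Rightarrow> 'a \<Rightarrow> nat" and X :: "nat \<Rightarrow> 'a \<Rightarrow> real"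
    and P :: "nat \<Rightarrow> 'a \<Rightarrow> real" and P\<^sub>0 :: "'a \<Rightarrow> real"
  assumes k_pos: "k \<ge> 1"
    and M_measurable [measurable]: "M \<in> measurable \<Omega> (count_space UNIV)"
    and M_square_integrable: "integrable \<Omega> (\<lambda>\<omega>. (real (M \<omega>))\<^sup>2)"
    and A_uniform: "distr \<Omega> (count_space UNIV) (A j) = measure_pmf (pmf_of_set {1..k})"
    and X_uniform: "distr \<Omega> lborel (X j) = unit_uniform"
    and P\<^sub>0_measurable [measurable]: "P\<^sub>0 \<in> borel_measurable \<Omega>"
    and P\<^sub>0_square_integrable: "integrable \<Omega> (\<lambda>\<omega>. (P\<^sub>0 \<omega>)\<^sup>2)"
    and P_distr: "distr \<Omega> borel (P j) = distr \<Omega> borel P\<^sub>0"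
    and indep_sources: "indep_vars (\<lambda>_. borel) (source_var M A X P) UNIV"
begin

abbreviation src :: "'a \<Rightarrow> source \<Rightarrow> real" where
  "src \<omega> s \<equiv> source_var M A X P s \<omega>"

lemma source_measurable: "source_var M A X P s \<in> borel_measurable \<Omega>"
  using indep_sources by (auto simp: indep_vars_def)

lemma X_measurable [measurable]: "X j \<in> borel_measurable \<Omega>"
  using source_measurable[of "Location j"] by simp

lemma P_measurable [measurable]: "P j \<in> borel_measurable \<Omega>"
  using source_measurable[of "Picking j"] by simp

lemma A_measurable [measurable]: "A j \<in> measurable \<Omega> (count_space UNIV)"
proof -
  have "(\<lambda>\<omega>. nat \<lfloor>source_var M A X P (Aisle j) \<omega>\<rfloor>) \<in> measurable \<Omega> (count_space UNIV)"
    using source_measurable by measurable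
  then show ?thesis by simp
qed

lemma AE_A_range: "AE \<omega> in \<Omega>. \<forall>j. A j \<omega> \<in> {1..k}"
proof -
  have "AE \<omega> in \<Omega>. A j \<omega> \<in> {1..k}" for j
  proof -
    have "AE i in distr \<Omega> (count_space UNIV) (A j). i \<in> {1..k}"
      unfolding A_uniform using k_pos by (simp add: AE_measure_pmf_iff)
    then show ?thesis by (subst (asm) AE_distr_iff) auto
  qed
  then show ?thesis by (simp add: AE_all_countable)
qed

lemma AE_X_range: "AE \<omega> in \<Omega>. \<forall>j. X j \<omega> \<in> {0..1}"
proof -
  have "AE \<omega> in \<Omega>. X j \<omega> \<in> {0..1}" for j
  proof -
    have "AE x in distr \<Omega> lborel (X j). x \<in> {0..1}"
      unfolding X_uniform by (rule AE_uniform_measureI) auto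
    then show ?thesis by (subst (asm) AE_distr_iff) auto
  qed
  then show ?thesis by (simp add: AE_all_countable)
qed

lemma integral_A:
  fixes w :: "nat \<Rightarrow> real"
  shows "expectation (\<lambda>\<omega>. w (A j \<omega>)) = (\<Sum>i=1..k. w i) / real k"
    and "integrable \<Omega> (\<lambda>\<omega>. w (A j \<omega>))"
proof -
  have "expectation (\<lambda>\<omega>. w (A j \<omega>)) = (\<integral>i. w i \<partial>distr \<Omega> (count_space UNIV) (A j))"
    by (subst integral_distr) auto
  also have "\<dots> = (\<Sum>i=1..k. w i) / real k"
    unfolding A_uniform using k_pos by (subst integral_pmf_of_set) auto
  finally show "expectation (\<lambda>\<omega>. w (A j \<omega>)) = (\<Sum>i=1..k. w i) / real k" .
  have "integrable (distr \<Omega> (count_space UNIV) (A j)) w"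
    unfolding A_uniform using k_pos by (intro integrable_measure_pmf_finite) simp
  then show "integrable \<Omega> (\<lambda>\<omega>. w (A j \<omega>))"
    by (subst (asm) integrable_distr_eq) auto
qed

lemma P_moments:
  "integrable \<Omega> (P j)" "integrable \<Omega> (\<lambda>\<omega>. (P j \<omega>)\<^sup>2)"
  "expectation (P j) = expectation P\<^sub>0" "expectation (\<lambda>\<omega>. (P j \<omega>)\<^sup>2) = expectation (\<lambda>\<omega>. (P\<^sub>0 \<omega>)\<^sup>2)"
proof -
  have eq: "expectation (\<lambda>\<omega>. f (P j \<omega>)) = expectation (\<lambda>\<omega>. f (P\<^sub>0 \<omega>))"
    "integrable \<Omega> (\<lambda>\<omega>. f (P j \<omega>)) \<longleftrightarrow> integrable \<Omega> (\<lambda>\<omega>. f (P\<^sub>0 \<omega>))"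
    if [measurable]: "f \<in> borel_measurable borel" for f :: "real \<Rightarrow> real"
    using integral_distr[of "P j" \<Omega> borel f] integral_distr[of "P\<^sub>0" \<Omega> borel f]
      integrable_distr_eq[of "P j" \<Omega> borel f] integrable_distr_eq[of "P\<^sub>0" \<Omega> borel f] P_distr[of j]
    by auto
  show sq: "integrable \<Omega> (\<lambda>\<omega>. (P j \<omega>)\<^sup>2)"
    using eq(2)[of "\<lambda>x. x\<^sup>2"] P\<^sub>0_square_integrable by simp
  show "integrable \<Omega> (P j)"
    using sq by (rule square_integrable_imp_integrable[rotated]) simp
  show "expectation (P j) = expectation P\<^sub>0" using eq(1)[of "\<lambda>x. x"] by simp
  show "expectation (\<lambda>\<omega>. (P j \<omega>)\<^sup>2) = expectation (\<lambda>\<omega>. (P\<^sub>0 \<omega>)\<^sup>2)" using eq(1)[of "\<lambda>x. x\<^sup>2"] by simp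
qed

lemma M_integrable: "integrable \<Omega> (\<lambda>\<omega>. real (M \<omega>))"
  using M_square_integrable by (rule square_integrable_imp_integrable[rotated]) simp

abbreviation restrict_src :: "source set \<Rightarrow> 'a \<Rightarrow> source \<Rightarrow> real" where
  "restrict_src K \<omega> \<equiv> restrict (src \<omega>) K"

lemma indep_disjoint_sources:
  assumes "K \<inter> L = {}"
    and "f \<in> measurable (PiM K (\<lambda>_. borel)) N1" "g \<in> measurable (PiM L (\<lambda>_. borel)) N2"
  shows "indep_var N1 (\<lambda>\<omega>. f (restrict_src K \<omega>)) N2 (\<lambda>\<omega>. g (restrict_src L \<omega>))"
  using indep_var_compose[OF indep_var_restrict[OF indep_sources assms(1)] assms(2,3)]
  by (simp add: comp_def)

text \<open>
  The placement of the order, that is, all of its discrete data: the length of the list is the order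
  size.  Lists of natural numbers form a countable type, so the placement can be frozen.
\<close>

definition picks :: "'a \<Rightarrow> nat list" where
  "picks \<omega> = map (\<lambda>j. A j \<omega>) [0..<M \<omega>]"

definition item_sources :: "source set" where
  "item_sources = range Location \<union> range Picking"

lemma picks_measurable [measurable]: "picks \<in> measurable \<Omega> (count_space UNIV)"
  unfolding picks_def by (rule measurable_prefix) measurable

lemma freeze_picks:
  fixes f :: "nat list \<Rightarrow> (source \<Rightarrow> real) \<Rightarrow> real"
  assumes "\<And>z. f z \<in> borel_measurable (PiM item_sources (\<lambda>_. borel))"
  shows "(\<integral>\<^sup>+\<omega>. ennreal (f (picks \<omega>) (restrict_src item_sources \<omega>)) \<partial>\<Omega>)
      = (\<integral>\<^sup>+\<omega>. (\<integral>\<^sup>+\<omega>'. ennreal (f (picks \<omega>) (restrict_src item_sources \<omega>')) \<partial>\<Omega>) \<partial>\<Omega>)" (is ?nn)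
    and "integrable \<Omega> (\<lambda>\<omega>. f (picks \<omega>) (restrict_src item_sources \<omega>)) \<Longrightarrow>
      expectation (\<lambda>\<omega>. f (picks \<omega>) (restrict_src item_sources \<omega>))
        = expectation (\<lambda>\<omega>. expectation (\<lambda>\<omega>'. f (picks \<omega>) (restrict_src item_sources \<omega>')))" (is "?int \<Longrightarrow> ?eq")
proof -
  let ?K = "insert Size (range Aisle)"
  let ?N = "PiM ?K (\<lambda>_. borel :: real measure)"
  let ?\<zeta> = "\<lambda>y. map (\<lambda>j. nat \<lfloor>y (Aisle j) :: real\<rfloor>) [0..<nat \<lfloor>y Size :: real\<rfloor>]"
  have [measurable]: "(\<lambda>y. y Size) \<in> borel_measurable ?N" "(\<lambda>y. y (Aisle j)) \<in> borel_measurable ?N" for j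
    by (rule measurable_component_singleton, blast)+
  have \<zeta>: "?\<zeta> \<in> measurable ?N (count_space UNIV)" by (rule measurable_prefix) measurable
  have "?K \<inter> item_sources = {}" by (auto simp: item_sources_def)
  then have ind: "indep_var ?N (restrict_src ?K) (PiM item_sources (\<lambda>_. borel)) (restrict_src item_sources)"
    by (rule indep_var_restrict[OF indep_sources]) auto
  have eq: "?\<zeta> (restrict_src ?K \<omega>) = picks \<omega>" for \<omega> by (simp add: picks_def)
  show ?nn and "?int \<Longrightarrow> ?eq"
    using freeze_countable[OF ind \<zeta>, where f = f, OF assms] unfolding eq by blast+
qed

lemma freeze_M:
  fixes f :: "nat \<Rightarrow> (source \<Rightarrow> real) \<Rightarrow> real"
  assumes "\<And>n. f n \<in> borel_measurable (PiM (range Aisle) (\<lambda>_. borel))"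
    and "integrable \<Omega> (\<lambda>\<omega>. f (M \<omega>) (restrict_src (range Aisle) \<omega>))"
  shows "expectation (\<lambda>\<omega>. f (M \<omega>) (restrict_src (range Aisle) \<omega>))
        = expectation (\<lambda>\<omega>. expectation (\<lambda>\<omega>'. f (M \<omega>) (restrict_src (range Aisle) \<omega>')))"
proof -
  let ?N = "PiM {Size} (\<lambda>_. borel :: real measure)"
  have [measurable]: "(\<lambda>y. y Size) \<in> borel_measurable ?N"
    by (rule measurable_component_singleton) blast
  have \<zeta>: "(\<lambda>y. nat \<lfloor>y Size\<rfloor>) \<in> measurable ?N (count_space UNIV)" by measurable
  have "{Size} \<inter> range Aisle = {}" by auto
  then have ind: "indep_var ?N (restrict_src {Size}) (PiM (range Aisle) (\<lambda>_. borel)) (restrict_src (range Aisle))"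
    by (rule indep_var_restrict[OF indep_sources]) auto
  have eq: "nat \<lfloor>restrict_src {Size} \<omega> Size\<rfloor> = M \<omega>" for \<omega> by simp
  show ?thesis
    using freeze_countable(2)[OF ind \<zeta>, where f = f, OF assms(1)] assms(2) unfolding eq by blast
qed

section \<open>Moments of the gaps given the placement\<close>

definition items_in :: "nat \<Rightarrow> nat list \<Rightarrow> nat list" where
  "items_in i z = filter (\<lambda>j. z ! j = i) [0..<length z]"

lemma items_in_picks: "items_in i (picks \<omega>) = filter (\<lambda>j. A j \<omega> = i) [0..<M \<omega>]"
  unfolding items_in_def picks_def by (intro filter_cong) auto

lemma distinct_items_in: "distinct (items_in i z)"
  by (simp add: items_in_def)

lemma item_count_eq: "item_count M A i \<omega> = length (items_in i (picks \<omega>))"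
proof -
  have "item_count M A i \<omega> = card (set (items_in i (picks \<omega>)))"
    unfolding item_count_def items_in_picks by (intro arg_cong[where f = card]) auto
  then show ?thesis by (simp add: distinct_card distinct_items_in)
qed

lemma largest_gap_eq: "largest_gap M A X i \<omega> = longest_gap (map (\<lambda>j. X j \<omega>) (items_in i (picks \<omega>)))"
  by (simp add: largest_gap_def items_in_picks)

lemma AE_longest_gap_X: "AE \<omega> in \<Omega>. \<forall>js. 0 \<le> longest_gap (map (\<lambda>j. X j \<omega>) js) \<and> longest_gap (map (\<lambda>j. X j \<omega>) js) \<le> 1"
  using AE_X_range
proof eventually_elim
  case (elim \<omega>)
  show ?case
  proof
    fix js
    have "set (map (\<lambda>j. X j \<omega>) js) \<subseteq> {0..1}" using elim by auto
    from longest_gap_bounds[OF this]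
    show "0 \<le> longest_gap (map (\<lambda>j. X j \<omega>) js) \<and> longest_gap (map (\<lambda>j. X j \<omega>) js) \<le> 1" by simp
  qed
qed

lemma longest_gap_X_integrable:
  "integrable \<Omega> (\<lambda>\<omega>. longest_gap (map (\<lambda>j. X j \<omega>) js) ^ p)"
proof (rule integrable_const_bound[where B = 1])
  show "AE \<omega> in \<Omega>. norm (longest_gap (map (\<lambda>j. X j \<omega>) js) ^ p) \<le> 1"
    using AE_longest_gap_X by eventually_elim (simp add: power_abs power_le_one)
  have [measurable]: "(\<lambda>\<omega>. longest_gap (map (\<lambda>j. X j \<omega>) js)) \<in> borel_measurable \<Omega>"
    by (rule longest_gap_measurable) measurable
  show "(\<lambda>\<omega>. longest_gap (map (\<lambda>j. X j \<omega>) js) ^ p) \<in> borel_measurable \<Omega>"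
    by measurable
qed

text \<open>
  With \<open>gap_weight1\<close> or \<open>gap_weight2\<close> for \<open>w\<close>, this is the first or second moment of the largest gap
  in an aisle with \<open>n\<close> items.
\<close>

definition gap_mean :: "(real \<Rightarrow> real) \<Rightarrow> nat \<Rightarrow> real" where
  "gap_mean w n = (LBINT x:{0..1}. w x * x ^ n)"

lemma expectation_longest_gap:
  assumes w: "gap_moment_weight p w" and "distinct js"
  shows "expectation (\<lambda>\<omega>. longest_gap (map (\<lambda>j. X j \<omega>) js) ^ p) = gap_mean w (length js)"
proof (cases "js = []")
  case True
  interpret E: prob_space "PiM {} (\<lambda>_ :: nat. unit_uniform)"
    by (intro prob_space_PiM prob_space_unit_uniform)
  show ?thesis
    using gap_moment_weight_integral(2)[OF w, of "[] :: nat list"] True prob_space E.prob_space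
    by (simp add: gap_mean_def)
next
  case False
  let ?S = "map Location js"
  let ?N = "PiM (set ?S) (\<lambda>_. borel :: real measure)"
  have dist: "distinct ?S" using assms(2) by (simp add: distinct_map inj_on_def)
  have "indep_vars (\<lambda>_. borel) (source_var M A X P) (set ?S)"
    by (rule indep_vars_subset[OF indep_sources]) auto
  then have "distr \<Omega> ?N (\<lambda>\<omega>. \<lambda>s\<in>set ?S. src \<omega> s) = PiM (set ?S) (\<lambda>s. distr \<Omega> borel (source_var M A X P s))"
    using False by (subst (asm) indep_vars_iff_distr_eq_PiM) (auto simp: source_measurable)
  also have "\<dots> = PiM (set ?S) (\<lambda>_. unit_uniform)"
  proof (rule PiM_cong)
    fix s assume "s \<in> set ?S"
    then obtain j where s: "s = Location j" by auto
    have "distr \<Omega> borel (X j) = distr \<Omega> lborel (X j)" by (rule distr_cong) auto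
    then show "distr \<Omega> borel (source_var M A X P s) = unit_uniform" using s X_uniform by simp
  qed simp
  finally have distr: "distr \<Omega> ?N (\<lambda>\<omega>. \<lambda>s\<in>set ?S. src \<omega> s) = PiM (set ?S) (\<lambda>_. unit_uniform)" .
  have [measurable]: "(\<lambda>y. longest_gap (map y ?S)) \<in> borel_measurable ?N"
    by (rule longest_gap_measurable[of ?S "\<lambda>s y. y s"]) auto
  have [measurable]: "(\<lambda>\<omega>. \<lambda>s\<in>set ?S. src \<omega> s) \<in> measurable \<Omega> ?N"
    by (rule measurable_restrict) (rule source_measurable)
  have eq: "map (\<lambda>s\<in>set ?S. src \<omega> s) ?S = map (\<lambda>j. X j \<omega>) js" for \<omega>
    by simp
  have "gap_mean w (length js) = (\<integral>y. longest_gap (map y ?S) ^ p \<partial>PiM (set ?S) (\<lambda>_. unit_uniform))"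
    using gap_moment_weight_integral(2)[OF w dist] by (simp add: gap_mean_def)
  also have "\<dots> = (\<integral>y. longest_gap (map y ?S) ^ p \<partial>distr \<Omega> ?N (\<lambda>\<omega>. \<lambda>s\<in>set ?S. src \<omega> s))"
    unfolding distr ..
  also have "\<dots> = expectation (\<lambda>\<omega>. longest_gap (map (\<lambda>s\<in>set ?S. src \<omega> s) ?S) ^ p)"
    by (rule integral_distr) measurable
  finally show ?thesis unfolding eq by simp
qed

text \<open>
  Disjoint sets of items have independent locations.
\<close>

lemma expectation_longest_gap_product:
  assumes "distinct js" "distinct js'" "set js \<inter> set js' = {}"
  shows "expectation (\<lambda>\<omega>. longest_gap (map (\<lambda>j. X j \<omega>) js) * longest_gap (map (\<lambda>j. X j \<omega>) js'))
    = gap_mean gap_weight1 (length js) * gap_mean gap_weight1 (length js')"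
proof -
  let ?K = "Location ` set js" and ?L = "Location ` set js'"
  have m: "(\<lambda>y. longest_gap (map (\<lambda>j. y (Location j)) js)) \<in> borel_measurable (PiM (Location ` set js) (\<lambda>_. borel))" for js
    by (rule longest_gap_measurable) auto
  have eq: "map (\<lambda>j. restrict_src (Location ` set js) \<omega> (Location j)) js = map (\<lambda>j. X j \<omega>) js" for js \<omega>
    by (rule map_cong) auto
  have "?K \<inter> ?L = {}" using assms(3) by auto
  from indep_disjoint_sources[OF this m m]
  have "indep_var borel (\<lambda>\<omega>. longest_gap (map (\<lambda>j. X j \<omega>) js)) borel (\<lambda>\<omega>. longest_gap (map (\<lambda>j. X j \<omega>) js'))"
    unfolding eq .
  from indep_var_lebesgue_integral[OF this] show ?thesis
    using longest_gap_X_integrable[of js 1] longest_gap_X_integrable[of js' 1] assms(1,2)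
      expectation_longest_gap[OF gap_moment_weight1, of js] expectation_longest_gap[OF gap_moment_weight1, of js']
    by simp
qed

text \<open>
  The form in which the placement is frozen below: \<open>h\<close> is given the placement, the locations and
  the picking times.
\<close>

lemma freeze_items:
  fixes h :: "nat list \<Rightarrow> (nat \<Rightarrow> real) \<Rightarrow> (nat \<Rightarrow> real) \<Rightarrow> real"
  assumes "\<And>z. (\<lambda>y. h z (\<lambda>j. y (Location j)) (\<lambda>j. y (Picking j))) \<in> borel_measurable (PiM item_sources (\<lambda>_. borel))"
  shows "(\<integral>\<^sup>+\<omega>. ennreal (h (picks \<omega>) (\<lambda>j. X j \<omega>) (\<lambda>j. P j \<omega>)) \<partial>\<Omega>)
      = (\<integral>\<^sup>+\<omega>. (\<integral>\<^sup>+\<omega>'. ennreal (h (picks \<omega>) (\<lambda>j. X j \<omega>') (\<lambda>j. P j \<omega>')) \<partial>\<Omega>) \<partial>\<Omega>)"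
    and "integrable \<Omega> (\<lambda>\<omega>. h (picks \<omega>) (\<lambda>j. X j \<omega>) (\<lambda>j. P j \<omega>)) \<Longrightarrow>
      expectation (\<lambda>\<omega>. h (picks \<omega>) (\<lambda>j. X j \<omega>) (\<lambda>j. P j \<omega>))
        = expectation (\<lambda>\<omega>. expectation (\<lambda>\<omega>'. h (picks \<omega>) (\<lambda>j. X j \<omega>') (\<lambda>j. P j \<omega>')))"
  using freeze_picks[of "\<lambda>z y. h z (\<lambda>j. y (Location j)) (\<lambda>j. y (Picking j))", OF assms]
  by (simp_all add: item_sources_def)

lemma measurable_locations:
  "(\<lambda>y. y (Location j)) \<in> borel_measurable (PiM item_sources (\<lambda>_. borel :: real measure))"
  "(\<lambda>y. y (Picking j)) \<in> borel_measurable (PiM item_sources (\<lambda>_. borel :: real measure))"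
  by (rule measurable_component_singleton, simp add: item_sources_def)+

lemma longest_gap_locations_measurable [measurable]:
  "(\<lambda>y. longest_gap (map (\<lambda>j. y (Location j)) js)) \<in> borel_measurable (PiM item_sources (\<lambda>_. borel :: real measure))"
  by (rule longest_gap_measurable) (rule measurable_locations)

lemma largest_gap_measurable [measurable]: "largest_gap M A X i \<in> borel_measurable \<Omega>"
  unfolding largest_gap_eq[abs_def]
  by (rule measurable_compose_countable[where f = "\<lambda>z \<omega>. longest_gap (map (\<lambda>j. X j \<omega>) (items_in i z))" and g = picks])
     (auto intro: longest_gap_measurable)

lemma AE_largest_gap: "AE \<omega> in \<Omega>. \<forall>i. 0 \<le> largest_gap M A X i \<omega> \<and> largest_gap M A X i \<omega> \<le> 1"
  unfolding largest_gap_eq using AE_longest_gap_X by eventually_elim blast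

lemma picks_comp_measurable:
  "(\<lambda>\<omega>. F (picks \<omega>)) \<in> measurable \<Omega> (count_space UNIV)" for F :: "nat list \<Rightarrow> 'c"
  using measurable_compose[OF picks_measurable, of F "count_space UNIV"] by simp

lemma picks_comp_borel: "(\<lambda>\<omega>. F (picks \<omega>)) \<in> borel_measurable \<Omega>" for F :: "nat list \<Rightarrow> real"
  using measurable_compose[OF picks_measurable, of F borel] by simp

lemma item_count_measurable [measurable]: "item_count M A i \<in> measurable \<Omega> (count_space UNIV)"
  unfolding item_count_eq[abs_def] by (rule picks_comp_measurable)

lemma conditional_gap_power:
  assumes w: "gap_moment_weight p w" and F: "integrable \<Omega> (\<lambda>\<omega>. F (picks \<omega>))"
  shows "expectation (\<lambda>\<omega>. F (picks \<omega>) * largest_gap M A X i \<omega> ^ p)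
       = expectation (\<lambda>\<omega>. F (picks \<omega>) * gap_mean w (item_count M A i \<omega>))"
proof -
  let ?h = "\<lambda>z x (p' :: nat \<Rightarrow> real). F z * longest_gap (map x (items_in i z)) ^ p"
  have "integrable \<Omega> (\<lambda>\<omega>. F (picks \<omega>) * largest_gap M A X i \<omega> ^ p)"
  proof (rule integrable_mult_bounded[OF F])
    show "AE \<omega> in \<Omega>. \<bar>largest_gap M A X i \<omega> ^ p\<bar> \<le> 1"
      using AE_largest_gap by eventually_elim (simp add: power_abs power_le_one)
  qed measurable
  then have "integrable \<Omega> (\<lambda>\<omega>. ?h (picks \<omega>) (\<lambda>j. X j \<omega>) (\<lambda>j. P j \<omega>))"
    by (simp add: largest_gap_eq)
  moreover have "(\<lambda>y. ?h z (\<lambda>j. y (Location j)) (\<lambda>j. y (Picking j))) \<in> borel_measurable (PiM item_sources (\<lambda>_. borel))" for z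
    by measurable
  ultimately have "expectation (\<lambda>\<omega>. ?h (picks \<omega>) (\<lambda>j. X j \<omega>) (\<lambda>j. P j \<omega>))
     = expectation (\<lambda>\<omega>. expectation (\<lambda>\<omega>'. ?h (picks \<omega>) (\<lambda>j. X j \<omega>') (\<lambda>j. P j \<omega>')))"
    by (intro freeze_items(2)[where h = ?h])
  then show ?thesis
    by (simp add: largest_gap_eq item_count_eq expectation_longest_gap[OF w] distinct_items_in)
qed

lemma conditional_gap_product:
  assumes "i \<noteq> i'" and F: "integrable \<Omega> (\<lambda>\<omega>. F (picks \<omega>))"
  shows "expectation (\<lambda>\<omega>. F (picks \<omega>) * (largest_gap M A X i \<omega> * largest_gap M A X i' \<omega>))
       = expectation (\<lambda>\<omega>. F (picks \<omega>) * (gap_mean gap_weight1 (item_count M A i \<omega>) *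
           gap_mean gap_weight1 (item_count M A i' \<omega>)))"
proof -
  let ?h = "\<lambda>z x (p' :: nat \<Rightarrow> real). F z * (longest_gap (map x (items_in i z)) * longest_gap (map x (items_in i' z)))"
  have "integrable \<Omega> (\<lambda>\<omega>. F (picks \<omega>) * (largest_gap M A X i \<omega> * largest_gap M A X i' \<omega>))"
  proof (rule integrable_mult_bounded[OF F])
    show "AE \<omega> in \<Omega>. \<bar>largest_gap M A X i \<omega> * largest_gap M A X i' \<omega>\<bar> \<le> 1"
      using AE_largest_gap by eventually_elim (simp add: abs_mult mult_le_one)
  qed measurable
  then have "integrable \<Omega> (\<lambda>\<omega>. ?h (picks \<omega>) (\<lambda>j. X j \<omega>) (\<lambda>j. P j \<omega>))"
    by (simp add: largest_gap_eq)
  moreover have "(\<lambda>y. ?h z (\<lambda>j. y (Location j)) (\<lambda>j. y (Picking j))) \<in> borel_measurable (PiM item_sources (\<lambda>_. borel))" for z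
    by measurable
  ultimately have "expectation (\<lambda>\<omega>. ?h (picks \<omega>) (\<lambda>j. X j \<omega>) (\<lambda>j. P j \<omega>))
     = expectation (\<lambda>\<omega>. expectation (\<lambda>\<omega>'. ?h (picks \<omega>) (\<lambda>j. X j \<omega>') (\<lambda>j. P j \<omega>')))"
    by (intro freeze_items(2)[where h = ?h])
  moreover have "set (items_in i z) \<inter> set (items_in i' z) = {}" for z
    using assms(1) by (auto simp: items_in_def)
  ultimately show ?thesis
    by (simp add: largest_gap_eq item_count_eq expectation_longest_gap_product distinct_items_in)
qed

section \<open>Generating functions of the item counts\<close>

lemma aisle_function_measurable:
  "(\<lambda>y. w (nat \<lfloor>y (Aisle j) :: real\<rfloor>) :: real) \<in> borel_measurable (PiM (range Aisle) (\<lambda>_. borel))"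
proof (rule measurable_compose[where N = "count_space UNIV" and g = w])
  have [measurable]: "(\<lambda>y. y (Aisle j)) \<in> borel_measurable (PiM (range Aisle) (\<lambda>_. borel :: real measure))"
    by (rule measurable_component_singleton) blast
  show "(\<lambda>y. nat \<lfloor>y (Aisle j) :: real\<rfloor>) \<in> measurable (PiM (range Aisle) (\<lambda>_. borel)) (count_space UNIV)"
    by measurable
qed simp

lemma expectation_prod_aisles:
  fixes w :: "nat \<Rightarrow> nat \<Rightarrow> real"
  shows "expectation (\<lambda>\<omega>. \<Prod>j<n. w j (A j \<omega>)) = (\<Prod>j<n. (\<Sum>i=1..k. w j i) / real k)"
    and "integrable \<Omega> (\<lambda>\<omega>. \<Prod>j<n. w j (A j \<omega>))"
proof -
  let ?I = "Aisle ` {..<n}"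
  \<comment> \<open>On the sources other than aisles, which do not occur in the product, the value is arbitrary.\<close>
  define u where "u s x = (case s of Aisle j \<Rightarrow> w j (nat \<lfloor>x :: real\<rfloor>) | _ \<Rightarrow> 0)" for s x
  have "indep_vars (\<lambda>_. borel) (\<lambda>s \<omega>. u s (src \<omega> s)) ?I"
  proof (rule indep_vars_compose2[OF indep_vars_subset[OF indep_sources]])
    show "u s \<in> borel_measurable borel" for s
    proof (cases s)
      case (Aisle j)
      have "(\<lambda>x. w j (nat \<lfloor>x :: real\<rfloor>)) \<in> borel_measurable borel"
        by (rule measurable_compose[where N = "count_space UNIV"]) measurable
      then show ?thesis by (simp add: u_def[abs_def] Aisle)
    qed (simp_all add: u_def[abs_def])
  qed auto
  moreover have "integrable \<Omega> (\<lambda>\<omega>. u s (src \<omega> s))" if "s \<in> ?I" for s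
    using that integral_A(2) by (auto simp: u_def)
  ultimately have *: "expectation (\<lambda>\<omega>. \<Prod>s\<in>?I. u s (src \<omega> s)) = (\<Prod>s\<in>?I. expectation (\<lambda>\<omega>. u s (src \<omega> s)))"
    "integrable \<Omega> (\<lambda>\<omega>. \<Prod>s\<in>?I. u s (src \<omega> s))"
    by (auto intro!: indep_vars_lebesgue_integral indep_vars_integrable)
  have inj: "inj_on Aisle {..<n}" by (auto simp: inj_on_def)
  show "expectation (\<lambda>\<omega>. \<Prod>j<n. w j (A j \<omega>)) = (\<Prod>j<n. (\<Sum>i=1..k. w j i) / real k)"
    using *(1) by (simp add: prod.reindex[OF inj] u_def integral_A)
  show "integrable \<Omega> (\<lambda>\<omega>. \<Prod>j<n. w j (A j \<omega>))"
    using *(2) by (simp add: prod.reindex[OF inj] u_def)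
qed

text \<open>
  Suitable weights turn this product into \<open>x ^ N\<^sub>i\<close>, into \<open>x ^ N\<^sub>i * y ^ N\<^sub>j\<close>, or into the indicator
  of a set of aisles containing all items.
\<close>

definition order_weight :: "(nat \<Rightarrow> real) \<Rightarrow> 'a \<Rightarrow> real" where
  "order_weight w \<omega> = (\<Prod>j<M \<omega>. w (A j \<omega>))"

definition aisle_mean :: "(nat \<Rightarrow> real) \<Rightarrow> real" where
  "aisle_mean w = (\<Sum>i=1..k. w i) / real k"

text \<open>
  The derivative of the generating function of the order size, in closed form.
\<close>

definition pgf' :: "real \<Rightarrow> real" where
  "pgf' x = expectation (\<lambda>\<omega>. real (M \<omega>) * x ^ (M \<omega> - 1))"

lemma order_weight_measurable [measurable]: "order_weight w \<in> borel_measurable \<Omega>"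
proof -
  have "order_weight w \<omega> = (\<Prod>j<length (picks \<omega>). w (picks \<omega> ! j))" for \<omega>
    by (simp add: order_weight_def picks_def)
  then show ?thesis
    using picks_comp_borel[of "\<lambda>z. \<Prod>j<length z. w (z ! j)"] by presburger
qed

lemma order_weight_bound: "(\<And>i. \<bar>w i\<bar> \<le> 1) \<Longrightarrow> \<bar>order_weight w \<omega>\<bar> \<le> 1"
  unfolding order_weight_def abs_prod by (intro prod_le_1) auto

text \<open>
  For a fixed order size the factors are independent, each with mean \<open>aisle_mean w\<close>.
\<close>

lemma expectation_order_weight:
  assumes w: "\<And>i. \<bar>w i\<bar> \<le> 1" and \<phi>: "integrable \<Omega> (\<lambda>\<omega>. \<phi> (M \<omega>))"
  shows "expectation (\<lambda>\<omega>. \<phi> (M \<omega>) * order_weight w \<omega>) = expectation (\<lambda>\<omega>. \<phi> (M \<omega>) * aisle_mean w ^ M \<omega>)"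
proof -
  let ?f = "\<lambda>n y. \<phi> n * (\<Prod>j<n. w (nat \<lfloor>y (Aisle j) :: real\<rfloor>))"
  have f: "?f n \<in> borel_measurable (PiM (range Aisle) (\<lambda>_. borel))" for n
    by (intro borel_measurable_times borel_measurable_prod borel_measurable_const aisle_function_measurable)
  have eq: "?f n (restrict_src (range Aisle) \<omega>) = \<phi> n * (\<Prod>j<n. w (A j \<omega>))" for n \<omega>
    by simp
  have int: "integrable \<Omega> (\<lambda>\<omega>. ?f (M \<omega>) (restrict_src (range Aisle) \<omega>))"
    unfolding eq order_weight_def[symmetric]
    by (rule integrable_mult_bounded[OF \<phi>]) (use order_weight_bound[OF w] in auto)
  have "expectation (\<lambda>\<omega>. \<phi> (M \<omega>) * order_weight w \<omega>)
      = expectation (\<lambda>\<omega>. expectation (\<lambda>\<omega>'. \<phi> (M \<omega>) * (\<Prod>j<M \<omega>. w (A j \<omega>'))))"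
    using freeze_M[where f = ?f, OF f int] unfolding eq order_weight_def .
  then show ?thesis by (simp add: expectation_prod_aisles(1)[of "\<lambda>_. w"] aisle_mean_def)
qed

lemma item_count_sum: "real (item_count M A c \<omega>) = (\<Sum>l<M \<omega>. if A l \<omega> = c then 1 else 0)"
  by (simp add: item_count_def sum.If_cases Int_def)

lemma item_count_le: "item_count M A c \<omega> \<le> M \<omega>"
  using card_mono[of "{..<M \<omega>}" "{j. j < M \<omega> \<and> A j \<omega> = c}"] by (auto simp: item_count_def)

lemma item_count_integrable: "integrable \<Omega> (\<lambda>\<omega>. real (item_count M A c \<omega>))"
proof (rule Bochner_Integration.integrable_bound[OF M_integrable])
  show "(\<lambda>\<omega>. real (item_count M A c \<omega>)) \<in> borel_measurable \<Omega>" by measurable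
qed (simp add: item_count_le)

text \<open>
  The count \<open>N\<^sub>c\<close> is a sum over the items \<open>l\<close> of the indicator that \<open>l\<close> lies in aisle \<open>c\<close>.  That
  indicator replaces the factor of item \<open>l\<close>, whose mean becomes \<open>w c / k\<close>, and leaves \<open>M - 1\<close>
  factors with the mean weight.
\<close>

lemma expectation_item_count_order_weight:
  assumes w: "\<And>i. \<bar>w i\<bar> \<le> 1" and c: "c \<in> {1..k}"
  shows "expectation (\<lambda>\<omega>. real (item_count M A c \<omega>) * order_weight w \<omega>) = w c / real k * pgf' (aisle_mean w)"
proof -
  \<comment> \<open>\<open>?v\<close> is the weight of an item that is counted in aisle \<open>c\<close>.\<close>
  let ?v = "\<lambda>i. if i = c then w i else 0"
  let ?g = "\<lambda>n a. \<Sum>l<n. \<Prod>j<n. if j = l then ?v (a j) else w (a j)"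
  let ?f = "\<lambda>n y. ?g n (\<lambda>j. nat \<lfloor>y (Aisle j) :: real\<rfloor>)"
  have f: "?f n \<in> borel_measurable (PiM (range Aisle) (\<lambda>_. borel))" for n
    using aisle_function_measurable[of ?v] aisle_function_measurable[of w]
    by (intro borel_measurable_sum borel_measurable_prod) auto
  have eq: "?f n (restrict_src (range Aisle) \<omega>) = ?g n (\<lambda>j. A j \<omega>)" for n \<omega>
    by (simp cong: if_cong)
  have g_eq: "?g (M \<omega>) (\<lambda>j. A j \<omega>) = real (item_count M A c \<omega>) * order_weight w \<omega>" for \<omega>
  proof -
    have "(\<Prod>j<M \<omega>. if j = l then ?v (A j \<omega>) else w (A j \<omega>))
        = (if A l \<omega> = c then 1 else 0) * order_weight w \<omega>" if "l < M \<omega>" for l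
    proof (cases "A l \<omega> = c")
      case True
      then show ?thesis unfolding order_weight_def by (auto intro!: prod.cong)
    next
      case False
      then show ?thesis using that by (auto intro!: prod_zero)
    qed
    then show ?thesis by (simp add: item_count_sum sum_distrib_right)
  qed
  have int: "integrable \<Omega> (\<lambda>\<omega>. ?f (M \<omega>) (restrict_src (range Aisle) \<omega>))"
    unfolding eq g_eq
  proof (rule integrable_mult_bounded)
    show "integrable \<Omega> (\<lambda>\<omega>. real (item_count M A c \<omega>))"
      by (rule item_count_integrable)
  qed (use order_weight_bound[OF w] in auto)
  have "expectation (\<lambda>\<omega>. real (item_count M A c \<omega>) * order_weight w \<omega>)
      = expectation (\<lambda>\<omega>. expectation (\<lambda>\<omega>'. ?g (M \<omega>) (\<lambda>j. A j \<omega>')))"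
    using freeze_M[where f = ?f, OF f int] unfolding eq g_eq .
  moreover have "expectation (\<lambda>\<omega>'. ?g n (\<lambda>j. A j \<omega>')) = w c / real k * (real n * aisle_mean w ^ (n - 1))" for n
  proof -
    have "expectation (\<lambda>\<omega>'. ?g n (\<lambda>j. A j \<omega>'))
        = (\<Sum>l<n. expectation (\<lambda>\<omega>'. \<Prod>j<n. (\<lambda>i. if j = l then ?v i else w i) (A j \<omega>')))"
      by (intro Bochner_Integration.integral_sum)
         (use expectation_prod_aisles(2)[of "\<lambda>j i. if j = l then ?v i else w i" n for l] in auto)
    also have "\<dots> = (\<Sum>l<n. \<Prod>j<n. (\<Sum>i=1..k. if j = l then ?v i else w i) / real k)"
      by (intro sum.cong refl) (rule expectation_prod_aisles(1)[of "\<lambda>j i. if j = l then ?v i else w i" n for l])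
    also have "\<dots> = (\<Sum>l<n. w c / real k * aisle_mean w ^ (n - 1))"
    proof (rule sum.cong[OF refl])
      fix l assume l: "l \<in> {..<n}"
      have "(\<Prod>j<n. (\<Sum>i=1..k. if j = l then ?v i else w i) / real k)
          = (\<Sum>i=1..k. ?v i) / real k * (\<Prod>j\<in>{..<n} - {l}. (\<Sum>i=1..k. if j = l then ?v i else w i) / real k)"
        using l by (subst prod.remove[of _ l]) auto
      also have "(\<Prod>j\<in>{..<n} - {l}. (\<Sum>i=1..k. if j = l then ?v i else w i) / real k)
          = (\<Prod>j\<in>{..<n} - {l}. aisle_mean w)"
        by (intro prod.cong) (auto simp: aisle_mean_def)
      also have "(\<Sum>i=1..k. ?v i) = w c" using c by simp
      finally show "(\<Prod>j<n. (\<Sum>i=1..k. if j = l then ?v i else w i) / real k)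
          = w c / real k * aisle_mean w ^ (n - 1)" using l by simp
    qed
    finally show ?thesis by simp
  qed
  ultimately show ?thesis by (simp add: pgf'_def mult.assoc)
qed

text \<open>
  An indicator with real values; unlike the indicator of an event it does not mention the space.
\<close>

definition spans :: "nat \<Rightarrow> nat \<Rightarrow> 'a \<Rightarrow> real" where
  "spans a b \<omega> = (if first_aisle k M A \<omega> = a \<and> last_aisle k M A \<omega> = b then 1 else 0)"

text \<open>
  A placement can itself serve as the outcome: its order size is its length and item \<open>j\<close> lies in
  the aisle \<open>z ! j\<close>.  In this way the definitions of the model also apply to placements.
\<close>

lemma aisles_of_picks:
  "item_count M A i \<omega> = item_count length (\<lambda>j z. z ! j) i (picks \<omega>)"
  "first_aisle k M A \<omega> = first_aisle k length (\<lambda>j z. z ! j) (picks \<omega>)"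
  "last_aisle k M A \<omega> = last_aisle k length (\<lambda>j z. z ! j) (picks \<omega>)"
proof -
  show eq: "item_count M A i \<omega> = item_count length (\<lambda>j z. z ! j) i (picks \<omega>)" for i
    unfolding item_count_def by (intro arg_cong[where f = card]) (auto simp: picks_def)
  have "occupied k M A \<omega> = occupied k length (\<lambda>j z. z ! j) (picks \<omega>)"
    unfolding occupied_def eq ..
  then show "first_aisle k M A \<omega> = first_aisle k length (\<lambda>j z. z ! j) (picks \<omega>)"
    "last_aisle k M A \<omega> = last_aisle k length (\<lambda>j z. z ! j) (picks \<omega>)"
    by (simp_all add: first_aisle_def last_aisle_def)
qed

lemma aisle_measurable [measurable]:
  "first_aisle k M A \<in> measurable \<Omega> (count_space UNIV)"
  "last_aisle k M A \<in> measurable \<Omega> (count_space UNIV)"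
  unfolding aisles_of_picks[abs_def] by (rule picks_comp_measurable)+

lemma spans_measurable [measurable]: "spans a b \<in> borel_measurable \<Omega>"
  unfolding spans_def by measurable

lemma spans_bounds [simp]: "0 \<le> spans a b \<omega>" "spans a b \<omega> \<le> 1" "\<bar>spans a b \<omega>\<bar> \<le> 1"
  by (auto simp: spans_def)

lemma occupied_eq_image:
  assumes "\<forall>j. A j \<omega> \<in> {1..k}"
  shows "occupied k M A \<omega> = (\<lambda>j. A j \<omega>) ` {..<M \<omega>}"
proof (intro equalityI subsetI)
  fix i assume "i \<in> occupied k M A \<omega>"
  then have "{j. j < M \<omega> \<and> A j \<omega> = i} \<noteq> {}"
    by (auto simp: occupied_def item_count_def card_gt_0_iff)
  then show "i \<in> (\<lambda>j. A j \<omega>) ` {..<M \<omega>}" by auto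
next
  fix i assume "i \<in> (\<lambda>j. A j \<omega>) ` {..<M \<omega>}"
  then have "{j. j < M \<omega> \<and> A j \<omega> = i} \<noteq> {}" "i \<in> {1..k}" using assms by auto
  then show "i \<in> occupied k M A \<omega>"
    by (auto simp: occupied_def item_count_def card_gt_0_iff)
qed

definition confined :: "nat set \<Rightarrow> 'a \<Rightarrow> real" where
  "confined B \<omega> = (if (\<lambda>j. A j \<omega>) ` {..<M \<omega>} \<subseteq> B then 1 else 0)"

text \<open>
  Inclusion-exclusion: all items lie in \<open>{a..b}\<close>, but not all outside aisle \<open>a\<close> and not all outside
  aisle \<open>b\<close>.  For an empty order the four terms cancel.
\<close>

lemma spans_eq_confined:
  assumes A: "\<forall>j. A j \<omega> \<in> {1..k}" and ab: "1 \<le> a" "a < b" "b \<le> k"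
  shows "spans a b \<omega> = confined {a..b} \<omega> - confined {a + 1..b} \<omega> - confined {a..b - 1} \<omega> + confined {a + 1..b - 1} \<omega>"
proof -
  let ?O = "(\<lambda>j. A j \<omega>) ` {..<M \<omega>}"
  have fin: "finite ?O" by simp
  have "first_aisle k M A \<omega> = a \<and> last_aisle k M A \<omega> = b \<longleftrightarrow> ?O \<noteq> {} \<and> Min ?O = a \<and> Max ?O = b"
    using ab by (auto simp: first_aisle_def last_aisle_def occupied_eq_image[OF A])
  also have "\<dots> \<longleftrightarrow> ?O \<subseteq> {a..b} \<and> a \<in> ?O \<and> b \<in> ?O"
  proof
    assume *: "?O \<noteq> {} \<and> Min ?O = a \<and> Max ?O = b"
    then show "?O \<subseteq> {a..b} \<and> a \<in> ?O \<and> b \<in> ?O"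
      using Min_in[OF fin] Max_in[OF fin] Min_le[OF fin] Max_ge[OF fin] by auto
  next
    assume *: "?O \<subseteq> {a..b} \<and> a \<in> ?O \<and> b \<in> ?O"
    then have "Min ?O = a" "Max ?O = b"
      using fin by (auto intro!: Min_eqI Max_eqI)
    then show "?O \<noteq> {} \<and> Min ?O = a \<and> Max ?O = b" using * by blast
  qed
  finally have spans: "spans a b \<omega> = (if ?O \<subseteq> {a..b} \<and> a \<in> ?O \<and> b \<in> ?O then 1 else 0)"
    by (simp add: spans_def)
  have "?O \<subseteq> {a + 1..b} \<longleftrightarrow> ?O \<subseteq> {a..b} \<and> a \<notin> ?O" "?O \<subseteq> {a..b - 1} \<longleftrightarrow> ?O \<subseteq> {a..b} \<and> b \<notin> ?O"
    "?O \<subseteq> {a + 1..b - 1} \<longleftrightarrow> ?O \<subseteq> {a..b} \<and> a \<notin> ?O \<and> b \<notin> ?O"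
  proof -
    have "{a + 1..b} = {a..b} - {a}" "{a..b - 1} = {a..b} - {b}" "{a + 1..b - 1} = {a..b} - {a} - {b}"
      using ab by auto
    then show "?O \<subseteq> {a + 1..b} \<longleftrightarrow> ?O \<subseteq> {a..b} \<and> a \<notin> ?O" "?O \<subseteq> {a..b - 1} \<longleftrightarrow> ?O \<subseteq> {a..b} \<and> b \<notin> ?O"
      "?O \<subseteq> {a + 1..b - 1} \<longleftrightarrow> ?O \<subseteq> {a..b} \<and> a \<notin> ?O \<and> b \<notin> ?O"
      by blast+
  qed
  then show ?thesis unfolding spans confined_def by auto
qed

text \<open>
  Confinement to \<open>B\<close> is itself a product weight, namely the one vanishing outside \<open>B\<close>.
\<close>

lemma confined_mult_order_weight:
  "confined B \<omega> * order_weight w \<omega> = order_weight (\<lambda>i. if i \<in> B then w i else 0) \<omega>"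
proof (cases "(\<lambda>j. A j \<omega>) ` {..<M \<omega>} \<subseteq> B")
  case True
  then show ?thesis by (auto simp: confined_def order_weight_def intro!: prod.cong)
next
  case False
  then obtain j where "j < M \<omega>" "A j \<omega> \<notin> B" by auto
  then have "order_weight (\<lambda>i. if i \<in> B then w i else 0) \<omega> = 0"
    unfolding order_weight_def by (intro prod_zero) auto
  then show ?thesis using False by (simp add: confined_def)
qed

lemma aisle_mean_restrict:
  assumes "B \<subseteq> {1..k}"
  shows "aisle_mean (\<lambda>i. if i \<in> B then w i else 0) = (\<Sum>i\<in>B. w i) / real k"
proof -
  have "(\<Sum>i=1..k. if i \<in> B then w i else 0) = (\<Sum>i\<in>{1..k} \<inter> B. w i)"
    by (simp add: sum.inter_restrict)
  then show ?thesis using assms by (simp add: aisle_mean_def Int_absorb1)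
qed

lemma expectation_confined:
  assumes w: "\<And>i. \<bar>w i\<bar> \<le> 1" and B: "B \<subseteq> {1..k}"
  shows "expectation (\<lambda>\<omega>. confined B \<omega> * order_weight w \<omega>) = pgf \<Omega> M ((\<Sum>i\<in>B. w i) / real k)"
    and "integrable \<Omega> (\<lambda>\<omega>. confined B \<omega> * order_weight w \<omega>)"
    and "c \<in> {1..k} \<Longrightarrow> expectation (\<lambda>\<omega>. confined B \<omega> * order_weight w \<omega> * real (item_count M A c \<omega>))
      = (if c \<in> B then w c / real k * pgf' ((\<Sum>i\<in>B. w i) / real k) else 0)"
    and "integrable \<Omega> (\<lambda>\<omega>. confined B \<omega> * order_weight w \<omega> * real (item_count M A c \<omega>))"
proof -
  let ?w = "\<lambda>i. if i \<in> B then w i else 0"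
  have w': "\<bar>?w i\<bar> \<le> 1" for i using w by auto
  show "expectation (\<lambda>\<omega>. confined B \<omega> * order_weight w \<omega>) = pgf \<Omega> M ((\<Sum>i\<in>B. w i) / real k)"
    using expectation_order_weight[of ?w "\<lambda>_. 1", OF w']
    unfolding confined_mult_order_weight aisle_mean_restrict[OF B] by (simp add: pgf_def)
  show "expectation (\<lambda>\<omega>. confined B \<omega> * order_weight w \<omega> * real (item_count M A c \<omega>))
      = (if c \<in> B then w c / real k * pgf' ((\<Sum>i\<in>B. w i) / real k) else 0)" if "c \<in> {1..k}"
    using expectation_item_count_order_weight[of ?w, OF w' that]
    unfolding confined_mult_order_weight aisle_mean_restrict[OF B] by (simp add: mult.commute)
  show "integrable \<Omega> (\<lambda>\<omega>. confined B \<omega> * order_weight w \<omega>)"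
    unfolding confined_mult_order_weight
    by (rule integrable_const_bound[where B = 1]) (use order_weight_bound[of ?w, OF w'] in auto)
  have "integrable \<Omega> (\<lambda>\<omega>. real (item_count M A c \<omega>) * order_weight ?w \<omega>)"
    by (rule integrable_mult_bounded[OF item_count_integrable]) (use order_weight_bound[of ?w, OF w'] in auto)
  then show "integrable \<Omega> (\<lambda>\<omega>. confined B \<omega> * order_weight w \<omega> * real (item_count M A c \<omega>))"
    unfolding confined_mult_order_weight by (simp add: mult.commute)
qed

text \<open>
  On confinement to \<open>B\<close> the mean weight is \<open>\<sigma> B\<close>.  The count of aisle \<open>c\<close> vanishes on
  confinement to a set without \<open>c\<close>; that is why terms are missing if \<open>c\<close> is an end of the span.
\<close>

lemma expectation_spans:
  assumes w: "\<And>i. \<bar>w i\<bar> \<le> 1" and ab: "1 \<le> a" "a < b" "b \<le> k"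
  defines "\<sigma> \<equiv> \<lambda>B. (\<Sum>i\<in>B. w i) / real k"
  shows "expectation (\<lambda>\<omega>. spans a b \<omega> * order_weight w \<omega>)
      = pgf \<Omega> M (\<sigma> {a..b}) - pgf \<Omega> M (\<sigma> {a + 1..b}) - pgf \<Omega> M (\<sigma> {a..b - 1}) + pgf \<Omega> M (\<sigma> {a + 1..b - 1})"
    and "c \<in> {a..b} \<Longrightarrow> expectation (\<lambda>\<omega>. spans a b \<omega> * order_weight w \<omega> * real (item_count M A c \<omega>))
      = w c / real k * (pgf' (\<sigma> {a..b}) - (if c = a then 0 else pgf' (\<sigma> {a + 1..b}))
          - (if c = b then 0 else pgf' (\<sigma> {a..b - 1}))
          + (if c = a \<or> c = b then 0 else pgf' (\<sigma> {a + 1..b - 1})))"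
proof -
  have sub: "{a..b} \<subseteq> {1..k}" "{a + 1..b} \<subseteq> {1..k}" "{a..b - 1} \<subseteq> {1..k}" "{a + 1..b - 1} \<subseteq> {1..k}"
    using ab by auto
  have eq: "AE \<omega> in \<Omega>. spans a b \<omega> * G \<omega> = confined {a..b} \<omega> * G \<omega> - confined {a + 1..b} \<omega> * G \<omega>
      - confined {a..b - 1} \<omega> * G \<omega> + confined {a + 1..b - 1} \<omega> * G \<omega>" for G :: "'a \<Rightarrow> real"
    using AE_A_range by eventually_elim (simp add: spans_eq_confined[OF _ ab] algebra_simps)
  note W = expectation_confined[OF w]
  have "expectation (\<lambda>\<omega>. spans a b \<omega> * order_weight w \<omega>)
      = expectation (\<lambda>\<omega>. confined {a..b} \<omega> * order_weight w \<omega> - confined {a + 1..b} \<omega> * order_weight w \<omega>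
      - confined {a..b - 1} \<omega> * order_weight w \<omega> + confined {a + 1..b - 1} \<omega> * order_weight w \<omega>)"
    by (intro integral_cong_AE eq borel_measurable_add borel_measurable_diff
        borel_measurable_integrable[OF W(2)] borel_measurable_times spans_measurable order_weight_measurable sub)
  also have "\<dots> = pgf \<Omega> M (\<sigma> {a..b}) - pgf \<Omega> M (\<sigma> {a + 1..b}) - pgf \<Omega> M (\<sigma> {a..b - 1}) + pgf \<Omega> M (\<sigma> {a + 1..b - 1})"
    using W(1,2)[OF sub(1)] W(1,2)[OF sub(2)] W(1,2)[OF sub(3)] W(1,2)[OF sub(4)] by (simp add: \<sigma>_def)
  finally show "expectation (\<lambda>\<omega>. spans a b \<omega> * order_weight w \<omega>)
      = pgf \<Omega> M (\<sigma> {a..b}) - pgf \<Omega> M (\<sigma> {a + 1..b}) - pgf \<Omega> M (\<sigma> {a..b - 1}) + pgf \<Omega> M (\<sigma> {a + 1..b - 1})" .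
  assume c: "c \<in> {a..b}"
  then have c': "c \<in> {1..k}" using ab by auto
  let ?G = "\<lambda>\<omega>. order_weight w \<omega> * real (item_count M A c \<omega>)"
  have W4: "integrable \<Omega> (\<lambda>\<omega>. confined B \<omega> * ?G \<omega>)" if "B \<subseteq> {1..k}" for B
    using W(4)[OF that] by (simp add: mult.assoc)
  have W3: "expectation (\<lambda>\<omega>. confined B \<omega> * ?G \<omega>) = (if c \<in> B then w c / real k * pgf' (\<sigma> B) else 0)"
    if "B \<subseteq> {1..k}" for B
    using W(3)[OF that c'] by (simp add: mult.assoc \<sigma>_def)
  have "expectation (\<lambda>\<omega>. spans a b \<omega> * ?G \<omega>)
      = expectation (\<lambda>\<omega>. confined {a..b} \<omega> * ?G \<omega> - confined {a + 1..b} \<omega> * ?G \<omega>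
      - confined {a..b - 1} \<omega> * ?G \<omega> + confined {a + 1..b - 1} \<omega> * ?G \<omega>)"
  proof (intro integral_cong_AE eq borel_measurable_add borel_measurable_diff
        borel_measurable_integrable[OF W4] sub)
    show "(\<lambda>\<omega>. spans a b \<omega> * ?G \<omega>) \<in> borel_measurable \<Omega>" by measurable
  qed
  also have "\<dots> = w c / real k * (pgf' (\<sigma> {a..b}) - (if c = a then 0 else pgf' (\<sigma> {a + 1..b}))
          - (if c = b then 0 else pgf' (\<sigma> {a..b - 1}))
          + (if c = a \<or> c = b then 0 else pgf' (\<sigma> {a + 1..b - 1})))"
    using W3[OF sub(1)] W3[OF sub(2)] W3[OF sub(3)] W3[OF sub(4)]
      W4[OF sub(1)] W4[OF sub(2)] W4[OF sub(3)] W4[OF sub(4)] c ab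
    by (auto simp: algebra_simps)
  finally show "expectation (\<lambda>\<omega>. spans a b \<omega> * order_weight w \<omega> * real (item_count M A c \<omega>)) = \<dots>"
    by (simp add: mult.assoc)
qed

section \<open>Closed forms for a fixed span of occupied aisles\<close>

lemma power_item_count: "x ^ item_count M A i \<omega> = order_weight (\<lambda>c. if c = i then x else 1) \<omega>"
  for x :: real
  by (simp add: order_weight_def prod.If_cases item_count_def Int_def)

lemma power_item_count_product:
  fixes x y :: real
  assumes "i \<noteq> j"
  shows "x ^ item_count M A i \<omega> * y ^ item_count M A j \<omega>
    = order_weight (\<lambda>c. if c = i then x else if c = j then y else 1) \<omega>"
  unfolding power_item_count order_weight_def prod.distrib[symmetric]
  using assms by (intro prod.cong) auto

text \<open>
  The generating function of the number of items in one inner aisle, on the event that the occupied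
  aisles range over a given interval of \<open>m + 1\<close> aisles.
\<close>

definition inner_pgf :: "nat \<Rightarrow> real \<Rightarrow> real" where
  "inner_pgf m x = pgf \<Omega> M ((real m + x) / real k)
      - 2 * pgf \<Omega> M ((real m - 1 + x) / real k) + pgf \<Omega> M ((real m - 2 + x) / real k)"

text \<open>
  The joint generating function for two inner aisles.
\<close>

definition inner_pgf2 :: "nat \<Rightarrow> real \<Rightarrow> real \<Rightarrow> real" where
  "inner_pgf2 m x y = pgf \<Omega> M ((real m - 1 + x + y) / real k)
      - 2 * pgf \<Omega> M ((real m - 2 + x + y) / real k) + pgf \<Omega> M ((real m - 3 + x + y) / real k)"

text \<open>
  The derivative of \<open>inner_pgf m\<close>.
\<close>

definition inner_slope :: "nat \<Rightarrow> real \<Rightarrow> real" where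
  "inner_slope m x = (pgf' ((real m + x) / real k)
      - 2 * pgf' ((real m - 1 + x) / real k) + pgf' ((real m - 2 + x) / real k)) / real k"

text \<open>
  The derivative of the generating function of the number of items in an end aisle of the span.
\<close>

definition outer_slope :: "nat \<Rightarrow> real \<Rightarrow> real" where
  "outer_slope m x = (pgf' ((real m + x) / real k) - pgf' ((real m - 1 + x) / real k)) / real k"

lemma spans_integrable: "integrable \<Omega> (spans a b)"
  by (rule integrable_const_bound[where B = 1]) auto

lemma spans_item_count_integrable: "integrable \<Omega> (\<lambda>\<omega>. spans a b \<omega> * real (item_count M A c \<omega>))"
  using integrable_mult_bounded[OF item_count_integrable, of "spans a b" c] by (simp add: mult.commute)

context
  fixes a b m :: nat
  assumes ab: "1 \<le> a" "a < b" "b \<le> k" and m: "b = a + m"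
begin

lemma card_span:
  "real (card {a..b}) = real m + 1" "real (card {a + 1..b}) = real m"
  "real (card {a..b - 1}) = real m" "real (card {a + 1..b - 1}) = real m - 1"
  using ab m by auto

lemma sums_one_weight:
  assumes "a < i" "i < b"
  shows "(\<Sum>c\<in>{a..b}. if c = i then x else 1) = real m + x"
    "(\<Sum>c\<in>{a + 1..b}. if c = i then x else 1) = real m - 1 + x"
    "(\<Sum>c\<in>{a..b - 1}. if c = i then x else 1) = real m - 1 + x"
    "(\<Sum>c\<in>{a + 1..b - 1}. if c = i then x else 1) = real m - 2 + x"
  using assms by (simp_all only: sum_one_exceptional_weight finite_atLeastAtMost card_span) auto

lemma sums_endpoint_weight:
  "(\<Sum>c\<in>{a..b}. if c = a then x else 1) = real m + x"
  "(\<Sum>c\<in>{a..b - 1}. if c = a then x else 1) = real m - 1 + x"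
  "(\<Sum>c\<in>{a + 1..b}. if c = a then x else 1) = real m"
  "(\<Sum>c\<in>{a + 1..b - 1}. if c = a then x else 1) = real m - 1"
  using ab by (simp_all only: sum_one_exceptional_weight finite_atLeastAtMost card_span) auto

lemma sums_two_weights:
  assumes "a < i" "i < b" "a < j" "j < b" "i \<noteq> j"
  shows "(\<Sum>c\<in>{a..b}. if c = i then x else if c = j then y else 1) = real m - 1 + x + y"
    "(\<Sum>c\<in>{a + 1..b}. if c = i then x else if c = j then y else 1) = real m - 2 + x + y"
    "(\<Sum>c\<in>{a..b - 1}. if c = i then x else if c = j then y else 1) = real m - 2 + x + y"
    "(\<Sum>c\<in>{a + 1..b - 1}. if c = i then x else if c = j then y else 1) = real m - 3 + x + y"
  using assms by (simp_all only: sum_two_exceptional_weights[OF finite_atLeastAtMost assms(5)] card_span) auto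

lemma expectation_spans_power:
  assumes "a < i" "i < b" "x \<in> {0..1}"
  shows "expectation (\<lambda>\<omega>. spans a b \<omega> * x ^ item_count M A i \<omega>) = inner_pgf m x"
proof -
  have w: "\<bar>if c = i then x else 1\<bar> \<le> 1" for c using assms(3) by auto
  show ?thesis
    unfolding power_item_count expectation_spans(1)[of "\<lambda>c. if c = i then x else 1", OF w ab]
      sums_one_weight[OF assms(1,2)] inner_pgf_def by simp
qed

lemma expectation_spans_power2:
  assumes "a < i" "i < b" "a < j" "j < b" "i \<noteq> j" "x \<in> {0..1}" "y \<in> {0..1}"
  shows "expectation (\<lambda>\<omega>. spans a b \<omega> * (x ^ item_count M A i \<omega> * y ^ item_count M A j \<omega>)) = inner_pgf2 m x y"
proof -
  have w: "\<bar>if c = i then x else if c = j then y else 1\<bar> \<le> 1" for c using assms(6,7) by auto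
  show ?thesis
    unfolding power_item_count_product[OF assms(5)]
      expectation_spans(1)[of "\<lambda>c. if c = i then x else if c = j then y else 1", OF w ab]
      sums_two_weights[OF assms(1-5)] inner_pgf2_def by simp
qed

text \<open>
  For an inner aisle \<open>c \<noteq> i\<close> the value is the derivative of the generating function of aisle \<open>i\<close>
  itself: the joint generating function of two inner aisles depends on \<open>x + y\<close> only.
\<close>

lemma expectation_spans_power_count:
  assumes "a < i" "i < b" "c \<in> {a..b}" "x \<in> {0..1}"
  shows "expectation (\<lambda>\<omega>. spans a b \<omega> * x ^ item_count M A i \<omega> * real (item_count M A c \<omega>))
    = (if c = i then x else 1) * (if c = a \<or> c = b then outer_slope m x else inner_slope m x)"
proof -
  have w: "\<bar>if c = i then x else 1\<bar> \<le> 1" for c using assms(4) by auto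
  show ?thesis
    unfolding power_item_count expectation_spans(2)[of "\<lambda>c. if c = i then x else 1", OF w ab assms(3)]
      sums_one_weight[OF assms(1,2)] inner_slope_def outer_slope_def using ab
    by (auto simp: algebra_simps add_divide_distrib diff_divide_distrib)
qed

text \<open>
  The same slope as for the count of an end aisle combined with a power for an inner aisle.  This
  makes it possible to return to a generating function in the formula for end aisles.
\<close>

lemma expectation_spans_endpoint_power_count:
  assumes "x \<in> {0..1}"
  shows "expectation (\<lambda>\<omega>. spans a b \<omega> * x ^ item_count M A a \<omega> * real (item_count M A a \<omega>)) = x * outer_slope m x"
proof -
  have w: "\<bar>if c = a then x else 1\<bar> \<le> 1" for c using assms by auto
  have a: "a \<in> {a..b}" using ab by simp
  show ?thesis
    unfolding power_item_count expectation_spans(2)[of "\<lambda>c. if c = a then x else 1", OF w ab a]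
      sums_endpoint_weight outer_slope_def using ab by simp
qed

end

text \<open>
  Averaging a conditional moment of the gap over the placement produces a generating function.
\<close>

lemma gap_mean_swap:
  assumes w: "gap_moment_weight p w" and G: "integrable \<Omega> G"
  shows "expectation (\<lambda>\<omega>. G \<omega> * gap_mean w (item_count M A i \<omega>))
      = (LBINT x:{0..1}. w x * expectation (\<lambda>\<omega>. G \<omega> * x ^ item_count M A i \<omega>))"
    and "integrable \<Omega> (\<lambda>\<omega>. G \<omega> * gap_mean w (item_count M A i \<omega>))"
proof -
  have [measurable]: "w \<in> borel_measurable borel" using w by (simp add: gap_moment_weight_def)
  have bound: "\<bar>w x * x ^ n\<bar> \<le> 1 * w x" if "x \<in> {0..1}" for n x
  proof -
    have "0 \<le> w x" using w that by (simp add: gap_moment_weight_def)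
    then show ?thesis using that by (simp add: abs_mult mult_left_le power_le_one)
  qed
  have int: "set_integrable lborel {0..1} w"
    using gap_moment_weight_integral(1)[OF w, of 0] by simp
  note swap = expectation_unit_integral_swap[where f = "\<lambda>n x. w x * x ^ n" and B = "\<lambda>_. 1",
      OF borel_measurable_integrable[OF G] item_count_measurable[of i] _ int bound]
  show "expectation (\<lambda>\<omega>. G \<omega> * gap_mean w (item_count M A i \<omega>))
      = (LBINT x:{0..1}. w x * expectation (\<lambda>\<omega>. G \<omega> * x ^ item_count M A i \<omega>))"
  proof -
    have "expectation (\<lambda>\<omega>. G \<omega> * (w x * x ^ item_count M A i \<omega>))
        = w x * expectation (\<lambda>\<omega>. G \<omega> * x ^ item_count M A i \<omega>)" for x
      by (subst integral_mult_right_zero[symmetric]) (simp add: mult_ac)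
    then show ?thesis using swap(1) G by (simp add: gap_mean_def)
  qed
  show "integrable \<Omega> (\<lambda>\<omega>. G \<omega> * gap_mean w (item_count M A i \<omega>))"
    using swap(3) G by (simp add: gap_mean_def)
qed

text \<open>
  Such a quantity is constant once the placement is fixed, so it may multiply a gap whose
  conditional moments are inserted.
\<close>

definition determined_by_picks :: "('a \<Rightarrow> 'c) \<Rightarrow> bool" where
  "determined_by_picks G \<longleftrightarrow> (\<exists>F. \<forall>\<omega>. G \<omega> = F (picks \<omega>))"

lemma determined_by_picks_spans: "determined_by_picks (spans a b)"
  unfolding determined_by_picks_def spans_def aisles_of_picks
  by (rule exI[of _ "\<lambda>z. if first_aisle k length (\<lambda>j z. z ! j) z = a
        \<and> last_aisle k length (\<lambda>j z. z ! j) z = b then 1 else 0"]) auto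

lemma determined_by_picks_spans_count: "determined_by_picks (\<lambda>\<omega>. spans a b \<omega> * real (item_count M A c \<omega>))"
proof -
  obtain F where "spans a b \<omega> = F (picks \<omega>)" for \<omega>
    using determined_by_picks_spans[of a b] by (auto simp: determined_by_picks_def)
  then show ?thesis unfolding determined_by_picks_def item_count_eq
    by (intro exI[of _ "\<lambda>z. F z * real (length (items_in c z))"]) simp
qed

lemma expectation_gap_power:
  assumes w: "gap_moment_weight p w" and "determined_by_picks G" and G: "integrable \<Omega> G"
  shows "expectation (\<lambda>\<omega>. G \<omega> * largest_gap M A X i \<omega> ^ p)
      = (LBINT x:{0..1}. w x * expectation (\<lambda>\<omega>. G \<omega> * x ^ item_count M A i \<omega>))"
proof -
  obtain F where F: "G \<omega> = F (picks \<omega>)" for \<omega>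
    using assms(2) by (auto simp: determined_by_picks_def)
  have "integrable \<Omega> (\<lambda>\<omega>. F (picks \<omega>))" using G by (simp add: F[symmetric])
  from conditional_gap_power[OF w this, of i] show ?thesis
    unfolding F[symmetric] gap_mean_swap(1)[OF w G] .
qed

lemma gap_power_integrable:
  assumes "integrable \<Omega> G"
  shows "integrable \<Omega> (\<lambda>\<omega>. G \<omega> * largest_gap M A X i \<omega> ^ p)"
proof (rule integrable_mult_bounded[OF assms])
  show "AE \<omega> in \<Omega>. \<bar>largest_gap M A X i \<omega> ^ p\<bar> \<le> 1"
    using AE_largest_gap by eventually_elim (simp add: power_abs power_le_one)
qed measurable

lemma expectation_complement_gap:
  assumes "determined_by_picks G" and G: "integrable \<Omega> G"
  shows "expectation (\<lambda>\<omega>. G \<omega> * (1 - largest_gap M A X i \<omega>))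
      = expectation G - (LBINT x:{0..1}. gap_weight1 x * expectation (\<lambda>\<omega>. G \<omega> * x ^ item_count M A i \<omega>))"
  using expectation_gap_power[OF gap_moment_weight1 assms, of i] gap_power_integrable[OF G, of i 1] G
  by (simp add: right_diff_distrib)

context
  fixes a b m :: nat
  assumes ab: "1 \<le> a" "a < b" "b \<le> k" and m: "b = a + m"
begin

lemmas spans_powers = expectation_spans_power[OF ab m] expectation_spans_power2[OF ab m]
  expectation_spans_power_count[OF ab m] expectation_spans_endpoint_power_count[OF ab m]

lemma expectation_spans_eq:
  assumes "a < i" "i < b"
  shows "expectation (spans a b) = inner_pgf m 1"
  using spans_powers(1)[OF assms, of 1] by simp

lemma expectation_complement_gap_spans:
  assumes "a < i" "i < b"
  shows "expectation (\<lambda>\<omega>. spans a b \<omega> * (1 - largest_gap M A X i \<omega>))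
      = inner_pgf m 1 + (LBINT x:{0..1}. inner_pgf m x * ln (1 - x))"
proof -
  have "(LBINT x:{0..1}. gap_weight1 x * expectation (\<lambda>\<omega>. spans a b \<omega> * x ^ item_count M A i \<omega>))
      = (LBINT x:{0..1}. gap_weight1 x * inner_pgf m x)"
    by (rule set_integral_unit_cong) (simp add: spans_powers(1)[OF assms])
  then show ?thesis
    unfolding expectation_complement_gap[OF determined_by_picks_spans spans_integrable]
    by (simp add: expectation_spans_eq[OF assms] set_integral_gap_weight1)
qed

text \<open>
  Expanded as \<open>(1 - D)\<^sup>2 = 2 * (1 - D) - 1 + D\<^sup>2\<close>.
\<close>

lemma expectation_complement_gap_squared_spans:
  assumes "a < i" "i < b"
  shows "expectation (\<lambda>\<omega>. spans a b \<omega> * (1 - largest_gap M A X i \<omega>)\<^sup>2)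
      = inner_pgf m 1 + 2 * (LBINT x:{0..1}. inner_pgf m x * ln (1 - x))
        + (LBINT x:{0..1}. x * inner_pgf m x * (LBINT y:{x..1}. (ln (1 - y))\<^sup>2 / y\<^sup>2))"
proof -
  let ?D = "largest_gap M A X i"
  have "(LBINT x:{0..1}. gap_weight2 x * expectation (\<lambda>\<omega>. spans a b \<omega> * x ^ item_count M A i \<omega>))
      = (LBINT x:{0..1}. x * inner_pgf m x * (LBINT y:{x..1}. (ln (1 - y))\<^sup>2 / y\<^sup>2))"
    by (rule set_integral_unit_cong) (simp add: spans_powers(1)[OF assms] gap_weight2_def)
  then have sq: "expectation (\<lambda>\<omega>. spans a b \<omega> * ?D \<omega> ^ 2)
      = (LBINT x:{0..1}. x * inner_pgf m x * (LBINT y:{x..1}. (ln (1 - y))\<^sup>2 / y\<^sup>2))"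
    using expectation_gap_power[OF gap_moment_weight2 determined_by_picks_spans spans_integrable, of a b i] by simp
  have int: "integrable \<Omega> (\<lambda>\<omega>. spans a b \<omega> * (1 - ?D \<omega>))" "integrable \<Omega> (\<lambda>\<omega>. spans a b \<omega> * ?D \<omega> ^ 2)"
    using gap_power_integrable[OF spans_integrable, of a b i 1] gap_power_integrable[OF spans_integrable, of a b i 2]
      spans_integrable by (simp_all add: right_diff_distrib)
  have "expectation (\<lambda>\<omega>. spans a b \<omega> * (1 - ?D \<omega>)\<^sup>2)
      = expectation (\<lambda>\<omega>. 2 * (spans a b \<omega> * (1 - ?D \<omega>)) - spans a b \<omega> + spans a b \<omega> * ?D \<omega> ^ 2)"
    by (intro Bochner_Integration.integral_cong) (simp_all add: power2_eq_square algebra_simps)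
  also have "\<dots> = 2 * expectation (\<lambda>\<omega>. spans a b \<omega> * (1 - ?D \<omega>)) - expectation (spans a b)
      + expectation (\<lambda>\<omega>. spans a b \<omega> * ?D \<omega> ^ 2)"
    using int spans_integrable by simp
  finally show ?thesis
    unfolding sq expectation_complement_gap_spans[OF assms] expectation_spans_eq[OF assms] by simp
qed

text \<open>
  Given the placement the gaps of two aisles are independent, so \<open>gap_mean_swap\<close> applies once for
  each of them.
\<close>

lemma expectation_complement_gap_product_spans:
  assumes i: "a < i" "i < b" and j: "a < j" "j < b" and ij: "i \<noteq> j"
  shows "expectation (\<lambda>\<omega>. spans a b \<omega> * ((1 - largest_gap M A X i \<omega>) * (1 - largest_gap M A X j \<omega>)))
      = inner_pgf m 1 + 2 * (LBINT x:{0..1}. inner_pgf m x * ln (1 - x))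
        + (LBINT x:{0..1}. LBINT y:{0..1}. ln (1 - x) * ln (1 - y) * inner_pgf2 m x y)"
proof -
  let ?D = "largest_gap M A X" and ?N = "item_count M A"
  obtain F where F: "spans a b \<omega> = F (picks \<omega>)" for \<omega>
    using determined_by_picks_spans[of a b] by (auto simp: determined_by_picks_def)
  have F_int: "integrable \<Omega> (\<lambda>\<omega>. F (picks \<omega>))" using spans_integrable[of a b] by (simp add: F[symmetric])
  let ?g = "\<lambda>\<omega>. spans a b \<omega> * gap_mean gap_weight1 (?N j \<omega>)"
  have g_int: "integrable \<Omega> ?g" by (rule gap_mean_swap(2)[OF gap_moment_weight1 spans_integrable])
  have inner: "expectation (\<lambda>\<omega>. ?g \<omega> * x ^ ?N i \<omega>) = (LBINT y:{0..1}. gap_weight1 y * inner_pgf2 m x y)"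
    if x: "x \<in> {0..1}" for x
  proof -
    have "integrable \<Omega> (\<lambda>\<omega>. spans a b \<omega> * x ^ ?N i \<omega>)"
      by (rule integrable_mult_bounded[OF spans_integrable]) (use x in \<open>auto simp: power_abs power_le_one\<close>)
    from gap_mean_swap(1)[OF gap_moment_weight1 this, of j]
    have "expectation (\<lambda>\<omega>. ?g \<omega> * x ^ ?N i \<omega>)
        = (LBINT y:{0..1}. gap_weight1 y * expectation (\<lambda>\<omega>. spans a b \<omega> * (x ^ ?N i \<omega> * y ^ ?N j \<omega>)))"
      by (simp add: mult_ac)
    also have "\<dots> = (LBINT y:{0..1}. gap_weight1 y * inner_pgf2 m x y)"
      by (rule set_integral_unit_cong) (simp add: spans_powers(2)[OF i j ij x])
    finally show ?thesis .
  qed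
  have "expectation (\<lambda>\<omega>. spans a b \<omega> * (?D i \<omega> * ?D j \<omega>)) = expectation (\<lambda>\<omega>. ?g \<omega> * gap_mean gap_weight1 (?N i \<omega>))"
    using conditional_gap_product[OF ij F_int] by (simp add: F[symmetric] mult_ac)
  also have "\<dots> = (LBINT x:{0..1}. gap_weight1 x * (LBINT y:{0..1}. gap_weight1 y * inner_pgf2 m x y))"
    unfolding gap_mean_swap(1)[OF gap_moment_weight1 g_int]
    by (rule set_integral_unit_cong) (simp add: inner)
  also have "\<dots> = (LBINT x:{0..1}. LBINT y:{0..1}. ln (1 - x) * ln (1 - y) * inner_pgf2 m x y)"
    unfolding set_integral_mult_right[symmetric] by (simp add: gap_weight1_def mult_ac)
  finally have prod: "expectation (\<lambda>\<omega>. spans a b \<omega> * (?D i \<omega> * ?D j \<omega>)) = \<dots>" .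
  have int1: "integrable \<Omega> (\<lambda>\<omega>. spans a b \<omega> * (1 - ?D c \<omega>))" for c
    using gap_power_integrable[OF spans_integrable, of a b c 1] spans_integrable by (simp add: right_diff_distrib)
  have int2: "integrable \<Omega> (\<lambda>\<omega>. spans a b \<omega> * (?D i \<omega> * ?D j \<omega>))"
  proof (rule integrable_mult_bounded[OF spans_integrable])
    show "AE \<omega> in \<Omega>. \<bar>?D i \<omega> * ?D j \<omega>\<bar> \<le> 1"
      using AE_largest_gap by eventually_elim (simp add: abs_mult mult_le_one)
  qed measurable
  have "expectation (\<lambda>\<omega>. spans a b \<omega> * ((1 - ?D i \<omega>) * (1 - ?D j \<omega>)))
      = expectation (\<lambda>\<omega>. spans a b \<omega> * (1 - ?D i \<omega>) + spans a b \<omega> * (1 - ?D j \<omega>) - spans a b \<omega>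
          + spans a b \<omega> * (?D i \<omega> * ?D j \<omega>))"
    by (intro Bochner_Integration.integral_cong) (simp_all add: algebra_simps)
  also have "\<dots> = expectation (\<lambda>\<omega>. spans a b \<omega> * (1 - ?D i \<omega>)) + expectation (\<lambda>\<omega>. spans a b \<omega> * (1 - ?D j \<omega>))
      - expectation (spans a b) + expectation (\<lambda>\<omega>. spans a b \<omega> * (?D i \<omega> * ?D j \<omega>))"
    using int1 int2 spans_integrable by simp
  finally show ?thesis
    unfolding prod expectation_complement_gap_spans[OF i] expectation_complement_gap_spans[OF j]
      expectation_spans_eq[OF i] by simp
qed

lemma expectation_count_complement_gap_spans:
  assumes "a < i" "i < b" "c \<in> {a..b}"
  shows "expectation (\<lambda>\<omega>. spans a b \<omega> * real (item_count M A c \<omega>) * (1 - largest_gap M A X i \<omega>))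
      = (if c = a \<or> c = b then outer_slope m 1 - (LBINT x:{0..1}. gap_weight1 x * outer_slope m x)
         else if c = i then inner_slope m 1 - (LBINT x:{0..1}. gap_weight1 x * (x * inner_slope m x))
         else inner_slope m 1 - (LBINT x:{0..1}. gap_weight1 x * inner_slope m x))"
proof -
  have "(LBINT x:{0..1}. gap_weight1 x *
      expectation (\<lambda>\<omega>. spans a b \<omega> * real (item_count M A c \<omega>) * x ^ item_count M A i \<omega>))
    = (LBINT x:{0..1}. gap_weight1 x *
        ((if c = i then x else 1) * (if c = a \<or> c = b then outer_slope m x else inner_slope m x)))"
    using spans_powers(3)[OF assms] by (intro set_integral_unit_cong) (simp add: mult_ac)
  moreover have "expectation (\<lambda>\<omega>. spans a b \<omega> * real (item_count M A c \<omega>))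
      = (if c = a \<or> c = b then outer_slope m 1 else inner_slope m 1)"
    using spans_powers(3)[OF assms, of 1] by simp
  ultimately show ?thesis
    unfolding expectation_complement_gap[OF determined_by_picks_spans_count spans_item_count_integrable]
    using assms by auto
qed

end

text \<open>
  \<open>gap_weight1_derivative_power\<close> holds for every value of the item count, so it holds for the average.
\<close>

lemma expectation_geometric_quotient:
  "(LBINT x:{0..1}. gap_weight1 x * expectation (\<lambda>\<omega>. spans a b \<omega> * (real (item_count M A c \<omega>) * x ^ (item_count M A c \<omega> - 1))))
    = (LBINT x:{0..1}. (expectation (spans a b) - expectation (\<lambda>\<omega>. spans a b \<omega> * x ^ item_count M A c \<omega>)) / (1 - x))"
proof -
  let ?N = "item_count M A c"
  have [measurable]: "gap_weight1 \<in> borel_measurable borel"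
    using gap_moment_weight1 by (simp add: gap_moment_weight_def)
  have bound1: "\<bar>gap_weight1 x * (real n * x ^ (n - 1))\<bar> \<le> real n * gap_weight1 x" if "x \<in> {0..1}" for n x
  proof -
    have "0 \<le> gap_weight1 x" using gap_moment_weight1 that by (simp add: gap_moment_weight_def)
    then show ?thesis using that
      by (simp add: abs_mult mult.left_commute[of "gap_weight1 x"] mult_left_mono mult_left_le power_le_one)
  qed
  have bound2: "\<bar>(1 - x ^ n) / (1 - x)\<bar> \<le> real n * 1" if "x \<in> {0..1}" for n and x :: real
    using geometric_quotient_bound[OF that, of n] by simp
  have pow_int: "integrable \<Omega> (\<lambda>\<omega>. spans a b \<omega> * x ^ ?N \<omega>)" if "x \<in> {0..1}" for x
    by (rule integrable_mult_bounded[OF spans_integrable]) (use that in \<open>auto simp: power_abs power_le_one\<close>)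
  have "(LBINT x:{0..1}. gap_weight1 x * expectation (\<lambda>\<omega>. spans a b \<omega> * (real (?N \<omega>) * x ^ (?N \<omega> - 1))))
      = (LBINT x:{0..1}. expectation (\<lambda>\<omega>. spans a b \<omega> * (gap_weight1 x * (real (?N \<omega>) * x ^ (?N \<omega> - 1)))))"
    by (simp add: mult.left_commute)
  also have "\<dots> = expectation (\<lambda>\<omega>. spans a b \<omega> * (LBINT x:{0..1}. gap_weight1 x * (real (?N \<omega>) * x ^ (?N \<omega> - 1))))"
    by (rule expectation_unit_integral_swap(1)[where f = "\<lambda>n x. gap_weight1 x * (real n * x ^ (n - 1))"
          and B = real and w = gap_weight1, symmetric])
       (use bound1 spans_item_count_integrable gap_weight1_integrable in auto)
  also have "\<dots> = expectation (\<lambda>\<omega>. spans a b \<omega> * (LBINT x:{0..1}. (1 - x ^ ?N \<omega>) / (1 - x)))"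
    by (simp only: gap_weight1_derivative_power)
  also have "\<dots> = (LBINT x:{0..1}. expectation (\<lambda>\<omega>. spans a b \<omega> * ((1 - x ^ ?N \<omega>) / (1 - x))))"
    by (rule expectation_unit_integral_swap(1)[where f = "\<lambda>n x. (1 - x ^ n) / (1 - x)"
          and B = real and w = "\<lambda>_. 1"])
       (use bound2 spans_item_count_integrable in \<open>auto simp: set_integrable_def\<close>)
  also have "\<dots> = (LBINT x:{0..1}. (expectation (spans a b) - expectation (\<lambda>\<omega>. spans a b \<omega> * x ^ ?N \<omega>)) / (1 - x))"
  proof (rule set_integral_unit_cong)
    fix x :: real assume "x \<in> {0..1}"
    then show "expectation (\<lambda>\<omega>. spans a b \<omega> * ((1 - x ^ ?N \<omega>) / (1 - x)))
        = (expectation (spans a b) - expectation (\<lambda>\<omega>. spans a b \<omega> * x ^ ?N \<omega>)) / (1 - x)"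
      using pow_int spans_integrable[of a b] by (simp add: right_diff_distrib)
  qed
  finally show ?thesis .
qed

text \<open>
  The generating function identities give \<open>N * x ^ N\<close> where \<open>N * x ^ (N - 1)\<close> is needed.  Dividing by
  \<open>x\<close> is possible except at \<open>x = 0\<close>, where \<open>gap_weight1\<close> vanishes.
\<close>

lemma gap_weight1_mult_slope:
  assumes "\<And>x. x \<in> {0..1} \<Longrightarrow>
    expectation (\<lambda>\<omega>. spans a b \<omega> * x ^ item_count M A c \<omega> * real (item_count M A c \<omega>)) = x * s x"
    and x: "x \<in> {0..1}"
  shows "gap_weight1 x * expectation (\<lambda>\<omega>. spans a b \<omega> * (real (item_count M A c \<omega>) * x ^ (item_count M A c \<omega> - 1)))
      = gap_weight1 x * s x"
proof (cases "x = 0")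
  case False
  let ?N = "item_count M A c"
  have "x * (real n * x ^ (n - 1)) = x ^ n * real n" for n by (cases n) auto
  then have pointwise: "x * (spans a b \<omega> * (real (?N \<omega>) * x ^ (?N \<omega> - 1))) = spans a b \<omega> * x ^ ?N \<omega> * real (?N \<omega>)" for \<omega>
    by (metis mult.assoc mult.left_commute)
  have "x * expectation (\<lambda>\<omega>. spans a b \<omega> * (real (?N \<omega>) * x ^ (?N \<omega> - 1)))
      = expectation (\<lambda>\<omega>. spans a b \<omega> * x ^ ?N \<omega> * real (?N \<omega>))"
    by (subst integral_mult_right_zero[symmetric]) (simp only: pointwise)
  then show ?thesis using assms(1)[OF x] False by simp
qed (simp add: gap_weight1_zero)

context
  fixes a b m i :: nat
  assumes ab: "1 \<le> a" "a < b" "b \<le> k" and m: "b = a + m" and i: "a < i" "i < b"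
begin

lemma set_integral_inner_slope:
  "(LBINT x:{0..1}. gap_weight1 x * inner_slope m x) = (LBINT x:{0..1}. (inner_pgf m 1 - inner_pgf m x) / (1 - x))"
proof -
  have "x * (if i = a \<or> i = b then outer_slope m x else inner_slope m x) = x * inner_slope m x" for x
    using i by auto
  then have sl: "expectation (\<lambda>\<omega>. spans a b \<omega> * x ^ item_count M A i \<omega> * real (item_count M A i \<omega>)) = x * inner_slope m x"
    if "x \<in> {0..1}" for x
    using expectation_spans_power_count[OF ab m i _ that, of i] i by simp
  have "(LBINT x:{0..1}. gap_weight1 x * inner_slope m x)
    = (LBINT x:{0..1}. gap_weight1 x * expectation (\<lambda>\<omega>. spans a b \<omega> *
         (real (item_count M A i \<omega>) * x ^ (item_count M A i \<omega> - 1))))"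
    by (rule set_integral_unit_cong) (rule gap_weight1_mult_slope[OF sl, symmetric])
  also have "\<dots> = (LBINT x:{0..1}. (inner_pgf m 1 - inner_pgf m x) / (1 - x))"
    unfolding expectation_geometric_quotient expectation_spans_eq[OF ab m i]
    by (rule set_integral_unit_cong) (simp add: expectation_spans_power[OF ab m i])
  finally show ?thesis .
qed

text \<open>
  The slope belongs to the count of an end aisle, so it is the generating function of that aisle
  which appears, not the one of an inner aisle.
\<close>

lemma set_integral_outer_slope:
  "(LBINT x:{0..1}. gap_weight1 x * outer_slope m x)
    = (LBINT x:{0..1}. (expectation (spans a b) - expectation (\<lambda>\<omega>. spans a b \<omega> * x ^ item_count M A a \<omega>)) / (1 - x))"
proof -
  have "(LBINT x:{0..1}. gap_weight1 x * outer_slope m x)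
    = (LBINT x:{0..1}. gap_weight1 x * expectation (\<lambda>\<omega>. spans a b \<omega> *
         (real (item_count M A a \<omega>) * x ^ (item_count M A a \<omega> - 1))))"
    by (rule set_integral_unit_cong)
       (rule gap_weight1_mult_slope[OF expectation_spans_endpoint_power_count[OF ab m], symmetric])
  then show ?thesis unfolding expectation_geometric_quotient .
qed

text \<open>
  Here the power has the exponent \<open>N\<close> instead of \<open>N - 1\<close>.  Splitting \<open>N * x ^ N\<close> into
  \<open>(N + 1) * x ^ N - x ^ N\<close> makes the first part a derivative again.
\<close>

lemma set_integral_inner_slope_same_aisle:
  "(LBINT x:{0..1}. gap_weight1 x * (x * inner_slope m x))
    = (LBINT x:{0..1}. (inner_pgf m 1 - x * inner_pgf m x) / (1 - x)) + (LBINT x:{0..1}. ln (1 - x) * inner_pgf m x)"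
proof -
  let ?N = "item_count M A i"
  have [measurable]: "gap_weight1 \<in> borel_measurable borel"
    using gap_moment_weight1 by (simp add: gap_moment_weight_def)
  have "(LBINT x:{0..1}. gap_weight1 x * (x * inner_slope m x))
     = (LBINT x:{0..1}. gap_weight1 x * expectation (\<lambda>\<omega>. spans a b \<omega> * real (?N \<omega>) * x ^ ?N \<omega>))"
    using expectation_spans_power_count[OF ab m i, of i] i
    by (intro set_integral_unit_cong) (simp add: mult_ac)
  also have "\<dots> = expectation (\<lambda>\<omega>. spans a b \<omega> * real (?N \<omega>) * gap_mean gap_weight1 (?N \<omega>))"
    by (rule gap_mean_swap(1)[OF gap_moment_weight1 spans_item_count_integrable, symmetric])
  also have "\<dots> = expectation (\<lambda>\<omega>. spans a b \<omega> * (LBINT x:{0..1}. (1 - x ^ Suc (?N \<omega>)) / (1 - x))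
      - spans a b \<omega> * gap_mean gap_weight1 (?N \<omega>))"
  proof -
    have "(LBINT x:{0..1}. (1 - x ^ Suc n) / (1 - x)) = (real n + 1) * gap_mean gap_weight1 n" for n
      using gap_weight1_derivative_power[of "Suc n"]
      by (simp add: gap_mean_def mult.left_commute[of "gap_weight1 _"] add.commute del: power_Suc)
    then show ?thesis by (simp add: algebra_simps del: power_Suc)
  qed
  also have "\<dots> = expectation (\<lambda>\<omega>. spans a b \<omega> * (LBINT x:{0..1}. (1 - x ^ Suc (?N \<omega>)) / (1 - x)))
      - expectation (\<lambda>\<omega>. spans a b \<omega> * gap_mean gap_weight1 (?N \<omega>))"
  proof (rule Bochner_Integration.integral_diff)
    show "integrable \<Omega> (\<lambda>\<omega>. spans a b \<omega> * gap_mean gap_weight1 (?N \<omega>))"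
      by (rule gap_mean_swap(2)[OF gap_moment_weight1 spans_integrable])
    show "integrable \<Omega> (\<lambda>\<omega>. spans a b \<omega> * (LBINT x:{0..1}. (1 - x ^ Suc (?N \<omega>)) / (1 - x)))"
      by (rule expectation_unit_integral_swap(3)[where f = "\<lambda>n x. (1 - x ^ Suc n) / (1 - x)"
          and B = "\<lambda>n. real (Suc n)" and w = "\<lambda>_. 1"])
         (use geometric_quotient_bound[of _ "Suc _"] spans_item_count_integrable spans_integrable
           in \<open>auto simp: set_integrable_def distrib_left simp del: power_Suc\<close>)
  qed
  also have "expectation (\<lambda>\<omega>. spans a b \<omega> * gap_mean gap_weight1 (?N \<omega>))
      = - (LBINT x:{0..1}. ln (1 - x) * inner_pgf m x)"
  proof -
    have "(LBINT x:{0..1}. gap_weight1 x * expectation (\<lambda>\<omega>. spans a b \<omega> * x ^ ?N \<omega>))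
        = (LBINT x:{0..1}. gap_weight1 x * inner_pgf m x)"
      by (rule set_integral_unit_cong) (simp add: expectation_spans_power[OF ab m i])
    then show ?thesis
      unfolding gap_mean_swap(1)[OF gap_moment_weight1 spans_integrable]
      by (simp add: set_integral_gap_weight1 mult.commute)
  qed
  also have "expectation (\<lambda>\<omega>. spans a b \<omega> * (LBINT x:{0..1}. (1 - x ^ Suc (?N \<omega>)) / (1 - x)))
      = (LBINT x:{0..1}. expectation (\<lambda>\<omega>. spans a b \<omega> * ((1 - x ^ Suc (?N \<omega>)) / (1 - x))))"
    by (rule expectation_unit_integral_swap(1)[where f = "\<lambda>n x. (1 - x ^ Suc n) / (1 - x)"
          and B = "\<lambda>n. real (Suc n)" and w = "\<lambda>_. 1"])
       (use geometric_quotient_bound[of _ "Suc _"] spans_item_count_integrable spans_integrable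
         in \<open>auto simp: set_integrable_def distrib_left simp del: power_Suc\<close>)
  also have "\<dots> = (LBINT x:{0..1}. (inner_pgf m 1 - x * inner_pgf m x) / (1 - x))"
  proof (rule set_integral_unit_cong)
    fix x :: real assume x: "x \<in> {0..1}"
    have "integrable \<Omega> (\<lambda>\<omega>. spans a b \<omega> * x ^ ?N \<omega>)"
      by (rule integrable_mult_bounded[OF spans_integrable]) (use x in \<open>auto simp: power_abs power_le_one\<close>)
    then show "expectation (\<lambda>\<omega>. spans a b \<omega> * ((1 - x ^ Suc (?N \<omega>)) / (1 - x)))
        = (inner_pgf m 1 - x * inner_pgf m x) / (1 - x)"
      using spans_integrable[of a b] expectation_spans_power[OF ab m i x] expectation_spans_eq[OF ab m i]
      by (simp add: right_diff_distrib mult.left_commute[of _ x])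
  qed
  finally show ?thesis by simp
qed

lemma unit_deriv_inner_pgf: "unit_deriv (inner_pgf m) 1 = inner_slope m 1"
proof (rule unit_deriv_eqI)
  have "((\<lambda>x. expectation (\<lambda>\<omega>. spans a b \<omega> * x ^ item_count M A i \<omega>)) has_real_derivative
      expectation (\<lambda>\<omega>. spans a b \<omega> * (real (item_count M A i \<omega>) * 1 ^ (item_count M A i \<omega> - 1)))) (at 1 within {0..1})"
    by (rule has_derivative_expectation_power[OF spans_integrable item_count_measurable spans_item_count_integrable]) simp
  then show "((\<lambda>x. expectation (\<lambda>\<omega>. spans a b \<omega> * x ^ item_count M A i \<omega>)) has_real_derivative inner_slope m 1)
      (at 1 within {0..1})"
    using expectation_spans_power_count[OF ab m i, of i 1] i by simp
qed (use expectation_spans_power[OF ab m i] in auto)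

lemma unit_deriv_outer_pgf:
  "unit_deriv (\<lambda>x. expectation (\<lambda>\<omega>. spans a b \<omega> * x ^ item_count M A a \<omega>)) 1 = outer_slope m 1"
proof (rule unit_deriv_eqI)
  have "((\<lambda>x. expectation (\<lambda>\<omega>. spans a b \<omega> * x ^ item_count M A a \<omega>)) has_real_derivative
      expectation (\<lambda>\<omega>. spans a b \<omega> * (real (item_count M A a \<omega>) * 1 ^ (item_count M A a \<omega> - 1)))) (at 1 within {0..1})"
    by (rule has_derivative_expectation_power[OF spans_integrable item_count_measurable spans_item_count_integrable]) simp
  then show "((\<lambda>x. expectation (\<lambda>\<omega>. spans a b \<omega> * x ^ item_count M A a \<omega>)) has_real_derivative outer_slope m 1)
      (at 1 within {0..1})"
    using expectation_spans_endpoint_power_count[OF ab m, of 1] by simp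
qed auto

end

abbreviation last_idx :: "'a \<Rightarrow> nat" where "last_idx \<equiv> last_aisle k M A"

abbreviation first_idx :: "'a \<Rightarrow> nat" where "first_idx \<equiv> first_aisle k M A"

section \<open>The last occupied aisle\<close>

lemma last_aisle_le_iff_confined:
  assumes "\<forall>j. A j \<omega> \<in> {1..k}"
  shows "(if last_idx \<omega> \<le> r then 1 else 0) = confined {1..r} \<omega>"
proof -
  have "last_idx \<omega> \<le> r \<longleftrightarrow> (\<forall>i\<in>occupied k M A \<omega>. i \<le> r)"
  proof (cases "occupied k M A \<omega> = {}")
    case False
    have "finite (occupied k M A \<omega>)" by (simp add: occupied_def)
    with False show ?thesis by (simp add: last_aisle_def)
  qed (simp add: last_aisle_def)
  also have "\<dots> \<longleftrightarrow> (\<lambda>j. A j \<omega>) ` {..<M \<omega>} \<subseteq> {1..r}"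
    unfolding occupied_eq_image[OF assms] using assms by auto
  finally show ?thesis by (simp add: confined_def)
qed

lemma order_weight_one: "order_weight (\<lambda>_. 1) \<omega> = 1"
  by (simp add: order_weight_def)

lemma expectation_confined_M:
  assumes \<phi>: "integrable \<Omega> (\<lambda>\<omega>. \<phi> (M \<omega>))" and "r \<le> k"
  shows "expectation (\<lambda>\<omega>. confined {1..r} \<omega> * \<phi> (M \<omega>)) = expectation (\<lambda>\<omega>. \<phi> (M \<omega>) * (real r / real k) ^ M \<omega>)"
    and "integrable \<Omega> (\<lambda>\<omega>. confined {1..r} \<omega> * \<phi> (M \<omega>))"
proof -
  let ?w = "\<lambda>i. if i \<in> {1..r} then 1 else 0 :: real"
  have w: "\<bar>?w i\<bar> \<le> 1" for i by simp
  have c: "confined {1..r} \<omega> = order_weight ?w \<omega>" for \<omega>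
    using confined_mult_order_weight[of "{1..r}" \<omega> "\<lambda>_. 1"] by (simp add: order_weight_one)
  have "aisle_mean ?w = real r / real k"
    using aisle_mean_restrict[of "{1..r}" "\<lambda>_. 1"] assms(2) by simp
  then show "expectation (\<lambda>\<omega>. confined {1..r} \<omega> * \<phi> (M \<omega>)) = expectation (\<lambda>\<omega>. \<phi> (M \<omega>) * (real r / real k) ^ M \<omega>)"
    using expectation_order_weight[of ?w \<phi>, OF w \<phi>] unfolding c by (simp add: mult.commute)
  have "integrable \<Omega> (\<lambda>\<omega>. \<phi> (M \<omega>) * order_weight ?w \<omega>)"
    by (rule integrable_mult_bounded[OF \<phi>]) (use order_weight_bound[of ?w, OF w] in auto)
  then show "integrable \<Omega> (\<lambda>\<omega>. confined {1..r} \<omega> * \<phi> (M \<omega>))"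
    unfolding c by (simp add: mult.commute)
qed

text \<open>
  Summation by parts: if \<open>f\<close> has the increments \<open>g\<close>, then \<open>f k - f n\<close> is the sum of \<open>g r\<close> over
  \<open>n \<le> r < k\<close>; and the last occupied aisle is at most \<open>r\<close> if all items lie in the first \<open>r\<close> aisles.
\<close>

lemma expectation_tail_sum:
  assumes \<phi>: "integrable \<Omega> (\<lambda>\<omega>. \<phi> (M \<omega>))"
    and f: "\<And>n. n \<le> k \<Longrightarrow> f n = f k - (\<Sum>r<k. if n \<le> r then g r else 0)"
  shows "expectation (\<lambda>\<omega>. \<phi> (M \<omega>) * f (last_idx \<omega>))
    = f k * expectation (\<lambda>\<omega>. \<phi> (M \<omega>)) - (\<Sum>r<k. g r * expectation (\<lambda>\<omega>. \<phi> (M \<omega>) * (real r / real k) ^ M \<omega>))"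
proof -
  note C = expectation_confined_M[OF \<phi>, OF less_imp_le]
  have sum_int: "integrable \<Omega> (\<lambda>\<omega>. \<Sum>r<k. g r * (confined {1..r} \<omega> * \<phi> (M \<omega>)))"
    by (intro Bochner_Integration.integrable_sum integrable_mult_right C(2)) simp
  have [measurable]: "(\<lambda>\<omega>. \<phi> (M \<omega>)) \<in> borel_measurable \<Omega>" using \<phi> by (rule borel_measurable_integrable)
  have "(\<lambda>\<omega>. f (last_idx \<omega>)) \<in> borel_measurable \<Omega>"
    by (rule measurable_compose[OF aisle_measurable(2)]) simp
  then have [measurable]: "(\<lambda>\<omega>. \<phi> (M \<omega>) * f (last_idx \<omega>)) \<in> borel_measurable \<Omega>" by measurable
  have "expectation (\<lambda>\<omega>. \<phi> (M \<omega>) * f (last_idx \<omega>))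
      = expectation (\<lambda>\<omega>. f k * \<phi> (M \<omega>) - (\<Sum>r<k. g r * (confined {1..r} \<omega> * \<phi> (M \<omega>))))"
  proof (rule integral_cong_AE)
    show "AE \<omega> in \<Omega>. \<phi> (M \<omega>) * f (last_idx \<omega>) = f k * \<phi> (M \<omega>) - (\<Sum>r<k. g r * (confined {1..r} \<omega> * \<phi> (M \<omega>)))"
      using AE_A_range
    proof eventually_elim
      case (elim \<omega>)
      have "(\<Sum>r<k. if last_idx \<omega> \<le> r then g r else 0) = (\<Sum>r<k. g r * confined {1..r} \<omega>)"
        unfolding last_aisle_le_iff_confined[OF elim, symmetric] by (intro sum.cong) auto
      then have "f (last_idx \<omega>) = f k - (\<Sum>r<k. g r * confined {1..r} \<omega>)"
        using f[OF last_aisle_le[of k M A \<omega>]] by (simp only:)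
      then show ?case by (simp add: right_diff_distrib sum_distrib_left mult_ac)
    qed
    show "(\<lambda>\<omega>. f k * \<phi> (M \<omega>) - (\<Sum>r<k. g r * (confined {1..r} \<omega> * \<phi> (M \<omega>)))) \<in> borel_measurable \<Omega>"
      using borel_measurable_integrable[OF sum_int] by measurable
  qed measurable
  also have "\<dots> = f k * expectation (\<lambda>\<omega>. \<phi> (M \<omega>)) - expectation (\<lambda>\<omega>. \<Sum>r<k. g r * (confined {1..r} \<omega> * \<phi> (M \<omega>)))"
    using \<phi> sum_int by simp
  also have "expectation (\<lambda>\<omega>. \<Sum>r<k. g r * (confined {1..r} \<omega> * \<phi> (M \<omega>)))
      = (\<Sum>r<k. expectation (\<lambda>\<omega>. g r * (confined {1..r} \<omega> * \<phi> (M \<omega>))))"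
    by (intro Bochner_Integration.integral_sum integrable_mult_right C(2)) simp
  also have "\<dots> = (\<Sum>r<k. g r * expectation (\<lambda>\<omega>. \<phi> (M \<omega>) * (real r / real k) ^ M \<omega>))"
  proof (rule sum.cong[OF refl])
    fix r assume "r \<in> {..<k}"
    then have "r < k" by simp
    from C(1)[OF this]
    show "expectation (\<lambda>\<omega>. g r * (confined {1..r} \<omega> * \<phi> (M \<omega>)))
        = g r * expectation (\<lambda>\<omega>. \<phi> (M \<omega>) * (real r / real k) ^ M \<omega>)"
      by (simp only: integral_mult_right_zero)
  qed
  finally show ?thesis .
qed

lemma expectation_last_aisle:
  "expectation (\<lambda>\<omega>. real (last_idx \<omega>)) = real k - (\<Sum>r<k. pgf \<Omega> M (real r / real k))"
  "expectation (\<lambda>\<omega>. (real (last_idx \<omega>))\<^sup>2) = (real k)\<^sup>2 - (\<Sum>r<k. (2 * real r + 1) * pgf \<Omega> M (real r / real k))"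
  using expectation_tail_sum[of "\<lambda>_. 1" real "\<lambda>_. 1"] sum_tail_indicator(1)
    expectation_tail_sum[of "\<lambda>_. 1" "\<lambda>n. (real n)\<^sup>2" "\<lambda>r. 2 * real r + 1"] sum_tail_indicator(2)
  by (simp_all add: pgf_def prob_space)

lemma unit_deriv_pgf:
  assumes "x \<in> {0..1}"
  shows "unit_deriv (pgf \<Omega> M) x = pgf' x"
  using has_derivative_expectation_power[of "\<lambda>_. 1" M x] M_integrable assms
  by (intro unit_deriv_eqI[where f = "\<lambda>x. expectation (\<lambda>\<omega>. 1 * x ^ M \<omega>)"]) (auto simp: pgf_def pgf'_def)

lemma expectation_M_last_aisle:
  "expectation (\<lambda>\<omega>. real (M \<omega>) * real (last_idx \<omega>)) = real k * expectation (\<lambda>\<omega>. real (M \<omega>))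
      - (\<Sum>r<k. real r / real k * unit_deriv (pgf \<Omega> M) (real r / real k))"
proof -
  have "expectation (\<lambda>\<omega>. real (M \<omega>) * x ^ M \<omega>) = x * pgf' x" for x
  proof -
    have eq: "x * (real n * x ^ (n - 1)) = real n * x ^ n" for n by (cases n) auto
    show ?thesis unfolding pgf'_def
      by (subst integral_mult_right_zero[symmetric]) (simp only: eq)
  qed
  moreover have "real r / real k \<in> {0..1}" if "r < k" for r using that by simp
  ultimately show ?thesis
    using expectation_tail_sum[of real real "\<lambda>_. 1"] sum_tail_indicator(1) M_integrable
    by (simp add: unit_deriv_pgf)
qed

section \<open>Summing over the spans and their inner aisles\<close>

text \<open>
  At most one of the indicators is \<open>1\<close>, and a span without inner aisles contributes nothing.  Here \<open>m\<close> is the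
  difference of its ends and \<open>a\<close> its first aisle.
\<close>

lemma span_decomposition:
  fixes H :: "nat \<Rightarrow> nat \<Rightarrow> real"
  assumes H: "\<And>a b. b \<le> a + 1 \<Longrightarrow> H a b = 0"
  shows "H (first_idx \<omega>) (last_idx \<omega>) = (\<Sum>m=2..<k. \<Sum>a=1..k-m. spans a (a + m) \<omega> * H a (a + m))"
proof (cases "last_idx \<omega> \<le> first_idx \<omega> + 1")
  case True
  have "spans a (a + m) \<omega> = 0" if "2 \<le> m" for a m
    using True that by (auto simp: spans_def)
  then show ?thesis using H[OF True] by simp
next
  case False
  let ?f = "first_idx \<omega>" and ?l = "last_idx \<omega>"
  have f: "1 \<le> ?f" "?f + 2 \<le> ?l" "?l \<le> k"
    using False first_last_aisle_cases[of k M A \<omega>] last_aisle_le[of k M A \<omega>] by auto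
  have "(\<Sum>m=2..<k. \<Sum>a=1..k-m. spans a (a + m) \<omega> * H a (a + m))
      = (\<Sum>m=2..<k. \<Sum>a=1..k-m. if a = ?f then (if m = ?l - ?f then H ?f ?l else 0) else 0)"
    using f by (intro sum.cong refl) (auto simp: spans_def)
  also have "\<dots> = (\<Sum>m=2..<k. if m = ?l - ?f then H ?f ?l else 0)"
    using f by (intro sum.cong refl) (auto simp: sum.delta)
  also have "\<dots> = H ?f ?l" using f by (auto simp: sum.delta)
  finally show ?thesis by simp
qed

lemma expectation_span_decomposition:
  fixes H :: "nat \<Rightarrow> nat \<Rightarrow> 'a \<Rightarrow> real"
  assumes H: "\<And>a b \<omega>. b \<le> a + 1 \<Longrightarrow> H a b \<omega> = 0"
    and int: "\<And>a b. integrable \<Omega> (\<lambda>\<omega>. spans a b \<omega> * H a b \<omega>)"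
    and val: "\<And>a m. 1 \<le> a \<Longrightarrow> a + m \<le> k \<Longrightarrow> 2 \<le> m \<Longrightarrow> expectation (\<lambda>\<omega>. spans a (a + m) \<omega> * H a (a + m) \<omega>) = v a m"
  shows "expectation (\<lambda>\<omega>. H (first_idx \<omega>) (last_idx \<omega>) \<omega>) = (\<Sum>m=2..<k. \<Sum>a=1..k-m. v a m)"
    and "integrable \<Omega> (\<lambda>\<omega>. H (first_idx \<omega>) (last_idx \<omega>) \<omega>)"
proof -
  have eq: "H (first_idx \<omega>) (last_idx \<omega>) \<omega> = (\<Sum>m=2..<k. \<Sum>a=1..k-m. spans a (a + m) \<omega> * H a (a + m) \<omega>)" for \<omega>
    by (rule span_decomposition) (rule H)
  show "integrable \<Omega> (\<lambda>\<omega>. H (first_idx \<omega>) (last_idx \<omega>) \<omega>)"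
    unfolding eq by (intro Bochner_Integration.integrable_sum int)
  have "expectation (\<lambda>\<omega>. H (first_idx \<omega>) (last_idx \<omega>) \<omega>)
      = (\<Sum>m=2..<k. \<Sum>a=1..k-m. expectation (\<lambda>\<omega>. spans a (a + m) \<omega> * H a (a + m) \<omega>))"
    unfolding eq using int by (simp add: Bochner_Integration.integral_sum)
  also have "\<dots> = (\<Sum>m=2..<k. \<Sum>a=1..k-m. v a m)"
    by (intro sum.cong refl val) auto
  finally show "expectation (\<lambda>\<omega>. H (first_idx \<omega>) (last_idx \<omega>) \<omega>) = (\<Sum>m=2..<k. \<Sum>a=1..k-m. v a m)" .
qed

text \<open>
  The fraction of the aisle that is walked, once in each direction.
\<close>

definition detour :: "nat \<Rightarrow> 'a \<Rightarrow> real" where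
  "detour i \<omega> = 1 - largest_gap M A X i \<omega>"

definition detours :: "nat \<Rightarrow> nat \<Rightarrow> 'a \<Rightarrow> real" where
  "detours a b \<omega> = (\<Sum>i=a + 1..<b. detour i \<omega>)"

lemma detour_measurable [measurable]: "detour i \<in> borel_measurable \<Omega>"
  unfolding detour_def by measurable

lemma detours_measurable [measurable]: "detours a b \<in> borel_measurable \<Omega>"
  unfolding detours_def by measurable

lemma AE_detour: "AE \<omega> in \<Omega>. \<forall>i. 0 \<le> detour i \<omega> \<and> detour i \<omega> \<le> 1"
  using AE_largest_gap by eventually_elim (simp add: detour_def)

lemma AE_detours: "AE \<omega> in \<Omega>. \<forall>a b. \<bar>detours a b \<omega>\<bar> \<le> real b"
  using AE_detour
proof eventually_elim
  case (elim \<omega>)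
  have "\<bar>detours a b \<omega>\<bar> \<le> real b" for a b
  proof -
    have "\<bar>detours a b \<omega>\<bar> \<le> (\<Sum>i=a + 1..<b. 1)"
      unfolding detours_def using elim by (intro order_trans[OF sum_abs] sum_mono) (auto simp: abs_le_iff intro: order_trans)
    then show ?thesis by simp
  qed
  then show ?case by blast
qed

lemma detours_integrable:
  assumes F: "integrable \<Omega> F"
  shows "integrable \<Omega> (\<lambda>\<omega>. F \<omega> * detour i \<omega>)" "integrable \<Omega> (\<lambda>\<omega>. F \<omega> * detours a b \<omega>)"
proof -
  show "integrable \<Omega> (\<lambda>\<omega>. F \<omega> * detour i \<omega>)"
  proof (rule integrable_mult_bounded_by[OF F])
    show "AE \<omega> in \<Omega>. \<bar>detour i \<omega>\<bar> \<le> 1" using AE_detour by eventually_elim auto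
  qed measurable
  show "integrable \<Omega> (\<lambda>\<omega>. F \<omega> * detours a b \<omega>)"
  proof (rule integrable_mult_bounded_by[OF F])
    show "AE \<omega> in \<Omega>. \<bar>detours a b \<omega>\<bar> \<le> real b" using AE_detours by eventually_elim blast
  qed measurable
qed

lemma spans_M_integrable: "integrable \<Omega> (\<lambda>\<omega>. spans a b \<omega> * real (M \<omega>))"
  using integrable_mult_bounded[OF M_integrable, of "spans a b"] by (simp add: mult.commute)

text \<open>
  The four means that start here are taken at a reference position: the span starts at aisle \<open>1\<close> and the
  gaps are those of the first inner aisles.
\<close>

definition detour_mean where "detour_mean m = expectation (\<lambda>\<omega>. spans 1 (m + 1) \<omega> * detour 2 \<omega>)"

definition detour_square_mean where "detour_square_mean m = expectation (\<lambda>\<omega>. spans 1 (m + 1) \<omega> * (detour 2 \<omega>)\<^sup>2)"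

definition detour_product_mean where
  "detour_product_mean m = expectation (\<lambda>\<omega>. spans 1 (m + 1) \<omega> * (detour 2 \<omega> * detour 3 \<omega>))"

text \<open>
  For the gap in aisle \<open>2\<close> the values \<open>1\<close>, \<open>2\<close>, \<open>3\<close> of \<open>c\<close> stand for the three possible roles of
  the counted aisle: an end of the span, the aisle of the gap, another inner aisle.
\<close>

definition count_detour_mean where
  "count_detour_mean m c = expectation (\<lambda>\<omega>. spans 1 (m + 1) \<omega> * real (item_count M A c \<omega>) * detour 2 \<omega>)"

context
  fixes a m :: nat
  assumes am: "1 \<le> a" "a + m \<le> k" "2 \<le> m"
begin

lemma expectation_spans_detour:
  assumes "i \<in> {a + 1..<a + m}"
  shows "expectation (\<lambda>\<omega>. spans a (a + m) \<omega> * detour i \<omega>) = detour_mean m"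
  using expectation_complement_gap_spans[of a "a + m" m i] expectation_complement_gap_spans[of 1 "m + 1" m 2] assms am
  by (simp add: detour_def detour_mean_def)

lemma expectation_spans_detour_square:
  assumes "i \<in> {a + 1..<a + m}"
  shows "expectation (\<lambda>\<omega>. spans a (a + m) \<omega> * (detour i \<omega>)\<^sup>2) = detour_square_mean m"
  using expectation_complement_gap_squared_spans[of a "a + m" m i]
    expectation_complement_gap_squared_spans[of 1 "m + 1" m 2] assms am
  by (simp add: detour_def detour_square_mean_def)

lemma expectation_spans_detour_product:
  assumes "i \<in> {a + 1..<a + m}" "j \<in> {a + 1..<a + m}" "i \<noteq> j"
  shows "expectation (\<lambda>\<omega>. spans a (a + m) \<omega> * (detour i \<omega> * detour j \<omega>)) = detour_product_mean m"
proof -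
  have "3 \<le> m" using assms by auto
  then show ?thesis
    using expectation_complement_gap_product_spans[of a "a + m" m i j]
      expectation_complement_gap_product_spans[of 1 "m + 1" m 2 3] assms am
    by (simp add: detour_def detour_product_mean_def)
qed

text \<open>
  Both sides have the same closed form, which involves the span through \<open>m\<close> only.
\<close>

lemma expectation_spans_count_detour:
  assumes "i \<in> {a + 1..<a + m}" "c \<in> {a..a + m}"
  shows "expectation (\<lambda>\<omega>. spans a (a + m) \<omega> * real (item_count M A c \<omega>) * detour i \<omega>)
    = count_detour_mean m (if c = a \<or> c = a + m then 1 else if c = i then 2 else 3)"
proof -
  have "3 \<le> m" if "\<not> (c = a \<or> c = a + m)" "c \<noteq> i" using assms that by auto
  then show ?thesis
    using expectation_count_complement_gap_spans[of a "a + m" m i c]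
      expectation_count_complement_gap_spans[of 1 "m + 1" m 2 "if c = a \<or> c = a + m then 1 else if c = i then 2 else 3"] assms am
    by (auto simp: detour_def count_detour_mean_def)
qed

lemma expectation_spans_detours:
  "expectation (\<lambda>\<omega>. spans a (a + m) \<omega> * detours a (a + m) \<omega>) = (real m - 1) * detour_mean m"
proof -
  have "expectation (\<lambda>\<omega>. spans a (a + m) \<omega> * detours a (a + m) \<omega>)
      = (\<Sum>i=a + 1..<a + m. expectation (\<lambda>\<omega>. spans a (a + m) \<omega> * detour i \<omega>))"
    unfolding detours_def sum_distrib_left
    by (intro Bochner_Integration.integral_sum detours_integrable spans_integrable)
  also have "\<dots> = (\<Sum>i=a + 1..<a + m. detour_mean m)"
    by (intro sum.cong refl expectation_spans_detour)
  finally show ?thesis using am by simp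
qed

lemma expectation_spans_detours_square:
  "expectation (\<lambda>\<omega>. spans a (a + m) \<omega> * (detours a (a + m) \<omega>)\<^sup>2)
    = (real m - 1) * detour_square_mean m + (real m - 1) * (real m - 2) * detour_product_mean m"
proof -
  let ?I = "{a + 1..<a + m}"
  have int: "integrable \<Omega> (\<lambda>\<omega>. spans a (a + m) \<omega> * (detour i \<omega> * detour j \<omega>))" for i j
    using detours_integrable(1)[OF detours_integrable(1)[OF spans_integrable]] by (simp add: mult.assoc)
  have "expectation (\<lambda>\<omega>. spans a (a + m) \<omega> * (detours a (a + m) \<omega>)\<^sup>2)
      = expectation (\<lambda>\<omega>. \<Sum>i\<in>?I. \<Sum>j\<in>?I. spans a (a + m) \<omega> * (detour i \<omega> * detour j \<omega>))"
  proof -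
    have "(detours a (a + m) \<omega>)\<^sup>2 = (\<Sum>i\<in>?I. \<Sum>j\<in>?I. detour i \<omega> * detour j \<omega>)" for \<omega>
      by (simp only: detours_def power2_eq_square sum_product)
    then show ?thesis by (simp only: sum_distrib_left)
  qed
  also have "\<dots> = (\<Sum>i\<in>?I. \<Sum>j\<in>?I. expectation (\<lambda>\<omega>. spans a (a + m) \<omega> * (detour i \<omega> * detour j \<omega>)))"
    using int by (simp add: Bochner_Integration.integral_sum)
  also have "\<dots> = (\<Sum>i\<in>?I. \<Sum>j\<in>?I. detour_product_mean m +
      (if i = j then detour_square_mean m - detour_product_mean m else 0))"
    using expectation_spans_detour_square expectation_spans_detour_product
    by (intro sum.cong refl) (auto simp: power2_eq_square)
  also have "\<dots> = (\<Sum>i\<in>?I. real (card ?I) * detour_product_mean m + (detour_square_mean m - detour_product_mean m))"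
    by (intro sum.cong refl) (simp add: sum.distrib)
  also have "\<dots> = real (card ?I) * (real (card ?I) * detour_product_mean m + (detour_square_mean m - detour_product_mean m))"
    by (simp only: sum_constant)
  also have "real (card ?I) = real m - 1" using am by simp
  finally show ?thesis by (simp add: algebra_simps)
qed

text \<open>
  On the event of the span no item lies outside it.
\<close>

lemma AE_spans_M: "AE \<omega> in \<Omega>. spans a (a + m) \<omega> * real (M \<omega>)
    = (\<Sum>c=a..a + m. spans a (a + m) \<omega> * real (item_count M A c \<omega>))"
  using AE_A_range
proof eventually_elim
  case (elim \<omega>)
  show ?case
  proof (cases "spans a (a + m) \<omega> = 0")
    case False
    then have *: "first_idx \<omega> = a" "last_idx \<omega> = a + m" by (auto simp: spans_def split: if_splits)
    have fin: "finite (occupied k M A \<omega>)" by (simp add: occupied_def)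
    have "occupied k M A \<omega> \<noteq> {}" using *(1) am by (auto simp: first_aisle_def)
    then have "occupied k M A \<omega> \<subseteq> {a..a + m}"
      using * Min_le[OF fin] Max_ge[OF fin] by (auto simp: first_aisle_def last_aisle_def)
    then have sub: "\<And>l. l < M \<omega> \<Longrightarrow> A l \<omega> \<in> {a..a + m}"
      unfolding occupied_eq_image[OF elim] by blast
    have "(\<Sum>c=a..a + m. real (item_count M A c \<omega>)) = (\<Sum>l<M \<omega>. \<Sum>c=a..a + m. if A l \<omega> = c then 1 else 0)"
      unfolding item_count_sum by (rule sum.swap)
    also have "\<dots> = (\<Sum>l<M \<omega>. 1)"
      using sub by (intro sum.cong refl) simp
    finally show ?thesis by (simp add: sum_distrib_left[symmetric])
  qed simp
qed

text \<open>
  Writing the order size as the sum of the counts in the span, each gap is combined with the counts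
  of two end aisles, of its own aisle and of \<open>m - 2\<close> other inner aisles.
\<close>

lemma expectation_spans_M_detours:
  "expectation (\<lambda>\<omega>. spans a (a + m) \<omega> * (real (M \<omega>) * detours a (a + m) \<omega>))
    = (real m - 1) * (2 * count_detour_mean m 1 + count_detour_mean m 2 + (real m - 2) * count_detour_mean m 3)"
proof -
  let ?I = "{a + 1..<a + m}" and ?J = "{a..a + m}"
  let ?z = "\<lambda>i c. count_detour_mean m (if c = a \<or> c = a + m then 1 else if c = i then 2 else 3)"
  have int: "integrable \<Omega> (\<lambda>\<omega>. spans a (a + m) \<omega> * real (item_count M A c \<omega>) * detour i \<omega>)" for c i
    by (rule detours_integrable(1)[OF spans_item_count_integrable])
  have "expectation (\<lambda>\<omega>. spans a (a + m) \<omega> * (real (M \<omega>) * detours a (a + m) \<omega>))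
      = expectation (\<lambda>\<omega>. \<Sum>i\<in>?I. \<Sum>c\<in>?J. spans a (a + m) \<omega> * real (item_count M A c \<omega>) * detour i \<omega>)"
  proof (rule integral_cong_AE)
    show "AE \<omega> in \<Omega>. spans a (a + m) \<omega> * (real (M \<omega>) * detours a (a + m) \<omega>)
      = (\<Sum>i\<in>?I. \<Sum>c\<in>?J. spans a (a + m) \<omega> * real (item_count M A c \<omega>) * detour i \<omega>)"
      using AE_spans_M
    proof eventually_elim
      case (elim \<omega>)
      have "spans a (a + m) \<omega> * (real (M \<omega>) * detours a (a + m) \<omega>)
          = (\<Sum>c\<in>?J. spans a (a + m) \<omega> * real (item_count M A c \<omega>)) * detours a (a + m) \<omega>"
        using elim by (simp add: mult.assoc[symmetric])
      also have "\<dots> = (\<Sum>i\<in>?I. \<Sum>c\<in>?J. spans a (a + m) \<omega> * real (item_count M A c \<omega>) * detour i \<omega>)"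
        unfolding detours_def sum_product by (rule sum.swap)
      finally show ?case .
    qed
  qed measurable
  also have "\<dots> = (\<Sum>i\<in>?I. \<Sum>c\<in>?J. expectation (\<lambda>\<omega>. spans a (a + m) \<omega> * real (item_count M A c \<omega>) * detour i \<omega>))"
    using int by (simp add: Bochner_Integration.integral_sum)
  also have "\<dots> = (\<Sum>i\<in>?I. \<Sum>c\<in>?J. ?z i c)"
    by (intro sum.cong refl expectation_spans_count_detour)
  also have "\<dots> = (\<Sum>i\<in>?I. 2 * count_detour_mean m 1 + count_detour_mean m 2 + (real m - 2) * count_detour_mean m 3)"
  proof (rule sum.cong[OF refl])
    fix i assume i: "i \<in> ?I"
    \<comment> \<open>The aisles of the span by their roles relative to the gap in aisle \<open>i\<close>.\<close>
    let ?R = "?J - {a, a + m, i}"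
    have J: "?J = insert a (insert (a + m) (insert i ?R))" using i by auto
    have "card ?R = card ?J - card {a, a + m, i}" using i by (intro card_Diff_subset) auto
    then have card: "real (card ?R) = real m - 2" using i am by (simp add: of_nat_diff)
    have "(\<Sum>c\<in>?J. ?z i c) = ?z i a + (?z i (a + m) + (?z i i + (\<Sum>c\<in>?R. ?z i c)))"
      using i am by (subst J) (auto simp: sum.insert)
    also have "(\<Sum>c\<in>?R. ?z i c) = (\<Sum>c\<in>?R. count_detour_mean m 3)"
      by (intro sum.cong) auto
    finally show "(\<Sum>c\<in>?J. ?z i c) = 2 * count_detour_mean m 1 + count_detour_mean m 2 + (real m - 2) * count_detour_mean m 3"
      using i card by simp
  qed
  finally show ?thesis using am by simp
qed

end

definition total_detour :: "'a \<Rightarrow> real" where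
  "total_detour \<omega> = detours (first_idx \<omega>) (last_idx \<omega>) \<omega>"

lemma detours_short: "b \<le> a + 1 \<Longrightarrow> detours a b \<omega> = 0"
  by (simp add: detours_def)

lemma expectation_total_detour:
  "expectation total_detour = (\<Sum>m=2..<k. (real m - 1) * (real k - real m) * detour_mean m)"
proof -
  have "expectation total_detour = (\<Sum>m=2..<k. \<Sum>a=1..k-m. (real m - 1) * detour_mean m)"
    unfolding total_detour_def[abs_def]
    by (rule expectation_span_decomposition(1)[where H = detours])
       (auto intro: detours_short detours_integrable spans_integrable expectation_spans_detours)
  also have "\<dots> = (\<Sum>m=2..<k. (real m - 1) * (real k - real m) * detour_mean m)"
    by (intro sum.cong) (auto simp: of_nat_diff)
  finally show ?thesis .
qed

lemma expectation_last_aisle_total_detour: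
  "expectation (\<lambda>\<omega>. real (last_idx \<omega>) * total_detour \<omega>)
    = (\<Sum>m=2..<k. 1 / 2 * (real k - real m) * (real k + real m + 1) * (real m - 1) * detour_mean m)"
proof -
  have "expectation (\<lambda>\<omega>. real (last_idx \<omega>) * total_detour \<omega>)
      = (\<Sum>m=2..<k. \<Sum>a=1..k-m. real (a + m) * ((real m - 1) * detour_mean m))"
    unfolding total_detour_def
  proof (rule expectation_span_decomposition(1)[where H = "\<lambda>a b \<omega>. real b * detours a b \<omega>"])
    show "integrable \<Omega> (\<lambda>\<omega>. spans a b \<omega> * (real b * detours a b \<omega>))" for a b
      using detours_integrable(2)[OF spans_integrable, of a b a b] by (simp add: mult.left_commute)
    show "expectation (\<lambda>\<omega>. spans a (a + m) \<omega> * (real (a + m) * detours a (a + m) \<omega>))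
        = real (a + m) * ((real m - 1) * detour_mean m)" if "1 \<le> a" "a + m \<le> k" "2 \<le> m" for a m
      unfolding expectation_spans_detours[OF that, symmetric]
      by (subst integral_mult_right_zero[symmetric]) (simp only: mult.left_commute)
  qed (simp add: detours_short)
  also have "\<dots> = (\<Sum>m=2..<k. 1 / 2 * (real k - real m) * (real k + real m + 1) * (real m - 1) * detour_mean m)"
  proof (rule sum.cong[OF refl])
    fix m assume m: "m \<in> {2..<k}"
    have sum: "(\<Sum>a=1..n. real (a + m)) = real n * (real n + 1 + 2 * real m) / 2" for n
      by (induction n) (auto simp: field_simps)
    have "(\<Sum>a=1..k-m. real (a + m)) = 1 / 2 * (real k - real m) * (real k + real m + 1)"
      unfolding sum using m by (simp add: of_nat_diff)
    then show "(\<Sum>a=1..k-m. real (a + m) * ((real m - 1) * detour_mean m))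
        = 1 / 2 * (real k - real m) * (real k + real m + 1) * (real m - 1) * detour_mean m"
      by (simp only: sum_distrib_right[symmetric] mult.assoc)
  qed
  finally show ?thesis .
qed

lemma expectation_total_detour_square:
  "expectation (\<lambda>\<omega>. (total_detour \<omega>)\<^sup>2)
    = (\<Sum>m=2..<k. (real m - 1) * (real k - real m) * detour_square_mean m)
      + (\<Sum>m=3..<k. (real m - 1) * (real m - 2) * (real k - real m) * detour_product_mean m)"
proof -
  have "expectation (\<lambda>\<omega>. (total_detour \<omega>)\<^sup>2) = (\<Sum>m=2..<k. \<Sum>a=1..k-m.
      (real m - 1) * detour_square_mean m + (real m - 1) * (real m - 2) * detour_product_mean m)"
    unfolding total_detour_def
  proof (rule expectation_span_decomposition(1)[where H = "\<lambda>a b \<omega>. (detours a b \<omega>)\<^sup>2"])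
    show "integrable \<Omega> (\<lambda>\<omega>. spans a b \<omega> * (detours a b \<omega>)\<^sup>2)" for a b
      using detours_integrable(2)[OF detours_integrable(2)[OF spans_integrable], of a b a b a b]
      by (simp add: power2_eq_square mult.assoc)
  qed (auto simp: detours_short intro: expectation_spans_detours_square)
  also have "\<dots> = (\<Sum>m=2..<k. (real m - 1) * (real k - real m) * detour_square_mean m
      + (real m - 1) * (real m - 2) * (real k - real m) * detour_product_mean m)"
    by (intro sum.cong) (auto simp: of_nat_diff algebra_simps)
  also have "\<dots> = (\<Sum>m=2..<k. (real m - 1) * (real k - real m) * detour_square_mean m)
      + (\<Sum>m=2..<k. (real m - 1) * (real m - 2) * (real k - real m) * detour_product_mean m)"
    by (rule sum.distrib)
  also have "(\<Sum>m=2..<k. (real m - 1) * (real m - 2) * (real k - real m) * detour_product_mean m)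
      = (\<Sum>m=3..<k. (real m - 1) * (real m - 2) * (real k - real m) * detour_product_mean m)"
    by (rule sum_drop_two) simp
  finally show ?thesis .
qed

lemma expectation_M_total_detour:
  "expectation (\<lambda>\<omega>. real (M \<omega>) * total_detour \<omega>)
    = (\<Sum>m=3..<k. (real k - real m) * (real m - 1) * (real m - 2) * count_detour_mean m 3)
      + (\<Sum>m=2..<k. (real k - real m) * (real m - 1) * count_detour_mean m 2)
      + (\<Sum>m=2..<k. 2 * (real k - real m) * (real m - 1) * count_detour_mean m 1)"
proof -
  have "expectation (\<lambda>\<omega>. real (M \<omega>) * total_detour \<omega>) = (\<Sum>m=2..<k. \<Sum>a=1..k-m.
      (real m - 1) * (2 * count_detour_mean m 1 + count_detour_mean m 2 + (real m - 2) * count_detour_mean m 3))"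
    unfolding total_detour_def
  proof (rule expectation_span_decomposition(1)[where H = "\<lambda>a b \<omega>. real (M \<omega>) * detours a b \<omega>"])
    show "integrable \<Omega> (\<lambda>\<omega>. spans a b \<omega> * (real (M \<omega>) * detours a b \<omega>))" for a b
      using detours_integrable(2)[OF spans_M_integrable, of a b a b] by (simp add: mult.assoc)
  qed (simp add: detours_short, erule (2) expectation_spans_M_detours)
  also have "\<dots> = (\<Sum>m=2..<k. (real k - real m) * (real m - 1) * (real m - 2) * count_detour_mean m 3
      + (real k - real m) * (real m - 1) * count_detour_mean m 2
      + 2 * (real k - real m) * (real m - 1) * count_detour_mean m 1)"
    by (intro sum.cong) (auto simp: of_nat_diff algebra_simps)
  also have "\<dots> = (\<Sum>m=2..<k. (real k - real m) * (real m - 1) * (real m - 2) * count_detour_mean m 3)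
      + (\<Sum>m=2..<k. (real k - real m) * (real m - 1) * count_detour_mean m 2)
      + (\<Sum>m=2..<k. 2 * (real k - real m) * (real m - 1) * count_detour_mean m 1)"
    by (simp only: sum.distrib)
  also have "(\<Sum>m=2..<k. (real k - real m) * (real m - 1) * (real m - 2) * count_detour_mean m 3)
      = (\<Sum>m=3..<k. (real k - real m) * (real m - 1) * (real m - 2) * count_detour_mean m 3)"
    by (rule sum_drop_two) simp
  finally show ?thesis .
qed

section \<open>The total picking time\<close>

definition total_picking :: "'a \<Rightarrow> real" where
  "total_picking \<omega> = (\<Sum>j<M \<omega>. P j \<omega>)"

lemma P_product:
  "integrable \<Omega> (\<lambda>\<omega>. P i \<omega> * P j \<omega>)"
  "expectation (\<lambda>\<omega>. P i \<omega> * P j \<omega>)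
    = (expectation P\<^sub>0)\<^sup>2 + (if i = j then expectation (\<lambda>\<omega>. (P\<^sub>0 \<omega>)\<^sup>2) - (expectation P\<^sub>0)\<^sup>2 else 0)"
proof -
  have indep: "indep_var borel (P i) borel (P j)" if "i \<noteq> j"
  proof -
    have m: "(\<lambda>y. y (Picking i)) \<in> borel_measurable (PiM {Picking i} (\<lambda>_. borel :: real measure))" for i
      by (rule measurable_component_singleton) simp
    have "{Picking i} \<inter> {Picking j} = {}" using that by simp
    from indep_disjoint_sources[OF this m m] show ?thesis by simp
  qed
  show "integrable \<Omega> (\<lambda>\<omega>. P i \<omega> * P j \<omega>)"
    using indep_var_integrable[OF indep] P_moments(1,2) by (cases "i = j") (auto simp: power2_eq_square)
  show "expectation (\<lambda>\<omega>. P i \<omega> * P j \<omega>)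
    = (expectation P\<^sub>0)\<^sup>2 + (if i = j then expectation (\<lambda>\<omega>. (P\<^sub>0 \<omega>)\<^sup>2) - (expectation P\<^sub>0)\<^sup>2 else 0)"
    using indep_var_lebesgue_integral[OF indep] P_moments by (cases "i = j") (auto simp: power2_eq_square)
qed

lemma square_of_picking_sum:
  "integrable \<Omega> (\<lambda>\<omega>. (\<Sum>j<n. P j \<omega>)\<^sup>2)"
  "expectation (\<lambda>\<omega>. (\<Sum>j<n. P j \<omega>)\<^sup>2)
    = real n * (real n - 1) * (expectation P\<^sub>0)\<^sup>2 + real n * expectation (\<lambda>\<omega>. (P\<^sub>0 \<omega>)\<^sup>2)"
proof -
  have eq: "(\<Sum>j<n. P j \<omega>)\<^sup>2 = (\<Sum>i<n. \<Sum>j<n. P i \<omega> * P j \<omega>)" for \<omega>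
    by (simp only: power2_eq_square sum_product)
  show "integrable \<Omega> (\<lambda>\<omega>. (\<Sum>j<n. P j \<omega>)\<^sup>2)"
    unfolding eq by (intro Bochner_Integration.integrable_sum P_product)
  have "expectation (\<lambda>\<omega>. (\<Sum>j<n. P j \<omega>)\<^sup>2) = (\<Sum>i<n. \<Sum>j<n. expectation (\<lambda>\<omega>. P i \<omega> * P j \<omega>))"
    unfolding eq using P_product(1) by (simp add: Bochner_Integration.integral_sum)
  also have "\<dots> = (\<Sum>i<n. real n * (expectation P\<^sub>0)\<^sup>2 + (expectation (\<lambda>\<omega>. (P\<^sub>0 \<omega>)\<^sup>2) - (expectation P\<^sub>0)\<^sup>2))"
    unfolding P_product(2) by (intro sum.cong refl) (simp add: sum.distrib)
  finally show "expectation (\<lambda>\<omega>. (\<Sum>j<n. P j \<omega>)\<^sup>2)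
    = real n * (real n - 1) * (expectation P\<^sub>0)\<^sup>2 + real n * expectation (\<lambda>\<omega>. (P\<^sub>0 \<omega>)\<^sup>2)"
    by (simp add: algebra_simps)
qed

lemma length_picks: "length (picks \<omega>) = M \<omega>"
  by (simp add: picks_def)

lemma total_picking_measurable [measurable]: "total_picking \<in> borel_measurable \<Omega>"
  unfolding total_picking_def by measurable

text \<open>
  Computing the nonnegative integral by freezing the placement proves that the square is integrable.
\<close>

lemma total_picking_square:
  "integrable \<Omega> (\<lambda>\<omega>. (total_picking \<omega>)\<^sup>2)"
  "expectation (\<lambda>\<omega>. (total_picking \<omega>)\<^sup>2)
    = expectation (\<lambda>\<omega>. real (M \<omega>) * (real (M \<omega>) - 1)) * (expectation P\<^sub>0)\<^sup>2
      + expectation (\<lambda>\<omega>. real (M \<omega>)) * expectation (\<lambda>\<omega>. (P\<^sub>0 \<omega>)\<^sup>2)"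
proof -
  let ?h = "\<lambda>z (x :: nat \<Rightarrow> real) p. (\<Sum>j<length z. p j :: real)\<^sup>2"
  let ?g = "\<lambda>n. real n * (real n - 1) * (expectation P\<^sub>0)\<^sup>2 + real n * expectation (\<lambda>\<omega>. (P\<^sub>0 \<omega>)\<^sup>2)"
  have h: "(\<lambda>y. ?h z (\<lambda>j. y (Location j)) (\<lambda>j. y (Picking j))) \<in> borel_measurable (PiM item_sources (\<lambda>_. borel))" for z
    by (intro borel_measurable_power borel_measurable_sum measurable_locations)
  have MM: "integrable \<Omega> (\<lambda>\<omega>. real (M \<omega>) * (real (M \<omega>) - 1))"
    using M_square_integrable M_integrable by (simp add: right_diff_distrib power2_eq_square)
  then have g_int: "integrable \<Omega> (\<lambda>\<omega>. ?g (M \<omega>))" using M_integrable by simp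
  have g_nonneg: "0 \<le> ?g n" for n
    unfolding square_of_picking_sum(2)[symmetric] by (rule integral_nonneg_AE) simp
  have "(\<integral>\<^sup>+\<omega>. ennreal ((total_picking \<omega>)\<^sup>2) \<partial>\<Omega>) = (\<integral>\<^sup>+\<omega>. (\<integral>\<^sup>+\<omega>'. ennreal ((\<Sum>j<M \<omega>. P j \<omega>')\<^sup>2) \<partial>\<Omega>) \<partial>\<Omega>)"
    using freeze_items(1)[where h = ?h, OF h] by (simp add: length_picks total_picking_def)
  also have "\<dots> = (\<integral>\<^sup>+\<omega>. ennreal (?g (M \<omega>)) \<partial>\<Omega>)"
    using nn_integral_eq_integral[OF square_of_picking_sum(1)] by (simp add: square_of_picking_sum(2))
  also have "\<dots> < \<infinity>"
    using nn_integral_eq_integral[OF g_int] g_nonneg by simp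
  finally show int: "integrable \<Omega> (\<lambda>\<omega>. (total_picking \<omega>)\<^sup>2)"
    by (intro integrableI_nonneg) auto
  have "expectation (\<lambda>\<omega>. (total_picking \<omega>)\<^sup>2) = expectation (\<lambda>\<omega>. ?g (M \<omega>))"
    using freeze_items(2)[where h = ?h, OF h] int
    by (simp add: length_picks total_picking_def square_of_picking_sum(2))
  also have "\<dots> = expectation (\<lambda>\<omega>. real (M \<omega>) * (real (M \<omega>) - 1)) * (expectation P\<^sub>0)\<^sup>2
      + expectation (\<lambda>\<omega>. real (M \<omega>)) * expectation (\<lambda>\<omega>. (P\<^sub>0 \<omega>)\<^sup>2)"
    using MM M_integrable by simp
  finally show "expectation (\<lambda>\<omega>. (total_picking \<omega>)\<^sup>2) = \<dots>" .
qed

lemma total_picking_integrable: "integrable \<Omega> total_picking"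
  using total_picking_square(1) by (rule square_integrable_imp_integrable[rotated]) measurable

text \<open>
  Freeze the placement: each of the \<open>M\<close> picking times is independent of the locations and
  contributes its mean.  Freezing in the opposite direction reassembles \<open>M * h\<close>.
\<close>

lemma expectation_total_picking_mult:
  fixes h :: "nat list \<Rightarrow> (nat \<Rightarrow> real) \<Rightarrow> real"
  assumes meas: "\<And>z. (\<lambda>y. h z (\<lambda>j. y (Location j))) \<in> borel_measurable (PiM (range Location) (\<lambda>_. borel))"
    and bound: "\<And>z. AE \<omega> in \<Omega>. \<bar>h z (\<lambda>j. X j \<omega>)\<bar> \<le> C"
  shows "expectation (\<lambda>\<omega>. total_picking \<omega> * h (picks \<omega>) (\<lambda>j. X j \<omega>))
    = expectation P\<^sub>0 * expectation (\<lambda>\<omega>. real (M \<omega>) * h (picks \<omega>) (\<lambda>j. X j \<omega>))"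
    and "integrable \<Omega> (\<lambda>\<omega>. total_picking \<omega> * h (picks \<omega>) (\<lambda>j. X j \<omega>))"
proof -
  let ?L = "PiM (range Location) (\<lambda>_. borel :: real measure)"
  have meas': "(\<lambda>y. h z (\<lambda>j. y (Location j))) \<in> borel_measurable (PiM item_sources (\<lambda>_. borel))" for z
  proof -
    have "(\<lambda>y. restrict y (range Location)) \<in> measurable (PiM item_sources (\<lambda>_. borel)) ?L"
      by (rule measurable_restrict_subset) (simp add: item_sources_def)
    from measurable_compose[OF this meas[of z]] show ?thesis by simp
  qed
  have hX: "(\<lambda>\<omega>. h z (\<lambda>j. X j \<omega>)) \<in> borel_measurable \<Omega>" for z
  proof -
    have "restrict_src (range Location) \<in> measurable \<Omega> ?L"
      by (rule measurable_restrict) (rule source_measurable)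
    from measurable_compose[OF this meas[of z]] show ?thesis by simp
  qed
  have hZ[measurable]: "(\<lambda>\<omega>. h (picks \<omega>) (\<lambda>j. X j \<omega>)) \<in> borel_measurable \<Omega>"
    by (rule measurable_compose_countable[where f = "\<lambda>z \<omega>. h z (\<lambda>j. X j \<omega>)" and g = picks, OF hX picks_measurable])
  have "AE \<omega> in \<Omega>. \<forall>z. \<bar>h z (\<lambda>j. X j \<omega>)\<bar> \<le> C"
    using bound by (simp add: AE_all_countable)
  then have bZ: "AE \<omega> in \<Omega>. \<bar>h (picks \<omega>) (\<lambda>j. X j \<omega>)\<bar> \<le> C" by eventually_elim blast
  have h_int: "integrable \<Omega> (\<lambda>\<omega>. h z (\<lambda>j. X j \<omega>))" for z
    using hX bound by (intro integrable_const_bound[where B = C]) auto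
  show int: "integrable \<Omega> (\<lambda>\<omega>. total_picking \<omega> * h (picks \<omega>) (\<lambda>j. X j \<omega>))"
    by (rule integrable_mult_bounded_by[OF total_picking_integrable hZ bZ])
  have inner: "integrable \<Omega> (\<lambda>\<omega>. P j \<omega> * h z (\<lambda>j. X j \<omega>))"
    "expectation (\<lambda>\<omega>. P j \<omega> * h z (\<lambda>j. X j \<omega>)) = expectation P\<^sub>0 * expectation (\<lambda>\<omega>. h z (\<lambda>j. X j \<omega>))" for j z
  proof -
    have "(\<lambda>y. y (Picking j)) \<in> borel_measurable (PiM {Picking j} (\<lambda>_. borel :: real measure))"
      by (rule measurable_component_singleton) simp
    moreover have "{Picking j} \<inter> range Location = {}" by auto
    ultimately have ind: "indep_var borel (P j) borel (\<lambda>\<omega>. h z (\<lambda>j. X j \<omega>))"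
      using indep_disjoint_sources[of "{Picking j}" "range Location" "\<lambda>y. y (Picking j)" borel _ borel] meas[of z] by fastforce
    show "integrable \<Omega> (\<lambda>\<omega>. P j \<omega> * h z (\<lambda>j. X j \<omega>))"
      by (rule indep_var_integrable[OF ind P_moments(1) h_int])
    show "expectation (\<lambda>\<omega>. P j \<omega> * h z (\<lambda>j. X j \<omega>)) = expectation P\<^sub>0 * expectation (\<lambda>\<omega>. h z (\<lambda>j. X j \<omega>))"
      using indep_var_lebesgue_integral[OF ind P_moments(1) h_int] P_moments(3) by simp
  qed
  let ?h1 = "\<lambda>z x p. (\<Sum>j<length z. p j) * h z x"
  let ?h2 = "\<lambda>z x (p :: nat \<Rightarrow> real). real (length z) * h z x"
  have m1: "(\<lambda>y. ?h1 z (\<lambda>j. y (Location j)) (\<lambda>j. y (Picking j))) \<in> borel_measurable (PiM item_sources (\<lambda>_. borel))"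
    and m2: "(\<lambda>y. ?h2 z (\<lambda>j. y (Location j)) (\<lambda>j. y (Picking j))) \<in> borel_measurable (PiM item_sources (\<lambda>_. borel))" for z
    using meas'[of z] by (auto intro!: borel_measurable_times borel_measurable_sum measurable_locations)
  have "expectation (\<lambda>\<omega>. total_picking \<omega> * h (picks \<omega>) (\<lambda>j. X j \<omega>))
      = expectation (\<lambda>\<omega>. expectation (\<lambda>\<omega>'. (\<Sum>j<M \<omega>. P j \<omega>') * h (picks \<omega>) (\<lambda>j. X j \<omega>')))"
    using freeze_items(2)[where h = ?h1, OF m1] int by (simp add: length_picks total_picking_def)
  also have "\<dots> = expectation (\<lambda>\<omega>. expectation P\<^sub>0 * (real (M \<omega>) * expectation (\<lambda>\<omega>'. h (picks \<omega>) (\<lambda>j. X j \<omega>'))))"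
    using inner by (simp add: sum_distrib_right Bochner_Integration.integral_sum mult_ac)
  also have "\<dots> = expectation P\<^sub>0 * expectation (\<lambda>\<omega>. expectation (\<lambda>\<omega>'. real (M \<omega>) * h (picks \<omega>) (\<lambda>j. X j \<omega>')))"
    by simp
  also have "expectation (\<lambda>\<omega>. expectation (\<lambda>\<omega>'. real (M \<omega>) * h (picks \<omega>) (\<lambda>j. X j \<omega>')))
      = expectation (\<lambda>\<omega>. real (M \<omega>) * h (picks \<omega>) (\<lambda>j. X j \<omega>))"
    using freeze_items(2)[where h = ?h2, OF m2] integrable_mult_bounded_by[OF M_integrable hZ bZ]
    by (simp add: length_picks)
  finally show "expectation (\<lambda>\<omega>. total_picking \<omega> * h (picks \<omega>) (\<lambda>j. X j \<omega>))
    = expectation P\<^sub>0 * expectation (\<lambda>\<omega>. real (M \<omega>) * h (picks \<omega>) (\<lambda>j. X j \<omega>))" .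
qed

text \<open>
  The time spent walking, for the coefficients \<open>s = t = 2 l / v\<close> and \<open>u = 2 w\<^sub>a / v\<close>.
\<close>

definition walking :: "real \<Rightarrow> real \<Rightarrow> real \<Rightarrow> 'a \<Rightarrow> real" where
  "walking s t u \<omega> = s * total_detour \<omega> + t + u * (real (last_idx \<omega>) - 1)"

lemma expectation_total_picking_walking:
  "expectation (\<lambda>\<omega>. total_picking \<omega> * walking s t u \<omega>) = expectation P\<^sub>0 * expectation (\<lambda>\<omega>. real (M \<omega>) * walking s t u \<omega>)"
  "integrable \<Omega> (\<lambda>\<omega>. total_picking \<omega> * walking s t u \<omega>)"
proof -
  let ?f = "first_aisle k length (\<lambda>j z. z ! j)" and ?l = "last_aisle k length (\<lambda>j z. z ! j)"
  define h where "h z x = s * (\<Sum>i=?f z + 1..<?l z. 1 - longest_gap (map x (items_in i z))) + t + u * (real (?l z) - 1)"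
    for z and x :: "nat \<Rightarrow> real"
  have eq: "h (picks \<omega>) (\<lambda>j. X j \<omega>) = walking s t u \<omega>" for \<omega>
    by (simp add: h_def walking_def total_detour_def detours_def detour_def largest_gap_eq aisles_of_picks[symmetric])
  have "(\<lambda>y. longest_gap (map (\<lambda>j. y (Location j)) js)) \<in> borel_measurable (PiM (range Location) (\<lambda>_. borel :: real measure))" for js
    by (rule longest_gap_measurable, rule measurable_component_singleton) simp
  then have meas: "(\<lambda>y. h z (\<lambda>j. y (Location j))) \<in> borel_measurable (PiM (range Location) (\<lambda>_. borel))" for z
    unfolding h_def by (intro borel_measurable_add borel_measurable_times borel_measurable_sum borel_measurable_diff) auto
  have bound: "AE \<omega> in \<Omega>. \<bar>h z (\<lambda>j. X j \<omega>)\<bar> \<le> \<bar>s\<bar> * real k + \<bar>t\<bar> + \<bar>u\<bar> * (real k + 1)" for z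
    using AE_longest_gap_X
  proof eventually_elim
    case (elim \<omega>)
    have l: "?l z \<le> k" by (rule last_aisle_le)
    have "\<bar>\<Sum>i=?f z + 1..<?l z. 1 - longest_gap (map (\<lambda>j. X j \<omega>) (items_in i z))\<bar> \<le> (\<Sum>i=?f z + 1..<?l z. 1)"
      using elim by (intro order_trans[OF sum_abs] sum_mono) (auto simp: abs_le_iff intro: order_trans)
    also have "\<dots> \<le> real k" using l by simp
    finally have 1: "\<bar>s * (\<Sum>i=?f z + 1..<?l z. 1 - longest_gap (map (\<lambda>j. X j \<omega>) (items_in i z)))\<bar> \<le> \<bar>s\<bar> * real k"
      unfolding abs_mult by (intro mult_left_mono) auto
    have 2: "\<bar>u * (real (?l z) - 1)\<bar> \<le> \<bar>u\<bar> * (real k + 1)"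
      unfolding abs_mult using l by (intro mult_left_mono) auto
    show ?case unfolding h_def using 1 2 by linarith
  qed
  show "expectation (\<lambda>\<omega>. total_picking \<omega> * walking s t u \<omega>) = expectation P\<^sub>0 * expectation (\<lambda>\<omega>. real (M \<omega>) * walking s t u \<omega>)"
    "integrable \<Omega> (\<lambda>\<omega>. total_picking \<omega> * walking s t u \<omega>)"
    using expectation_total_picking_mult[of h, OF meas bound] unfolding eq by blast+
qed

lemma last_aisle_integrable:
  assumes "integrable \<Omega> F"
  shows "integrable \<Omega> (\<lambda>\<omega>. F \<omega> * real (last_idx \<omega>))"
  by (rule integrable_mult_bounded_by[OF assms, where C = "real k"]) (auto simp: last_aisle_le)

lemma total_detour_integrable:
  assumes "integrable \<Omega> F"
  shows "integrable \<Omega> (\<lambda>\<omega>. F \<omega> * total_detour \<omega>)"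
proof (rule integrable_mult_bounded_by[OF assms])
  have "integrable \<Omega> total_detour"
    unfolding total_detour_def[abs_def]
    by (rule expectation_span_decomposition(2)[where H = detours])
       (auto intro: detours_short detours_integrable spans_integrable)
  then show "total_detour \<in> borel_measurable \<Omega>" by (rule borel_measurable_integrable)
  show "AE \<omega> in \<Omega>. \<bar>total_detour \<omega>\<bar> \<le> real k"
    using AE_detours
  proof eventually_elim
    case (elim \<omega>)
    then have "\<bar>total_detour \<omega>\<bar> \<le> real (last_idx \<omega>)" by (simp add: total_detour_def)
    then show ?case using last_aisle_le[of k M A \<omega>] by linarith
  qed
qed

lemma expectation_walking:
  "integrable \<Omega> (walking s t u)" "integrable \<Omega> (\<lambda>\<omega>. (walking s t u \<omega>)\<^sup>2)"
  "expectation (walking s t u) = s * expectation total_detour + t + u * (expectation (\<lambda>\<omega>. real (last_idx \<omega>)) - 1)" (is ?mean)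
  "expectation (\<lambda>\<omega>. real (M \<omega>) * walking s t u \<omega>) = s * expectation (\<lambda>\<omega>. real (M \<omega>) * total_detour \<omega>)
    + t * expectation (\<lambda>\<omega>. real (M \<omega>))
    + u * (expectation (\<lambda>\<omega>. real (M \<omega>) * real (last_idx \<omega>)) - expectation (\<lambda>\<omega>. real (M \<omega>)))" (is ?mixed)
  "expectation (\<lambda>\<omega>. (walking s t u \<omega>)\<^sup>2) = s\<^sup>2 * expectation (\<lambda>\<omega>. (total_detour \<omega>)\<^sup>2) + t\<^sup>2
    + u\<^sup>2 * (expectation (\<lambda>\<omega>. (real (last_idx \<omega>))\<^sup>2) - 2 * expectation (\<lambda>\<omega>. real (last_idx \<omega>)) + 1)
    + 2 * s * t * expectation total_detour + 2 * t * u * (expectation (\<lambda>\<omega>. real (last_idx \<omega>)) - 1)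
    + 2 * s * u * (expectation (\<lambda>\<omega>. real (last_idx \<omega>) * total_detour \<omega>) - expectation total_detour)" (is ?square)
proof -
  have S: "integrable \<Omega> total_detour" and K: "integrable \<Omega> (\<lambda>\<omega>. real (last_idx \<omega>))"
    using total_detour_integrable[of "\<lambda>_. 1"] last_aisle_integrable[of "\<lambda>_. 1"] by simp_all
  have SS: "integrable \<Omega> (\<lambda>\<omega>. (total_detour \<omega>)\<^sup>2)" and KK: "integrable \<Omega> (\<lambda>\<omega>. (real (last_idx \<omega>))\<^sup>2)"
    and KS: "integrable \<Omega> (\<lambda>\<omega>. real (last_idx \<omega>) * total_detour \<omega>)"
    using total_detour_integrable[OF S] last_aisle_integrable[OF K] total_detour_integrable[OF K]
    by (simp_all add: power2_eq_square)
  note MS = total_detour_integrable[OF M_integrable] and MK = last_aisle_integrable[OF M_integrable]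
  show "integrable \<Omega> (walking s t u)"
    unfolding walking_def[abs_def] using S K by simp
  show ?mean
    unfolding walking_def[abs_def] using S K by (simp add: prob_space)
  have "real (M \<omega>) * walking s t u \<omega> = s * (real (M \<omega>) * total_detour \<omega>) + t * real (M \<omega>)
      + u * (real (M \<omega>) * real (last_idx \<omega>) - real (M \<omega>))" for \<omega>
    by (simp add: walking_def algebra_simps)
  then show ?mixed
    using MS MK M_integrable by simp
  have sq: "(walking s t u \<omega>)\<^sup>2 = s\<^sup>2 * (total_detour \<omega>)\<^sup>2 + t\<^sup>2
      + u\<^sup>2 * ((real (last_idx \<omega>))\<^sup>2 - 2 * real (last_idx \<omega>) + 1)
      + 2 * s * t * total_detour \<omega> + 2 * t * u * (real (last_idx \<omega>) - 1)
      + 2 * s * u * (real (last_idx \<omega>) * total_detour \<omega> - total_detour \<omega>)" for \<omega>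
    by (simp add: walking_def power2_eq_square algebra_simps)
  show "integrable \<Omega> (\<lambda>\<omega>. (walking s t u \<omega>)\<^sup>2)"
    unfolding sq using S K SS KK KS by simp
  show ?square
    unfolding sq using S K SS KK KS by (simp add: prob_space)
qed

lemma expectation_total_time:
  "integrable \<Omega> (\<lambda>\<omega>. total_picking \<omega> + walking s t u \<omega>)"
  "integrable \<Omega> (\<lambda>\<omega>. (total_picking \<omega> + walking s t u \<omega>)\<^sup>2)"
  "expectation (\<lambda>\<omega>. total_picking \<omega> + walking s t u \<omega>)
    = expectation (\<lambda>\<omega>. real (M \<omega>)) * expectation P\<^sub>0 + expectation (walking s t u)"
  "expectation (\<lambda>\<omega>. (total_picking \<omega> + walking s t u \<omega>)\<^sup>2)
    = expectation (\<lambda>\<omega>. (total_picking \<omega>)\<^sup>2)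
      + 2 * (expectation P\<^sub>0 * expectation (\<lambda>\<omega>. real (M \<omega>) * walking s t u \<omega>))
      + expectation (\<lambda>\<omega>. (walking s t u \<omega>)\<^sup>2)"
proof -
  show "integrable \<Omega> (\<lambda>\<omega>. total_picking \<omega> + walking s t u \<omega>)"
    using total_picking_integrable expectation_walking(1) by simp
  have "expectation total_picking = expectation (\<lambda>\<omega>. real (M \<omega>)) * expectation P\<^sub>0"
    using expectation_total_picking_walking(1)[of 0 1 0] by (simp add: walking_def)
  then show "expectation (\<lambda>\<omega>. total_picking \<omega> + walking s t u \<omega>)
    = expectation (\<lambda>\<omega>. real (M \<omega>)) * expectation P\<^sub>0 + expectation (walking s t u)"
    using total_picking_integrable expectation_walking(1) by simp
  have sq: "(total_picking \<omega> + walking s t u \<omega>)\<^sup>2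
      = (total_picking \<omega>)\<^sup>2 + 2 * (total_picking \<omega> * walking s t u \<omega>) + (walking s t u \<omega>)\<^sup>2" for \<omega>
    by (simp add: power2_sum)
  show "integrable \<Omega> (\<lambda>\<omega>. (total_picking \<omega> + walking s t u \<omega>)\<^sup>2)"
    unfolding sq using total_picking_square(1) expectation_total_picking_walking(2) expectation_walking(2) by simp
  show "expectation (\<lambda>\<omega>. (total_picking \<omega> + walking s t u \<omega>)\<^sup>2)
    = expectation (\<lambda>\<omega>. (total_picking \<omega>)\<^sup>2)
      + 2 * (expectation P\<^sub>0 * expectation (\<lambda>\<omega>. real (M \<omega>) * walking s t u \<omega>))
      + expectation (\<lambda>\<omega>. (walking s t u \<omega>)\<^sup>2)"
    unfolding sq using total_picking_square(1) expectation_total_picking_walking expectation_walking(2) by simp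
qed

lemma detour_closed_forms:
  assumes "m \<in> {2..<k}"
  shows "detour_mean m = inner_pgf m 1 + (LBINT x:{0..1}. inner_pgf m x * ln (1 - x))"
    and "detour_square_mean m = inner_pgf m 1 + 2 * (LBINT x:{0..1}. inner_pgf m x * ln (1 - x))
        + (LBINT x:{0..1}. x * inner_pgf m x * (LBINT y:{x..1}. (ln (1 - y))\<^sup>2 / y\<^sup>2))"
    and "count_detour_mean m 2 = unit_deriv (inner_pgf m) 1 - (LBINT x:{0..1}. ln (1 - x) * inner_pgf m x)
        - (LBINT x:{0..1}. (inner_pgf m 1 - x * inner_pgf m x) / (1 - x))"
    and "count_detour_mean m 1 = unit_deriv (\<lambda>x. expectation (\<lambda>\<omega>. spans 1 (m + 1) \<omega> * x ^ item_count M A 1 \<omega>)) 1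
        - (LBINT x:{0..1}. (expectation (spans 1 (m + 1)) - expectation (\<lambda>\<omega>. spans 1 (m + 1) \<omega> * x ^ item_count M A 1 \<omega>)) / (1 - x))"
proof -
  have am: "1 \<le> (1 :: nat)" "1 < m + 1" "m + 1 \<le> k" "m + 1 = 1 + m" "1 < (2 :: nat)" "2 < m + 1"
    using assms by auto
  show "detour_mean m = inner_pgf m 1 + (LBINT x:{0..1}. inner_pgf m x * ln (1 - x))"
    unfolding detour_mean_def detour_def by (rule expectation_complement_gap_spans[OF am])
  show "detour_square_mean m = inner_pgf m 1 + 2 * (LBINT x:{0..1}. inner_pgf m x * ln (1 - x))
        + (LBINT x:{0..1}. x * inner_pgf m x * (LBINT y:{x..1}. (ln (1 - y))\<^sup>2 / y\<^sup>2))"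
    unfolding detour_square_mean_def detour_def by (rule expectation_complement_gap_squared_spans[OF am])
  have "2 \<in> {1..m + 1}" "1 \<in> {1..m + 1}" using assms by auto
  note C = expectation_count_complement_gap_spans[OF am this(1)] expectation_count_complement_gap_spans[OF am this(2)]
  show "count_detour_mean m 2 = unit_deriv (inner_pgf m) 1 - (LBINT x:{0..1}. ln (1 - x) * inner_pgf m x)
        - (LBINT x:{0..1}. (inner_pgf m 1 - x * inner_pgf m x) / (1 - x))"
    unfolding count_detour_mean_def detour_def C(1) unit_deriv_inner_pgf[OF am]
      set_integral_inner_slope_same_aisle[OF am] using assms by simp
  show "count_detour_mean m 1 = unit_deriv (\<lambda>x. expectation (\<lambda>\<omega>. spans 1 (m + 1) \<omega> * x ^ item_count M A 1 \<omega>)) 1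
        - (LBINT x:{0..1}. (expectation (spans 1 (m + 1)) - expectation (\<lambda>\<omega>. spans 1 (m + 1) \<omega> * x ^ item_count M A 1 \<omega>)) / (1 - x))"
    unfolding count_detour_mean_def detour_def C(2) unit_deriv_outer_pgf[OF am]
      set_integral_outer_slope[OF am] by simp
qed

lemma detour_pair_closed_forms:
  assumes "m \<in> {3..<k}"
  shows "detour_product_mean m = inner_pgf m 1 + 2 * (LBINT x:{0..1}. inner_pgf m x * ln (1 - x))
        + (LBINT x:{0..1}. LBINT y:{0..1}. ln (1 - x) * ln (1 - y) * inner_pgf2 m x y)"
    and "count_detour_mean m 3 = unit_deriv (inner_pgf m) 1 - (LBINT x:{0..1}. (inner_pgf m 1 - inner_pgf m x) / (1 - x))"
proof -
  have am: "1 \<le> (1 :: nat)" "1 < m + 1" "m + 1 \<le> k" "m + 1 = 1 + m" "1 < (2 :: nat)" "2 < m + 1"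
    using assms by auto
  show "detour_product_mean m = inner_pgf m 1 + 2 * (LBINT x:{0..1}. inner_pgf m x * ln (1 - x))
        + (LBINT x:{0..1}. LBINT y:{0..1}. ln (1 - x) * ln (1 - y) * inner_pgf2 m x y)"
    unfolding detour_product_mean_def detour_def
    by (rule expectation_complement_gap_product_spans[OF am]) (use assms in auto)
  have "3 \<in> {1..m + 1}" using assms by auto
  from expectation_count_complement_gap_spans[OF am this]
  show "count_detour_mean m 3 = unit_deriv (inner_pgf m) 1 - (LBINT x:{0..1}. (inner_pgf m 1 - inner_pgf m x) / (1 - x))"
    unfolding count_detour_mean_def detour_def unit_deriv_inner_pgf[OF am] set_integral_inner_slope[OF am, symmetric]
    using assms by simp
qed

text \<open>
  Translates the event as it is written in the theorem into \<open>spans\<close>.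
\<close>

lemma expectation_indicator_spans:
  "expectation (\<lambda>\<omega>. f \<omega> * indicator {\<omega> \<in> space \<Omega>. last_idx \<omega> = m + 1 \<and> first_idx \<omega> = 1} \<omega>)
    = expectation (\<lambda>\<omega>. spans 1 (m + 1) \<omega> * f \<omega>)"
  by (intro Bochner_Integration.integral_cong) (auto simp: spans_def indicator_def)

end

theorem theorem5p6:
  fixes \<Omega> :: "'a measure"
    and k :: nat and l w\<^sub>a v :: real
    and M :: "'a \<Rightarrow> nat" and A :: "nat \<Rightarrow> 'a \<Rightarrow> nat" and X :: "nat \<Rightarrow> 'a \<Rightarrow> real"
    and P :: "nat \<Rightarrow> 'a \<Rightarrow> real" and P\<^sub>0 :: "'a \<Rightarrow> real"
  assumes "prob_space \<Omega>"
    and "k \<ge> 1" and "l > 0" and "w\<^sub>a > 0" and "v > 0"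
    and "M \<in> measurable \<Omega> (count_space UNIV)"
    and "integrable \<Omega> (\<lambda>\<omega>. (real (M \<omega>))\<^sup>2)"
    and "\<And>j. distr \<Omega> (count_space UNIV) (A j) = measure_pmf (pmf_of_set {1..k})"
    and "\<And>j. distr \<Omega> lborel (X j) = uniform_measure lborel {0..1}"
    and "P\<^sub>0 \<in> borel_measurable \<Omega>"
    and "AE \<omega> in \<Omega>. 0 \<le> P\<^sub>0 \<omega>"
    and "integrable \<Omega> (\<lambda>\<omega>. (P\<^sub>0 \<omega>)\<^sup>2)"
    and "\<And>j. distr \<Omega> borel (P j) = distr \<Omega> borel P\<^sub>0"
    and "prob_space.indep_vars \<Omega> (\<lambda>_. borel) (source_var M A X P) UNIV"
  defines "E \<equiv> \<lambda>f. \<integral>\<omega>. f \<omega> \<partial>\<Omega>"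
    and "P\<^sub>M \<equiv> pgf \<Omega> M"
    and "N \<equiv> item_count M A"
    and "kp \<equiv> last_aisle k M A"
    and "km \<equiv> first_aisle k M A"
    and "D \<equiv> largest_gap M A X"
  defines "S \<equiv> \<lambda>\<omega>. \<Sum>i = km \<omega> + 1..<kp \<omega>. 1 - D i \<omega>"
  defines "T \<equiv> \<lambda>\<omega>. (\<Sum>j<M \<omega>. P j \<omega>)
      + 2 * l / v * (\<Sum>i = km \<omega> + 1..<kp \<omega>. 1 - D i \<omega>)
      + 2 * l / v + 2 / v * w\<^sub>a * (real (kp \<omega>) - 1)"
    and "Q \<equiv> \<lambda>(m::nat) x. P\<^sub>M ((real m + x) / real k)
      - 2 * P\<^sub>M ((real m - 1 + x) / real k) + P\<^sub>M ((real m - 2 + x) / real k)"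
    and "R \<equiv> \<lambda>(m::nat) x y. P\<^sub>M ((real m - 1 + x + y) / real k)
      - 2 * P\<^sub>M ((real m - 2 + x + y) / real k) + P\<^sub>M ((real m - 3 + x + y) / real k)"
    and "Em \<equiv> \<lambda>m. {\<omega> \<in> space \<Omega>. kp \<omega> = m + 1 \<and> km \<omega> = 1}"
  defines "U \<equiv> \<lambda>m x. E (\<lambda>\<omega>. x ^ N 1 \<omega> * indicator (Em m) \<omega>)"
    and "\<alpha> \<equiv> \<lambda>m. E (\<lambda>\<omega>. (1 - D 2 \<omega>) * indicator (Em m) \<omega>)"
    and "\<beta> \<equiv> \<lambda>m. E (\<lambda>\<omega>. (1 - D 2 \<omega>)\<^sup>2 * indicator (Em m) \<omega>)"
    and "\<gamma> \<equiv> \<lambda>m. E (\<lambda>\<omega>. (1 - D 2 \<omega>) * (1 - D 3 \<omega>) * indicator (Em m) \<omega>)"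
    and "\<delta> \<equiv> \<lambda>m. E (\<lambda>\<omega>. real (N 3 \<omega>) * (1 - D 2 \<omega>) * indicator (Em m) \<omega>)"
    and "\<epsilon> \<equiv> \<lambda>m. E (\<lambda>\<omega>. real (N 2 \<omega>) * (1 - D 2 \<omega>) * indicator (Em m) \<omega>)"
    and "\<zeta> \<equiv> \<lambda>m. E (\<lambda>\<omega>. real (N 1 \<omega>) * (1 - D 2 \<omega>) * indicator (Em m) \<omega>)"
  shows
    "integrable \<Omega> T \<and> integrable \<Omega> (\<lambda>\<omega>. (T \<omega>)\<^sup>2)
    \<and> E T = E (\<lambda>\<omega>. real (M \<omega>)) * E P\<^sub>0 + 2 * l / v * E S
        + 2 * w\<^sub>a / v * (E (\<lambda>\<omega>. real (kp \<omega>)) - 1) + 2 * l / v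
    \<and> E (\<lambda>\<omega>. (T \<omega>)\<^sup>2)
      = E (\<lambda>\<omega>. real (M \<omega>) * (real (M \<omega>) - 1)) * (E P\<^sub>0)\<^sup>2
        + E (\<lambda>\<omega>. real (M \<omega>)) * E (\<lambda>\<omega>. (P\<^sub>0 \<omega>)\<^sup>2)
        + 4 * l\<^sup>2 / v\<^sup>2 * E (\<lambda>\<omega>. (S \<omega>)\<^sup>2)
        + 4 * w\<^sub>a\<^sup>2 / v\<^sup>2 * (E (\<lambda>\<omega>. (real (kp \<omega>))\<^sup>2) - 2 * E (\<lambda>\<omega>. real (kp \<omega>)) + 1)
        + 4 * l\<^sup>2 / v\<^sup>2
        + 4 * l / v * E P\<^sub>0 * E (\<lambda>\<omega>. real (M \<omega>) * S \<omega>)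
        + 4 * w\<^sub>a / v * E P\<^sub>0 * (E (\<lambda>\<omega>. real (M \<omega>) * real (kp \<omega>)) - E (\<lambda>\<omega>. real (M \<omega>)))
        + 8 * l * w\<^sub>a / v\<^sup>2 * (E (\<lambda>\<omega>. real (kp \<omega>) * S \<omega>) - E S)
        + 4 * l / v * (E T - 2 * l / v)
    \<and> E (\<lambda>\<omega>. real (kp \<omega>)) = real k - (\<Sum>r<k. P\<^sub>M (real r / real k))
    \<and> E (\<lambda>\<omega>. (real (kp \<omega>))\<^sup>2) = (real k)\<^sup>2 - (\<Sum>r<k. (2 * real r + 1) * P\<^sub>M (real r / real k))
    \<and> E (\<lambda>\<omega>. real (M \<omega>) * real (kp \<omega>)) = real k * E (\<lambda>\<omega>. real (M \<omega>))
        - (\<Sum>r<k. real r / real k * unit_deriv P\<^sub>M (real r / real k))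
    \<and> E S = (\<Sum>m = 2..<k. (real m - 1) * (real k - real m) * \<alpha> m)
    \<and> E (\<lambda>\<omega>. real (kp \<omega>) * S \<omega>)
      = (\<Sum>m = 2..<k. 1 / 2 * (real k - real m) * (real k + real m + 1) * (real m - 1) * \<alpha> m)
    \<and> E (\<lambda>\<omega>. (S \<omega>)\<^sup>2)
      = (\<Sum>m = 2..<k. (real m - 1) * (real k - real m) * \<beta> m)
        + (\<Sum>m = 3..<k. (real m - 1) * (real m - 2) * (real k - real m) * \<gamma> m)
    \<and> E (\<lambda>\<omega>. real (M \<omega>) * S \<omega>)
      = (\<Sum>m = 3..<k. (real k - real m) * (real m - 1) * (real m - 2) * \<delta> m)
        + (\<Sum>m = 2..<k. (real k - real m) * (real m - 1) * \<epsilon> m)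
        + (\<Sum>m = 2..<k. 2 * (real k - real m) * (real m - 1) * \<zeta> m)
    \<and> (\<forall>m\<in>{2..<k}.
        \<alpha> m = Q m 1 + (LBINT x:{0..1}. Q m x * ln (1 - x))
      \<and> \<beta> m = Q m 1 + 2 * (LBINT x:{0..1}. Q m x * ln (1 - x))
          + (LBINT x:{0..1}. x * Q m x * (LBINT y:{x..1}. (ln (1 - y))\<^sup>2 / y\<^sup>2))
      \<and> \<epsilon> m = unit_deriv (Q m) 1 - (LBINT x:{0..1}. ln (1 - x) * Q m x)
          - (LBINT x:{0..1}. (Q m 1 - x * Q m x) / (1 - x))
      \<and> \<zeta> m = unit_deriv (U m) 1 - (LBINT x:{0..1}. (U m 1 - U m x) / (1 - x)))
    \<and> (\<forall>m\<in>{3..<k}.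
        \<gamma> m = Q m 1 + 2 * (LBINT x:{0..1}. Q m x * ln (1 - x))
          + (LBINT x:{0..1}. LBINT y:{0..1}. ln (1 - x) * ln (1 - y) * R m x y)
      \<and> \<delta> m = unit_deriv (Q m) 1 - (LBINT x:{0..1}. (Q m 1 - Q m x) / (1 - x)))"
proof -
  interpret picking_order \<Omega> k M A X P P\<^sub>0
    by (intro picking_order.intro picking_order_axioms.intro assms(1,2,6,7,8,9,10,12,13,14))
  have E: "E = integral\<^sup>L \<Omega>" by (simp add: E_def)
  have S: "S = total_detour"
    by (simp add: fun_eq_iff S_def total_detour_def detours_def detour_def km_def kp_def D_def)
  have T: "T = (\<lambda>\<omega>. total_picking \<omega> + walking (2 * l / v) (2 * l / v) (2 / v * w\<^sub>a) \<omega>)"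
    by (simp add: fun_eq_iff T_def total_picking_def walking_def total_detour_def detours_def detour_def
        km_def kp_def D_def)
  have Q: "Q = inner_pgf" by (simp add: fun_eq_iff Q_def P\<^sub>M_def inner_pgf_def)
  have R: "R = inner_pgf2" by (simp add: fun_eq_iff R_def P\<^sub>M_def inner_pgf2_def)
  have Em: "expectation (\<lambda>\<omega>. f \<omega> * indicator (Em m) \<omega>) = expectation (\<lambda>\<omega>. spans 1 (m + 1) \<omega> * f \<omega>)" for f m
    unfolding Em_def kp_def km_def by (rule expectation_indicator_spans)
  have U: "U m x = expectation (\<lambda>\<omega>. spans 1 (m + 1) \<omega> * x ^ item_count M A 1 \<omega>)" for m x
    unfolding U_def E Em N_def ..
  have U1: "U m 1 = expectation (spans 1 (m + 1))" for m unfolding U by simp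
  have greek: "\<alpha> = detour_mean" "\<beta> = detour_square_mean" "\<gamma> = detour_product_mean"
    "\<delta> m = count_detour_mean m 3" "\<epsilon> m = count_detour_mean m 2" "\<zeta> m = count_detour_mean m 1" for m
    unfolding fun_eq_iff \<alpha>_def \<beta>_def \<gamma>_def \<delta>_def \<epsilon>_def \<zeta>_def E Em N_def D_def
      detour_mean_def detour_square_mean_def detour_product_mean_def count_detour_mean_def detour_def
    by (simp_all add: mult.assoc)
  let ?W = "walking (2 * l / v) (2 * l / v) (2 / v * w\<^sub>a)"
  have ET: "E T = E (\<lambda>\<omega>. real (M \<omega>)) * E P\<^sub>0 + 2 * l / v * E S
      + 2 * w\<^sub>a / v * (E (\<lambda>\<omega>. real (kp \<omega>)) - 1) + 2 * l / v"
    unfolding E T S kp_def expectation_total_time(3) expectation_walking(3) by simp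
  have ET2: "E (\<lambda>\<omega>. (T \<omega>)\<^sup>2)
      = E (\<lambda>\<omega>. real (M \<omega>) * (real (M \<omega>) - 1)) * (E P\<^sub>0)\<^sup>2
        + E (\<lambda>\<omega>. real (M \<omega>)) * E (\<lambda>\<omega>. (P\<^sub>0 \<omega>)\<^sup>2)
        + 4 * l\<^sup>2 / v\<^sup>2 * E (\<lambda>\<omega>. (S \<omega>)\<^sup>2)
        + 4 * w\<^sub>a\<^sup>2 / v\<^sup>2 * (E (\<lambda>\<omega>. (real (kp \<omega>))\<^sup>2) - 2 * E (\<lambda>\<omega>. real (kp \<omega>)) + 1)
        + 4 * l\<^sup>2 / v\<^sup>2
        + 4 * l / v * E P\<^sub>0 * E (\<lambda>\<omega>. real (M \<omega>) * S \<omega>)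
        + 4 * w\<^sub>a / v * E P\<^sub>0 * (E (\<lambda>\<omega>. real (M \<omega>) * real (kp \<omega>)) - E (\<lambda>\<omega>. real (M \<omega>)))
        + 8 * l * w\<^sub>a / v\<^sup>2 * (E (\<lambda>\<omega>. real (kp \<omega>) * S \<omega>) - E S)
        + 4 * l / v * (E T - 2 * l / v)"
  proof -
    \<comment> \<open>In terms of \<open>l / v\<close> and \<open>w\<^sub>a / v\<close> the claim is a polynomial identity.\<close>
    define c d where "c = l / v" and "d = w\<^sub>a / v"
    have coefficients: "2 * l / v = 2 * c" "2 / v * w\<^sub>a = 2 * d" "4 * l\<^sup>2 / v\<^sup>2 = 4 * c\<^sup>2"
      "4 * w\<^sub>a\<^sup>2 / v\<^sup>2 = 4 * d\<^sup>2" "4 * l / v = 4 * c" "4 * w\<^sub>a / v = 4 * d"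
      "8 * l * w\<^sub>a / v\<^sup>2 = 8 * (c * d)" "2 * w\<^sub>a / v = 2 * d"
      by (simp_all add: c_def d_def power_divide power2_eq_square)
    have sq: "E (\<lambda>\<omega>. (T \<omega>)\<^sup>2) = E (\<lambda>\<omega>. real (M \<omega>) * (real (M \<omega>) - 1)) * (E P\<^sub>0)\<^sup>2
        + E (\<lambda>\<omega>. real (M \<omega>)) * E (\<lambda>\<omega>. (P\<^sub>0 \<omega>)\<^sup>2)
        + 2 * (E P\<^sub>0 * (2 * c * E (\<lambda>\<omega>. real (M \<omega>) * S \<omega>) + 2 * c * E (\<lambda>\<omega>. real (M \<omega>))
            + 2 * d * (E (\<lambda>\<omega>. real (M \<omega>) * real (kp \<omega>)) - E (\<lambda>\<omega>. real (M \<omega>)))))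
        + ((2 * c)\<^sup>2 * E (\<lambda>\<omega>. (S \<omega>)\<^sup>2) + (2 * c)\<^sup>2
          + (2 * d)\<^sup>2 * (E (\<lambda>\<omega>. (real (kp \<omega>))\<^sup>2) - 2 * E (\<lambda>\<omega>. real (kp \<omega>)) + 1)
          + 2 * (2 * c) * (2 * c) * E S + 2 * (2 * c) * (2 * d) * (E (\<lambda>\<omega>. real (kp \<omega>)) - 1)
          + 2 * (2 * c) * (2 * d) * (E (\<lambda>\<omega>. real (kp \<omega>) * S \<omega>) - E S))"
      unfolding E T S kp_def coefficients expectation_total_time(4) expectation_walking(4,5)
        total_picking_square(2) by simp
    show ?thesis unfolding sq ET coefficients
      by (simp add: power2_eq_square algebra_simps)
  qed
  have closed: "\<forall>m\<in>{2..<k}.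
        \<alpha> m = Q m 1 + (LBINT x:{0..1}. Q m x * ln (1 - x))
      \<and> \<beta> m = Q m 1 + 2 * (LBINT x:{0..1}. Q m x * ln (1 - x))
          + (LBINT x:{0..1}. x * Q m x * (LBINT y:{x..1}. (ln (1 - y))\<^sup>2 / y\<^sup>2))
      \<and> \<epsilon> m = unit_deriv (Q m) 1 - (LBINT x:{0..1}. ln (1 - x) * Q m x)
          - (LBINT x:{0..1}. (Q m 1 - x * Q m x) / (1 - x))
      \<and> \<zeta> m = unit_deriv (U m) 1 - (LBINT x:{0..1}. (U m 1 - U m x) / (1 - x))"
  proof (intro ballI conjI)
    fix m assume m: "m \<in> {2..<k}"
    show "\<alpha> m = Q m 1 + (LBINT x:{0..1}. Q m x * ln (1 - x))"
      "\<beta> m = Q m 1 + 2 * (LBINT x:{0..1}. Q m x * ln (1 - x))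
          + (LBINT x:{0..1}. x * Q m x * (LBINT y:{x..1}. (ln (1 - y))\<^sup>2 / y\<^sup>2))"
      "\<epsilon> m = unit_deriv (Q m) 1 - (LBINT x:{0..1}. ln (1 - x) * Q m x)
          - (LBINT x:{0..1}. (Q m 1 - x * Q m x) / (1 - x))"
      unfolding greek Q by (rule detour_closed_forms[OF m])+
    have "U m = (\<lambda>x. expectation (\<lambda>\<omega>. spans 1 (m + 1) \<omega> * x ^ item_count M A 1 \<omega>))"
      by (rule ext) (rule U)
    then show "\<zeta> m = unit_deriv (U m) 1 - (LBINT x:{0..1}. (U m 1 - U m x) / (1 - x))"
      unfolding greek U1 using detour_closed_forms(4)[OF m] by simp
  qed
  have closed_pair: "\<forall>m\<in>{3..<k}.
        \<gamma> m = Q m 1 + 2 * (LBINT x:{0..1}. Q m x * ln (1 - x))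
          + (LBINT x:{0..1}. LBINT y:{0..1}. ln (1 - x) * ln (1 - y) * R m x y)
      \<and> \<delta> m = unit_deriv (Q m) 1 - (LBINT x:{0..1}. (Q m 1 - Q m x) / (1 - x))"
    unfolding greek Q R using detour_pair_closed_forms by blast
  show ?thesis
    using ET ET2 closed closed_pair expectation_total_time(1,2)
      expectation_last_aisle expectation_M_last_aisle expectation_total_detour
      expectation_last_aisle_total_detour expectation_total_detour_square expectation_M_total_detour
    unfolding E S T greek P\<^sub>M_def kp_def by (intro conjI) assumption+
qed

end
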